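(* Let $\mathbb K$ be a field of characteristic $0$, let $(\mathbf C,\otimes,I,\gamma)$ be a symmetric strict monoidal $\mathrm{Ch}^{[-1,0]}_{\mathbb K}$-category and let $t:\otimes\Rightarrow\otimes$ be a totally symmetric strict infinitesimal 2-braiding on it. Then the data $$\Big(\mathbf C_{\mathbb K[h]/(h^3)},\ \otimes,\ I,\ \alpha:=1+\tfrac{h^2}{24}[t_{12},t_{23}],\ \sigma:=\gamma e^{\frac h2t},\ \mathcal H^L:=\tfrac{h^2}{24}\gamma_{1(23)}\mathsf h^L,\ \mathcal H^R:=\tfrac{h^2}{24}\gamma_{(12)3}\mathsf h^R\Big)$$ satisfies the Breen polytope axiom if and only if $t$ is coherent.
   Context: **Enriched setting.** Let $R$ be a commutative $\mathbb K$-algebra (used for $R=\mathbb K$ and $R=\mathbb K[h]/(h^3)$). $\mathrm{Ch}^{[-1,0]}_R$ denotes cochain complexes of $R$-modules concentrated in degrees $-1,0$, with the truncated tensor product (products of two degree $-1$ elements vanish and $(\partial\phi)\otimes\phi'=\phi\otimes\partial\phi'$ for degree $-1$ elements). Thus a $\mathrm{Ch}^{[-1,0]}_R$-category $\mathbf C$ has $R$-modules $\mathbf C[U,V]^0$ (1-cells) and $\mathbf C[U,V]^{-1}$ (2-cells, or homotopies), $R$-linear maps $\partial:\mathbf C[U,V]^{-1}\to\mathbf C[U,V]^0$, and an $R$-bilinear associative unital degree-preserving composition (juxtaposition) in which composites of two 2-cells vanish, $\partial(f\phi)=f\,\partial\phi$, $\partial(\phi f)=(\partial\phi)f$ and $(\partial\phi)\phi'=\phi\,\partial\phi'$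 for 1-cells $f$ and 2-cells $\phi,\phi'$. $\mathbf C\boxtimes\mathbf D$ has pairs $UV$ as objects, truncated tensor products as hom complexes, and $(f'\boxtimes g')(f\boxtimes g)=f'f\boxtimes g'g$. $\mathbf C_{\mathbb K[h]/(h^3)}$ has the same objects as $\mathbf C$, with homs tensored with $\mathbb K[h]/(h^3)$ and all structure extended linearly. **Pseudonatural transformations.** For $\mathrm{Ch}^{[-1,0]}_R$-functors $F,G:\mathbf C\to\mathbf D$, a pseudonatural transformation $\xi:F\Rightarrow G$ consists of 1-cells $\xi_U\in\mathbf D[F(U),G(U)]^0$ and $R$-linear maps $f\mapsto\xi_f$, $\mathbf C[U,U']^0\to\mathbf D[F(U),G(U')]^{-1}$, with $G(f)\xi_U-\xi_{U'}F(f)=\partial\xi_f$ for 1-cells $f$, $G(q)\xi_U-\xi_{U'}F(q)=\xi_{\partial q}$ for 2-cells $q$, $\xi_{1_U}=0$, and $\xi_{f'f}=\xi_{f'}F(f)+G(f')\xi_f$. It is $\mathrm{Ch}^{[-1,0]}_R$-natural if all $\xi_f=0$. Vertical composition: $(\theta\xi)_U=\theta_U\xi_U$, $(\theta\xi)_f=\theta_f\xi_U+\theta_{U'}\xi_f$; the identity $1$ has $1_f=0$; sums and scalar multiples are componentwise; $[\xi,\theta]=\xi\theta-\theta\xi$. If all $\xi_U$ are invertible, $\xi$ has inverse $(\xi^{-1})_U=(\xi_U)^{-1}$, $(\xi^{-1})_f=-(\xi_{U'})^{-1}\xi_f(\xi_U)^{-1}$. **Symmetric strict monoidal categories.** $(\mathbf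 C,\otimes,I,\gamma)$ consists of a $\mathrm{Ch}^{[-1,0]}_R$-category, a strictly associative and strictly unital $\mathrm{Ch}^{[-1,0]}_R$-functor $\otimes:\mathbf C\boxtimes\mathbf C\to\mathbf C$ (on objects $(UV)$; brackets in subscripts only record the grouping of arguments), and a $\mathrm{Ch}^{[-1,0]}_R$-natural isomorphism $\gamma_{UV}:(UV)\to(VU)$ with $\gamma_{VU}\gamma_{UV}=1_{(UV)}$ and $\gamma_{U(VW)}=(1_V\otimes\gamma_{UW})(\gamma_{UV}\otimes1_W)$. **Infinitesimal 2-braidings.** An infinitesimal 2-braiding is a pseudonatural transformation $t:\otimes\Rightarrow\otimes$, with components $t_{UV}$ and $t_{f\boxtimes g}\in\mathbf C[(UV),(U'V')]^{-1}$ for $f:U\to U'$, $g:V\to V'$. It is strict if for all objects $U,V,W$ and 1-cells $f:U\to U'$, $g:V\to V'$, $k:W\to W'$: $t_{U(VW)}=t_{UV}\otimes1_W+(\gamma_{VU}\otimes1_W)(1_V\otimes t_{UW})(\gamma_{UV}\otimes1_W)$, $t_{f\boxtimes(g\otimes k)}=t_{f\boxtimes g}\otimes k+(\gamma_{V'U'}\otimes1_{W'})(g\otimes t_{f\boxtimes k})(\gamma_{UV}\otimes1_W)$, $t_{(UV)W}=1_U\otimes t_{VW}+(1_U\otimes\gamma_{WV})(t_{UW}\otimes1_V)(1_U\otimes\gamma_{VW})$, $t_{(f\otimes g)\boxtimes k}=f\otimes t_{g\boxtimes k}+(1_{U'}\otimes\gamma_{W'V'})(t_{f\boxtimes k}\otimes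 g)(1_U\otimes\gamma_{VW})$. It is symmetric if $\gamma_{UV}t_{UV}=t_{VU}\gamma_{UV}$ and $\gamma_{U'V'}t_{f\boxtimes g}=t_{g\boxtimes f}\gamma_{UV}$; it is totally symmetric if it is symmetric and $t_{\gamma_{UV}\boxtimes1_W}=0$ for all $U,V,W$. It is coherent if for all $U,V,W$ $$-(\gamma_{VU}\otimes1_W)t_{1_V\boxtimes t_{UW}}(\gamma_{UV}\otimes1_W)=t_{t_{UV}\boxtimes1_W}+t_{1_U\boxtimes t_{VW}}=-(1_U\otimes\gamma_{WV})t_{t_{UW}\boxtimes1_V}(1_U\otimes\gamma_{VW}).$$ **The data.** $t_{12},t_{23}$ are the pseudonatural endomorphisms of $\otimes^2:\mathbf C^{\boxtimes3}\to\mathbf C$ with components $(t_{12})_{UVW}=t_{UV}\otimes1_W$, $(t_{12})_{f\boxtimes g\boxtimes k}=t_{f\boxtimes g}\otimes k$, $(t_{23})_{UVW}=1_U\otimes t_{VW}$, $(t_{23})_{f\boxtimes g\boxtimes k}=f\otimes t_{g\boxtimes k}$. $\gamma e^{\frac h2t}=\gamma(1+\frac h2t+\frac{h^2}8t^2)$ modulo $h^3$. The four-term relationators have components $\mathcal L_{UVW}=t_{t_{UV}\boxtimes1_W}$ and $\mathcal R_{UVW}=t_{1_U\boxtimes t_{VW}}$, and $\mathsf h^L=2\mathcal L+\mathcal R$, $\mathsf h^R=\mathcal L+2\mathcal R$. Hence $\mathcal H^L_{UVW}=\frac{h^2}{24}\gamma_{U(VW)}(2\mathcal L_{UVW}+\mathcal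 R_{UVW})$ and $\mathcal H^R_{UVW}=\frac{h^2}{24}\gamma_{(UV)W}(\mathcal L_{UVW}+2\mathcal R_{UVW})$. **Breen polytope axiom.** For all objects $U,V,W$, $$-\alpha_{WVU}(\sigma_{VW}\otimes1_U)\alpha^{-1}_{VWU}\mathcal H^L_{UVW}+\alpha_{WVU}\,\sigma_{1_U\boxtimes\sigma_{VW}}\,\alpha_{UVW}+\mathcal H^L_{UWV}\alpha^{-1}_{UWV}(1_U\otimes\sigma_{VW})\alpha_{UVW}$$ $$=-\alpha_{WVU}\mathcal H^R_{VUW}\alpha_{VUW}(\sigma_{UV}\otimes1_W)-\sigma_{\sigma_{UV}\boxtimes1_W}+(1_W\otimes\sigma_{UV})\alpha_{WUV}\mathcal H^R_{UVW}\alpha_{UVW},$$ where $\sigma_{f\boxtimes g}$ denotes a homotopy component of $\sigma$. *)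

theory Defs
  imports
    "HOL-Computational_Algebra.Polynomial"
    "HOL-Library.Function_Algebras"
    "HOL-Algebra.Module"
begin

hide_const (open) Polynomial.smult

section \<open>Modules and linear maps\<close>

text \<open>A commutative ring of scalars is a type of class \<^class>\<open>comm_ring_1\<close>; hom modules are
  modules in the sense of HOL-Algebra over the following ring.\<close>

definition scalars :: "'r::comm_ring_1 ring" where
  "scalars = \<lparr>carrier = UNIV, monoid.mult = (*), one = 1, ring.zero = 0, add = (+)\<rparr>"

definition linear_map :: "('r, 'a) module \<Rightarrow> ('r, 'b) module \<Rightarrow> ('a \<Rightarrow> 'b) \<Rightarrow> bool" where
  "linear_map M N \<phi> \<longleftrightarrow>
     (\<forall>x\<in>carrier M. \<phi> x \<in> carrier N) \<and>
     (\<forall>x\<in>carrier M. \<forall>y\<in>carrier M. \<phi> (x \<oplus>\<^bsub>M\<^esub> y) = \<phi> x \<oplus>\<^bsub>N\<^esub> \<phi> y) \<and>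
     (\<forall>r. \<forall>x\<in>carrier M. \<phi> (r \<odot>\<^bsub>M\<^esub> x) = r \<odot>\<^bsub>N\<^esub> \<phi> x)"

definition bilinear_map ::
  "('r, 'a) module \<Rightarrow> ('r, 'b) module \<Rightarrow> ('r, 'c) module \<Rightarrow> ('a \<Rightarrow> 'b \<Rightarrow> 'c) \<Rightarrow> bool" where
  "bilinear_map M N P \<beta> \<longleftrightarrow>
     (\<forall>x\<in>carrier M. linear_map N P (\<beta> x)) \<and> (\<forall>y\<in>carrier N. linear_map M P (\<lambda>x. \<beta> x y))"

section \<open>Modules given by generators and relations\<close>

text \<open>The free module on a set \<open>X\<close> consists of the finitely supported functions on \<open>X\<close>;
  the module presented by generators \<open>X\<close> and relations \<open>S\<close> consists of cosets of the span
  of \<open>S\<close>. Operations on cosets are computed on representatives.\<close>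

definition formal_sums :: "'x set \<Rightarrow> ('x \<Rightarrow> 'r::comm_ring_1) set" where
  "formal_sums X = {p. finite {x. p x \<noteq> 0} \<and> {x. p x \<noteq> 0} \<subseteq> X}"

definition gen :: "'x \<Rightarrow> 'x \<Rightarrow> 'r::comm_ring_1" where
  "gen x = (\<lambda>y. if y = x then 1 else 0)"

definition relcoset :: "('x \<Rightarrow> 'r::comm_ring_1) set \<Rightarrow> ('x \<Rightarrow> 'r) \<Rightarrow> ('x \<Rightarrow> 'r) set" where
  "relcoset S p = {q. q - p \<in> Modules.module.span (\<lambda>r p x. r * p x) S}"

definition rep :: "('x \<Rightarrow> 'r) set \<Rightarrow> 'x \<Rightarrow> 'r" where
  "rep P = (SOME p. p \<in> P)"

definition presented ::
  "'x set \<Rightarrow> ('x \<Rightarrow> 'r::comm_ring_1) set \<Rightarrow> ('r, ('x \<Rightarrow> 'r) set) module" where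
  "presented X S =
     \<lparr>carrier = relcoset S ` formal_sums X, monoid.mult = undefined, one = undefined,
      ring.zero = relcoset S 0, add = (\<lambda>P Q. relcoset S (rep P + rep Q)),
      smult = (\<lambda>r P. relcoset S (\<lambda>x. r * rep P x))\<rparr>"

text \<open>Linear extensions to formal sums of maps and operations on generators, with values
  in formal sums (\<open>push\<close>, \<open>push2\<close>) or in a module (\<open>lin_ext\<close>).\<close>

definition push :: "('x \<Rightarrow> 'y) \<Rightarrow> ('x \<Rightarrow> 'r::comm_ring_1) \<Rightarrow> 'y \<Rightarrow> 'r" where
  "push \<phi> p = (\<lambda>z. \<Sum>x | p x \<noteq> 0 \<and> \<phi> x = z. p x)"

definition push2 ::
  "('x \<Rightarrow> 'y \<Rightarrow> 'z) \<Rightarrow> ('x \<Rightarrow> 'r::comm_ring_1) \<Rightarrow> ('y \<Rightarrow> 'r) \<Rightarrow> 'z \<Rightarrow> 'r" where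
  "push2 \<beta> p q = (\<lambda>z. \<Sum>(x, y) | p x \<noteq> 0 \<and> q y \<noteq> 0 \<and> \<beta> x y = z. p x * q y)"

definition lin_ext ::
  "('r::comm_ring_1, 'm) module \<Rightarrow> ('x \<Rightarrow> 'm) \<Rightarrow> ('x \<Rightarrow> 'r) \<Rightarrow> 'm" where
  "lin_ext N \<phi> p = finsum N (\<lambda>x. p x \<odot>\<^bsub>N\<^esub> \<phi> x) {x. p x \<noteq> 0}"

text \<open>Defining relations of the tensor product of \<open>M\<close> and \<open>N\<close>; the pair \<open>(m, n)\<close>
  is entered as the generator \<open>\<iota> (m, n)\<close>.\<close>

definition tensor_rels ::
  "('r::comm_ring_1, 'a) module \<Rightarrow> ('r, 'b) module \<Rightarrow> ('a \<times> 'b \<Rightarrow> 'x) \<Rightarrow> ('x \<Rightarrow> 'r) set" where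
  "tensor_rels M N \<iota> =
     {gen (\<iota> (m \<oplus>\<^bsub>M\<^esub> m', n)) - gen (\<iota> (m, n)) - gen (\<iota> (m', n)) | m m' n.
        m \<in> carrier M \<and> m' \<in> carrier M \<and> n \<in> carrier N} \<union>
     {gen (\<iota> (m, n \<oplus>\<^bsub>N\<^esub> n')) - gen (\<iota> (m, n)) - gen (\<iota> (m, n')) | m n n'.
        m \<in> carrier M \<and> n \<in> carrier N \<and> n' \<in> carrier N} \<union>
     {gen (\<iota> (r \<odot>\<^bsub>M\<^esub> m, n)) - (\<lambda>x. r * gen (\<iota> (m, n)) x) | r m n.
        m \<in> carrier M \<and> n \<in> carrier N} \<union>
     {gen (\<iota> (m, r \<odot>\<^bsub>N\<^esub> n)) - (\<lambda>x. r * gen (\<iota> (m, n)) x) | r m n.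
        m \<in> carrier M \<and> n \<in> carrier N}"

section \<open>Categories enriched in cochain complexes in degrees -1 and 0\<close>

text \<open>Cells carry their source and target, so that composition needs no object subscripts.
  The three compositions are those of two 1-cells, of a 1-cell after a 2-cell, and of a
  2-cell after a 1-cell; composites of two 2-cells vanish for degree reasons and are not
  recorded.\<close>

record ('r, 'o, 'a, 'b) ch_cat =
  hom0 :: "'o \<Rightarrow> 'o \<Rightarrow> ('r, 'a) module"
  hom1 :: "'o \<Rightarrow> 'o \<Rightarrow> ('r, 'b) module"
  src0 :: "'a \<Rightarrow> 'o"
  tgt0 :: "'a \<Rightarrow> 'o"
  src1 :: "'b \<Rightarrow> 'o"
  tgt1 :: "'b \<Rightarrow> 'o"
  bd :: "'b \<Rightarrow> 'a"
  idc :: "'o \<Rightarrow> 'a"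
  comp0 :: "'a \<Rightarrow> 'a \<Rightarrow> 'a" (infixl "\<bullet>\<index>" 70)
  lcomp :: "'a \<Rightarrow> 'b \<Rightarrow> 'b" (infixl "\<triangleright>\<index>" 70)
  rcomp :: "'b \<Rightarrow> 'a \<Rightarrow> 'b" (infixl "\<triangleleft>\<index>" 70)

locale ch_category =
  fixes C :: "('r::comm_ring_1, 'o, 'a, 'b) ch_cat" (structure)
  assumes module0: "Module.module scalars (hom0 C U V)"
    and module1: "Module.module scalars (hom1 C U V)"
    and ends0: "f \<in> carrier (hom0 C U V) \<Longrightarrow> src0 C f = U \<and> tgt0 C f = V"
    and ends1: "\<phi> \<in> carrier (hom1 C U V) \<Longrightarrow> src1 C \<phi> = U \<and> tgt1 C \<phi> = V"
    and bd_linear: "linear_map (hom1 C U V) (hom0 C U V) (bd C)"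
    and id_cell: "idc C U \<in> carrier (hom0 C U U)"
    and comp0_bilinear: "bilinear_map (hom0 C V W) (hom0 C U V) (hom0 C U W) (\<bullet>)"
    and lcomp_bilinear: "bilinear_map (hom0 C V W) (hom1 C U V) (hom1 C U W) (\<triangleright>)"
    and rcomp_bilinear: "bilinear_map (hom1 C V W) (hom0 C U V) (hom1 C U W) (\<triangleleft>)"
    and comp0_id: "f \<in> carrier (hom0 C U V) \<Longrightarrow> f \<bullet> idc C U = f \<and> idc C V \<bullet> f = f"
    and comp1_id: "\<phi> \<in> carrier (hom1 C U V) \<Longrightarrow> \<phi> \<triangleleft> idc C U = \<phi> \<and> idc C V \<triangleright> \<phi> = \<phi>"
    and assoc000: "\<lbrakk>h \<in> carrier (hom0 C W X); g \<in> carrier (hom0 C V W); f \<in> carrier (hom0 C U V)\<rbrakk>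
        \<Longrightarrow> (h \<bullet> g) \<bullet> f = h \<bullet> (g \<bullet> f)"
    and assoc001: "\<lbrakk>h \<in> carrier (hom0 C W X); g \<in> carrier (hom0 C V W); \<phi> \<in> carrier (hom1 C U V)\<rbrakk>
        \<Longrightarrow> (h \<bullet> g) \<triangleright> \<phi> = h \<triangleright> (g \<triangleright> \<phi>)"
    and assoc010: "\<lbrakk>h \<in> carrier (hom0 C W X); \<phi> \<in> carrier (hom1 C V W); f \<in> carrier (hom0 C U V)\<rbrakk>
        \<Longrightarrow> (h \<triangleright> \<phi>) \<triangleleft> f = h \<triangleright> (\<phi> \<triangleleft> f)"
    and assoc100: "\<lbrakk>\<phi> \<in> carrier (hom1 C W X); g \<in> carrier (hom0 C V W); f \<in> carrier (hom0 C U V)\<rbrakk>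
        \<Longrightarrow> (\<phi> \<triangleleft> g) \<triangleleft> f = \<phi> \<triangleleft> (g \<bullet> f)"
    and bd_lcomp: "\<lbrakk>f \<in> carrier (hom0 C V W); \<phi> \<in> carrier (hom1 C U V)\<rbrakk>
        \<Longrightarrow> bd C (f \<triangleright> \<phi>) = f \<bullet> bd C \<phi>"
    and bd_rcomp: "\<lbrakk>\<phi> \<in> carrier (hom1 C V W); f \<in> carrier (hom0 C U V)\<rbrakk>
        \<Longrightarrow> bd C (\<phi> \<triangleleft> f) = bd C \<phi> \<bullet> f"
    and bd_swap: "\<lbrakk>\<phi> \<in> carrier (hom1 C V W); \<phi>' \<in> carrier (hom1 C U V)\<rbrakk>
        \<Longrightarrow> bd C \<phi> \<triangleright> \<phi>' = \<phi> \<triangleleft> bd C \<phi>'"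

text \<open>Module operations of the hom containing the first argument.\<close>

definition add0 :: "('r, 'o, 'a, 'b) ch_cat \<Rightarrow> 'a \<Rightarrow> 'a \<Rightarrow> 'a" (infixl "+\<^sub>0\<index>" 65) where
  "f +\<^sub>0\<^bsub>C\<^esub> g = f \<oplus>\<^bsub>hom0 C (src0 C f) (tgt0 C f)\<^esub> g"

definition diff0 :: "('r, 'o, 'a, 'b) ch_cat \<Rightarrow> 'a \<Rightarrow> 'a \<Rightarrow> 'a" (infixl "-\<^sub>0\<index>" 65) where
  "f -\<^sub>0\<^bsub>C\<^esub> g = f \<ominus>\<^bsub>hom0 C (src0 C f) (tgt0 C f)\<^esub> g"

definition scale0 :: "('r, 'o, 'a, 'b) ch_cat \<Rightarrow> 'r \<Rightarrow> 'a \<Rightarrow> 'a" where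
  "scale0 C r f = r \<odot>\<^bsub>hom0 C (src0 C f) (tgt0 C f)\<^esub> f"

definition add1 :: "('r, 'o, 'a, 'b) ch_cat \<Rightarrow> 'b \<Rightarrow> 'b \<Rightarrow> 'b" (infixl "+\<^sub>1\<index>" 65) where
  "\<phi> +\<^sub>1\<^bsub>C\<^esub> \<psi> = \<phi> \<oplus>\<^bsub>hom1 C (src1 C \<phi>) (tgt1 C \<phi>)\<^esub> \<psi>"

definition diff1 :: "('r, 'o, 'a, 'b) ch_cat \<Rightarrow> 'b \<Rightarrow> 'b \<Rightarrow> 'b" (infixl "-\<^sub>1\<index>" 65) where
  "\<phi> -\<^sub>1\<^bsub>C\<^esub> \<psi> = \<phi> \<ominus>\<^bsub>hom1 C (src1 C \<phi>) (tgt1 C \<phi>)\<^esub> \<psi>"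

definition neg1 :: "('r, 'o, 'a, 'b) ch_cat \<Rightarrow> 'b \<Rightarrow> 'b" where
  "neg1 C \<phi> = \<ominus>\<^bsub>hom1 C (src1 C \<phi>) (tgt1 C \<phi>)\<^esub> \<phi>"

definition scale1 :: "('r, 'o, 'a, 'b) ch_cat \<Rightarrow> 'r \<Rightarrow> 'b \<Rightarrow> 'b" where
  "scale1 C r \<phi> = r \<odot>\<^bsub>hom1 C (src1 C \<phi>) (tgt1 C \<phi>)\<^esub> \<phi>"

definition inverse0 :: "('r, 'o, 'a, 'b) ch_cat \<Rightarrow> 'a \<Rightarrow> 'a" where
  "inverse0 C f = (THE g. g \<in> carrier (hom0 C (tgt0 C f) (src0 C f)) \<and>
     g \<bullet>\<^bsub>C\<^esub> f = idc C (src0 C f) \<and> f \<bullet>\<^bsub>C\<^esub> g = idc C (tgt0 C f))"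

record ('o, 'a, 'b, 'p, 'c, 'd) ch_fun =
  fob :: "'o \<Rightarrow> 'p"
  fmap0 :: "'a \<Rightarrow> 'c"
  fmap1 :: "'b \<Rightarrow> 'd"

locale ch_functor = dom: ch_category C + cod: ch_category D
  for C :: "('r::comm_ring_1, 'o, 'a, 'b) ch_cat"
    and D :: "('r, 'p, 'c, 'd) ch_cat"
    and F :: "('o, 'a, 'b, 'p, 'c, 'd) ch_fun" +
  assumes fmap0_linear: "linear_map (hom0 C U V) (hom0 D (fob F U) (fob F V)) (fmap0 F)"
    and fmap1_linear: "linear_map (hom1 C U V) (hom1 D (fob F U) (fob F V)) (fmap1 F)"
    and fmap_bd: "\<phi> \<in> carrier (hom1 C U V) \<Longrightarrow> fmap0 F (bd C \<phi>) = bd D (fmap1 F \<phi>)"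
    and fmap_id: "fmap0 F (idc C U) = idc D (fob F U)"
    and fmap_comp0: "\<lbrakk>g \<in> carrier (hom0 C V W); f \<in> carrier (hom0 C U V)\<rbrakk>
        \<Longrightarrow> fmap0 F (g \<bullet>\<^bsub>C\<^esub> f) = fmap0 F g \<bullet>\<^bsub>D\<^esub> fmap0 F f"
    and fmap_lcomp: "\<lbrakk>g \<in> carrier (hom0 C V W); \<phi> \<in> carrier (hom1 C U V)\<rbrakk>
        \<Longrightarrow> fmap1 F (g \<triangleright>\<^bsub>C\<^esub> \<phi>) = fmap0 F g \<triangleright>\<^bsub>D\<^esub> fmap1 F \<phi>"
    and fmap_rcomp: "\<lbrakk>\<phi> \<in> carrier (hom1 C V W); f \<in> carrier (hom0 C U V)\<rbrakk>
        \<Longrightarrow> fmap1 F (\<phi> \<triangleleft>\<^bsub>C\<^esub> f) = fmap1 F \<phi> \<triangleleft>\<^bsub>D\<^esub> fmap0 F f"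

definition id_fun :: "('o, 'a, 'b, 'o, 'a, 'b) ch_fun" where
  "id_fun = \<lparr>fob = id, fmap0 = id, fmap1 = id\<rparr>"

definition fun_comp ::
  "('p, 'c, 'd, 'q, 'e, 'f) ch_fun \<Rightarrow> ('o, 'a, 'b, 'p, 'c, 'd) ch_fun
   \<Rightarrow> ('o, 'a, 'b, 'q, 'e, 'f) ch_fun" where
  "fun_comp G F =
     \<lparr>fob = fob G \<circ> fob F, fmap0 = fmap0 G \<circ> fmap0 F, fmap1 = fmap1 G \<circ> fmap1 F\<rparr>"

section \<open>Pseudonatural transformations\<close>

record ('o, 'a, 'c, 'd) pnat =
  pob :: "'o \<Rightarrow> 'c"
  phtpy :: "'a \<Rightarrow> 'd"

locale pseudonatural = F: ch_functor C D F + G: ch_functor C D G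
  for C :: "('r::comm_ring_1, 'o, 'a, 'b) ch_cat"
    and D :: "('r, 'p, 'c, 'd) ch_cat"
    and F G :: "('o, 'a, 'b, 'p, 'c, 'd) ch_fun" +
  fixes \<xi> :: "('o, 'a, 'c, 'd) pnat"
  assumes pob_cell: "pob \<xi> U \<in> carrier (hom0 D (fob F U) (fob G U))"
    and phtpy_linear: "linear_map (hom0 C U U') (hom1 D (fob F U) (fob G U')) (phtpy \<xi>)"
    and pnat0: "f \<in> carrier (hom0 C U U') \<Longrightarrow>
        fmap0 G f \<bullet>\<^bsub>D\<^esub> pob \<xi> U -\<^sub>0\<^bsub>D\<^esub> pob \<xi> U' \<bullet>\<^bsub>D\<^esub> fmap0 F f = bd D (phtpy \<xi> f)"
    and pnat1: "q \<in> carrier (hom1 C U U') \<Longrightarrow>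
        fmap1 G q \<triangleleft>\<^bsub>D\<^esub> pob \<xi> U -\<^sub>1\<^bsub>D\<^esub> pob \<xi> U' \<triangleright>\<^bsub>D\<^esub> fmap1 F q = phtpy \<xi> (bd C q)"
    and phtpy_id: "phtpy \<xi> (idc C U) = \<zero>\<^bsub>hom1 D (fob F U) (fob G U)\<^esub>"
    and phtpy_comp: "\<lbrakk>f' \<in> carrier (hom0 C U' U''); f \<in> carrier (hom0 C U U')\<rbrakk> \<Longrightarrow>
        phtpy \<xi> (f' \<bullet>\<^bsub>C\<^esub> f) =
          phtpy \<xi> f' \<triangleleft>\<^bsub>D\<^esub> fmap0 F f +\<^sub>1\<^bsub>D\<^esub> fmap0 G f' \<triangleright>\<^bsub>D\<^esub> phtpy \<xi> f"

locale ch_natural = pseudonatural C D F G \<xi>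
  for C :: "('r::comm_ring_1, 'o, 'a, 'b) ch_cat"
    and D :: "('r, 'p, 'c, 'd) ch_cat"
    and F G :: "('o, 'a, 'b, 'p, 'c, 'd) ch_fun"
    and \<xi> :: "('o, 'a, 'c, 'd) pnat" +
  assumes phtpy_zero: "f \<in> carrier (hom0 C U U') \<Longrightarrow>
      phtpy \<xi> f = \<zero>\<^bsub>hom1 D (fob F U) (fob G U')\<^esub>"

definition pn_id :: "('r, 'o, 'a, 'b) ch_cat \<Rightarrow> ('r, 'p, 'c, 'd) ch_cat \<Rightarrow>
    ('o, 'a, 'b, 'p, 'c, 'd) ch_fun \<Rightarrow> ('o, 'a, 'c, 'd) pnat" where
  "pn_id C D F = \<lparr>pob = (\<lambda>U. idc D (fob F U)),
     phtpy = (\<lambda>f. \<zero>\<^bsub>hom1 D (fob F (src0 C f)) (fob F (tgt0 C f))\<^esub>)\<rparr>"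

definition pn_comp :: "('r, 'o, 'a, 'b) ch_cat \<Rightarrow> ('r, 'p, 'c, 'd) ch_cat \<Rightarrow>
    ('o, 'a, 'c, 'd) pnat \<Rightarrow> ('o, 'a, 'c, 'd) pnat \<Rightarrow> ('o, 'a, 'c, 'd) pnat" where
  "pn_comp C D \<theta> \<xi> = \<lparr>pob = (\<lambda>U. pob \<theta> U \<bullet>\<^bsub>D\<^esub> pob \<xi> U),
     phtpy = (\<lambda>f. phtpy \<theta> f \<triangleleft>\<^bsub>D\<^esub> pob \<xi> (src0 C f) +\<^sub>1\<^bsub>D\<^esub> pob \<theta> (tgt0 C f) \<triangleright>\<^bsub>D\<^esub> phtpy \<xi> f)\<rparr>"

definition pn_add :: "('r, 'p, 'c, 'd) ch_cat \<Rightarrow>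
    ('o, 'a, 'c, 'd) pnat \<Rightarrow> ('o, 'a, 'c, 'd) pnat \<Rightarrow> ('o, 'a, 'c, 'd) pnat" where
  "pn_add D \<theta> \<xi> = \<lparr>pob = (\<lambda>U. pob \<theta> U +\<^sub>0\<^bsub>D\<^esub> pob \<xi> U),
     phtpy = (\<lambda>f. phtpy \<theta> f +\<^sub>1\<^bsub>D\<^esub> phtpy \<xi> f)\<rparr>"

definition pn_diff :: "('r, 'p, 'c, 'd) ch_cat \<Rightarrow>
    ('o, 'a, 'c, 'd) pnat \<Rightarrow> ('o, 'a, 'c, 'd) pnat \<Rightarrow> ('o, 'a, 'c, 'd) pnat" where
  "pn_diff D \<theta> \<xi> = \<lparr>pob = (\<lambda>U. pob \<theta> U -\<^sub>0\<^bsub>D\<^esub> pob \<xi> U),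
     phtpy = (\<lambda>f. phtpy \<theta> f -\<^sub>1\<^bsub>D\<^esub> phtpy \<xi> f)\<rparr>"

definition pn_scale :: "('r, 'p, 'c, 'd) ch_cat \<Rightarrow>
    'r \<Rightarrow> ('o, 'a, 'c, 'd) pnat \<Rightarrow> ('o, 'a, 'c, 'd) pnat" where
  "pn_scale D r \<xi> = \<lparr>pob = (\<lambda>U. scale0 D r (pob \<xi> U)), phtpy = (\<lambda>f. scale1 D r (phtpy \<xi> f))\<rparr>"

definition pn_commutator :: "('r, 'o, 'a, 'b) ch_cat \<Rightarrow> ('r, 'p, 'c, 'd) ch_cat \<Rightarrow>
    ('o, 'a, 'c, 'd) pnat \<Rightarrow> ('o, 'a, 'c, 'd) pnat \<Rightarrow> ('o, 'a, 'c, 'd) pnat" where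
  "pn_commutator C D \<xi> \<theta> = pn_diff D (pn_comp C D \<xi> \<theta>) (pn_comp C D \<theta> \<xi>)"

definition pn_inverse :: "('r, 'o, 'a, 'b) ch_cat \<Rightarrow> ('r, 'p, 'c, 'd) ch_cat \<Rightarrow>
    ('o, 'a, 'c, 'd) pnat \<Rightarrow> ('o, 'a, 'c, 'd) pnat" where
  "pn_inverse C D \<xi> = \<lparr>pob = (\<lambda>U. inverse0 D (pob \<xi> U)),
     phtpy = (\<lambda>f. neg1 D (inverse0 D (pob \<xi> (tgt0 C f)) \<triangleright>\<^bsub>D\<^esub> phtpy \<xi> f
                            \<triangleleft>\<^bsub>D\<^esub> inverse0 D (pob \<xi> (src0 C f))))\<rparr>"

section \<open>The truncated tensor product of categories\<close>

text \<open>A cell of the tensor product is a triple of source, target and an element of the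
  truncated tensor product complex. In degree -1 the latter is generated by the tensors of
  a 2-cell with a 1-cell (left summand) and of a 1-cell with a 2-cell (right summand).\<close>

type_synonym ('r, 'o, 'p, 'a, 'c) box0 =
  "('o \<times> 'p) \<times> ('o \<times> 'p) \<times> ('a \<times> 'c \<Rightarrow> 'r) set"

type_synonym ('r, 'o, 'p, 'a, 'b, 'c, 'd) box1 =
  "('o \<times> 'p) \<times> ('o \<times> 'p) \<times> ((('b \<times> 'c) + ('a \<times> 'd)) \<Rightarrow> 'r) set"

definition tagged :: "'o \<Rightarrow> 'o \<Rightarrow> ('r, 'x) module \<Rightarrow> ('r, 'o \<times> 'o \<times> 'x) module" where
  "tagged A B M =
     \<lparr>carrier = (\<lambda>x. (A, B, x)) ` carrier M, monoid.mult = undefined, one = undefined,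
      ring.zero = (A, B, \<zero>\<^bsub>M\<^esub>), add = (\<lambda>(_, _, x) (_, _, y). (A, B, x \<oplus>\<^bsub>M\<^esub> y)),
      smult = (\<lambda>r (_, _, x). (A, B, r \<odot>\<^bsub>M\<^esub> x))\<rparr>"

definition box_gens0 :: "('r::comm_ring_1, 'o, 'a, 'b) ch_cat \<Rightarrow> ('r, 'p, 'c, 'd) ch_cat \<Rightarrow>
    'o \<times> 'p \<Rightarrow> 'o \<times> 'p \<Rightarrow> ('a \<times> 'c) set" where
  "box_gens0 C D A B =
     carrier (hom0 C (fst A) (fst B)) \<times> carrier (hom0 D (snd A) (snd B))"

definition box_rels0 :: "('r::comm_ring_1, 'o, 'a, 'b) ch_cat \<Rightarrow> ('r, 'p, 'c, 'd) ch_cat \<Rightarrow>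
    'o \<times> 'p \<Rightarrow> 'o \<times> 'p \<Rightarrow> ('a \<times> 'c \<Rightarrow> 'r) set" where
  "box_rels0 C D A B = tensor_rels (hom0 C (fst A) (fst B)) (hom0 D (snd A) (snd B)) id"

definition box_gens1 :: "('r::comm_ring_1, 'o, 'a, 'b) ch_cat \<Rightarrow> ('r, 'p, 'c, 'd) ch_cat \<Rightarrow>
    'o \<times> 'p \<Rightarrow> 'o \<times> 'p \<Rightarrow> ('b \<times> 'c + 'a \<times> 'd) set" where
  "box_gens1 C D A B =
     (carrier (hom1 C (fst A) (fst B)) \<times> carrier (hom0 D (snd A) (snd B))) <+>
     (carrier (hom0 C (fst A) (fst B)) \<times> carrier (hom1 D (snd A) (snd B)))"

definition box_rels1 :: "('r::comm_ring_1, 'o, 'a, 'b) ch_cat \<Rightarrow> ('r, 'p, 'c, 'd) ch_cat \<Rightarrow>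
    'o \<times> 'p \<Rightarrow> 'o \<times> 'p \<Rightarrow> ('b \<times> 'c + 'a \<times> 'd \<Rightarrow> 'r) set" where
  "box_rels1 C D A B =
     tensor_rels (hom1 C (fst A) (fst B)) (hom0 D (snd A) (snd B)) Inl \<union>
     tensor_rels (hom0 C (fst A) (fst B)) (hom1 D (snd A) (snd B)) Inr \<union>
     {gen (Inr (bd C \<phi>, \<phi>')) - gen (Inl (\<phi>, bd D \<phi>')) | \<phi> \<phi>'.
        \<phi> \<in> carrier (hom1 C (fst A) (fst B)) \<and> \<phi>' \<in> carrier (hom1 D (snd A) (snd B))}"

definition box :: "('r::comm_ring_1, 'o, 'a, 'b) ch_cat \<Rightarrow> ('r, 'p, 'c, 'd) ch_cat \<Rightarrow>
    ('r, 'o \<times> 'p, ('r, 'o, 'p, 'a, 'c) box0, ('r, 'o, 'p, 'a, 'b, 'c, 'd) box1) ch_cat" where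
  "box C D =
     \<lparr>hom0 = (\<lambda>A B. tagged A B (presented (box_gens0 C D A B) (box_rels0 C D A B))),
      hom1 = (\<lambda>A B. tagged A B (presented (box_gens1 C D A B) (box_rels1 C D A B))),
      src0 = fst, tgt0 = fst \<circ> snd, src1 = fst, tgt1 = fst \<circ> snd,
      bd = (\<lambda>(A, B, X). (A, B, relcoset (box_rels0 C D A B)
              (push (case_sum (\<lambda>(\<phi>, g). (bd C \<phi>, g)) (\<lambda>(f, \<psi>). (f, bd D \<psi>))) (rep X)))),
      idc = (\<lambda>A. (A, A, relcoset (box_rels0 C D A A) (gen (idc C (fst A), idc D (snd A))))),
      comp0 = (\<lambda>(_, B, X) (A, _, Y). (A, B, relcoset (box_rels0 C D A B)
              (push2 (\<lambda>(f', g') (f, g). (f' \<bullet>\<^bsub>C\<^esub> f, g' \<bullet>\<^bsub>D\<^esub> g)) (rep X) (rep Y)))),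
      lcomp = (\<lambda>(_, B, X) (A, _, Y). (A, B, relcoset (box_rels1 C D A B)
              (push2 (\<lambda>(f', g'). case_sum (\<lambda>(\<phi>, g). Inl (f' \<triangleright>\<^bsub>C\<^esub> \<phi>, g' \<bullet>\<^bsub>D\<^esub> g))
                                          (\<lambda>(f, \<psi>). Inr (f' \<bullet>\<^bsub>C\<^esub> f, g' \<triangleright>\<^bsub>D\<^esub> \<psi>)))
                 (rep X) (rep Y)))),
      rcomp = (\<lambda>(_, B, X) (A, _, Y). (A, B, relcoset (box_rels1 C D A B)
              (push2 (\<lambda>z (f, g). case_sum (\<lambda>(\<phi>, g'). Inl (\<phi> \<triangleleft>\<^bsub>C\<^esub> f, g' \<bullet>\<^bsub>D\<^esub> g))
                                          (\<lambda>(f', \<psi>). Inr (f' \<bullet>\<^bsub>C\<^esub> f, \<psi> \<triangleleft>\<^bsub>D\<^esub> g)) z)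
                 (rep X) (rep Y))))\<rparr>"

text \<open>The pure tensors of two 1-cells, of a 2-cell with a 1-cell and of a 1-cell with a 2-cell.\<close>

definition pure00 :: "('r::comm_ring_1, 'o, 'a, 'b) ch_cat \<Rightarrow> ('r, 'p, 'c, 'd) ch_cat \<Rightarrow>
    'a \<Rightarrow> 'c \<Rightarrow> ('r, 'o, 'p, 'a, 'c) box0" where
  "pure00 C D f g = (let A = (src0 C f, src0 D g); B = (tgt0 C f, tgt0 D g)
     in (A, B, relcoset (box_rels0 C D A B) (gen (f, g))))"

definition pure10 :: "('r::comm_ring_1, 'o, 'a, 'b) ch_cat \<Rightarrow> ('r, 'p, 'c, 'd) ch_cat \<Rightarrow>
    'b \<Rightarrow> 'c \<Rightarrow> ('r, 'o, 'p, 'a, 'b, 'c, 'd) box1" where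
  "pure10 C D \<phi> g = (let A = (src1 C \<phi>, src0 D g); B = (tgt1 C \<phi>, tgt0 D g)
     in (A, B, relcoset (box_rels1 C D A B) (gen (Inl (\<phi>, g)))))"

definition pure01 :: "('r::comm_ring_1, 'o, 'a, 'b) ch_cat \<Rightarrow> ('r, 'p, 'c, 'd) ch_cat \<Rightarrow>
    'a \<Rightarrow> 'd \<Rightarrow> ('r, 'o, 'p, 'a, 'b, 'c, 'd) box1" where
  "pure01 C D f \<psi> = (let A = (src0 C f, src1 D \<psi>); B = (tgt0 C f, tgt1 D \<psi>)
     in (A, B, relcoset (box_rels1 C D A B) (gen (Inr (f, \<psi>)))))"

definition box_fun :: "('r::comm_ring_1, 'o', 'a', 'b') ch_cat \<Rightarrow> ('r, 'p', 'c', 'd') ch_cat \<Rightarrow>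
    ('o, 'a, 'b, 'o', 'a', 'b') ch_fun \<Rightarrow> ('p, 'c, 'd, 'p', 'c', 'd') ch_fun \<Rightarrow>
    ('o \<times> 'p, ('r, 'o, 'p, 'a, 'c) box0, ('r, 'o, 'p, 'a, 'b, 'c, 'd) box1,
     'o' \<times> 'p', ('r, 'o', 'p', 'a', 'c') box0, ('r, 'o', 'p', 'a', 'b', 'c', 'd') box1) ch_fun" where
  "box_fun C' D' F G = (let ob = map_prod (fob F) (fob G) in
     \<lparr>fob = ob,
      fmap0 = (\<lambda>(A, B, X). (ob A, ob B, relcoset (box_rels0 C' D' (ob A) (ob B))
        (push (map_prod (fmap0 F) (fmap0 G)) (rep X)))),
      fmap1 = (\<lambda>(A, B, X). (ob A, ob B, relcoset (box_rels1 C' D' (ob A) (ob B))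
        (push (map_sum (map_prod (fmap1 F) (fmap0 G)) (map_prod (fmap0 F) (fmap1 G))) (rep X))))\<rparr>)"

definition swap_fun :: "('r::comm_ring_1, 'o, 'a, 'b) ch_cat \<Rightarrow> ('r, 'p, 'c, 'd) ch_cat \<Rightarrow>
    ('o \<times> 'p, ('r, 'o, 'p, 'a, 'c) box0, ('r, 'o, 'p, 'a, 'b, 'c, 'd) box1,
     'p \<times> 'o, ('r, 'p, 'o, 'c, 'a) box0, ('r, 'p, 'o, 'c, 'd, 'a, 'b) box1) ch_fun" where
  "swap_fun C D =
     \<lparr>fob = prod.swap,
      fmap0 = (\<lambda>(A, B, X). (prod.swap A, prod.swap B,
        relcoset (box_rels0 D C (prod.swap A) (prod.swap B)) (push prod.swap (rep X)))),
      fmap1 = (\<lambda>(A, B, X). (prod.swap A, prod.swap B,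
        relcoset (box_rels1 D C (prod.swap A) (prod.swap B))
          (push (case_sum (\<lambda>(\<phi>, g). Inr (g, \<phi>)) (\<lambda>(f, \<psi>). Inl (\<psi>, f))) (rep X))))\<rparr>"

section \<open>Symmetric strict monoidal categories\<close>

record ('r, 'o, 'a, 'b) smon =
  tensor :: "('o \<times> 'o, ('r, 'o, 'o, 'a, 'a) box0, ('r, 'o, 'o, 'a, 'b, 'a, 'b) box1,
    'o, 'a, 'b) ch_fun"
  munit :: 'o
  braid :: "('o \<times> 'o, ('r, 'o, 'o, 'a, 'a) box0, 'a, 'b) pnat"

definition tob :: "('r, 'o, 'a, 'b) smon \<Rightarrow> 'o \<Rightarrow> 'o \<Rightarrow> 'o" where
  "tob M U V = fob (tensor M) (U, V)"

definition ten00 ::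
  "('r::comm_ring_1, 'o, 'a, 'b) ch_cat \<Rightarrow> ('r, 'o, 'a, 'b) smon \<Rightarrow> 'a \<Rightarrow> 'a \<Rightarrow> 'a" where
  "ten00 C M f g = fmap0 (tensor M) (pure00 C C f g)"

definition ten10 ::
  "('r::comm_ring_1, 'o, 'a, 'b) ch_cat \<Rightarrow> ('r, 'o, 'a, 'b) smon \<Rightarrow> 'b \<Rightarrow> 'a \<Rightarrow> 'b" where
  "ten10 C M \<phi> g = fmap1 (tensor M) (pure10 C C \<phi> g)"

definition ten01 ::
  "('r::comm_ring_1, 'o, 'a, 'b) ch_cat \<Rightarrow> ('r, 'o, 'a, 'b) smon \<Rightarrow> 'a \<Rightarrow> 'b \<Rightarrow> 'b" where
  "ten01 C M f \<psi> = fmap1 (tensor M) (pure01 C C f \<psi>)"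

text \<open>Components of pseudonatural transformations between functors on a tensor square or
  a (left-bracketed) tensor cube.\<close>

definition pob2 :: "('o \<times> 'o, 'e, 'c, 'd) pnat \<Rightarrow> 'o \<Rightarrow> 'o \<Rightarrow> 'c" where
  "pob2 \<xi> U V = pob \<xi> (U, V)"

definition pob3 :: "(('o \<times> 'o) \<times> 'o, 'e, 'c, 'd) pnat \<Rightarrow> 'o \<Rightarrow> 'o \<Rightarrow> 'o \<Rightarrow> 'c" where
  "pob3 \<xi> U V W = pob \<xi> ((U, V), W)"

definition htpy2 :: "('r::comm_ring_1, 'o, 'a, 'b) ch_cat \<Rightarrow>
    ('o \<times> 'o, ('r, 'o, 'o, 'a, 'a) box0, 'a, 'b) pnat \<Rightarrow> 'a \<Rightarrow> 'a \<Rightarrow> 'b" where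
  "htpy2 C \<xi> f g = phtpy \<xi> (pure00 C C f g)"

locale symmetric_strict_monoidal =
  ch_category C +
  tensor: ch_functor "box C C" C "tensor M" +
  braid: ch_natural "box C C" C "tensor M" "fun_comp (tensor M) (swap_fun C C)" "braid M"
  for C :: "('r::comm_ring_1, 'o, 'a, 'b) ch_cat" and M :: "('r, 'o, 'a, 'b) smon" +
  assumes assoc_ob: "tob M (tob M U V) W = tob M U (tob M V W)"
    and assoc_000: "\<lbrakk>f \<in> carrier (hom0 C U U'); g \<in> carrier (hom0 C V V'); k \<in> carrier (hom0 C W W')\<rbrakk>
        \<Longrightarrow> ten00 C M (ten00 C M f g) k = ten00 C M f (ten00 C M g k)"
    and assoc_100: "\<lbrakk>\<phi> \<in> carrier (hom1 C U U'); g \<in> carrier (hom0 C V V'); k \<in> carrier (hom0 C W W')\<rbrakk>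
        \<Longrightarrow> ten10 C M (ten10 C M \<phi> g) k = ten10 C M \<phi> (ten00 C M g k)"
    and assoc_010: "\<lbrakk>f \<in> carrier (hom0 C U U'); \<phi> \<in> carrier (hom1 C V V'); k \<in> carrier (hom0 C W W')\<rbrakk>
        \<Longrightarrow> ten10 C M (ten01 C M f \<phi>) k = ten01 C M f (ten10 C M \<phi> k)"
    and assoc_001: "\<lbrakk>f \<in> carrier (hom0 C U U'); g \<in> carrier (hom0 C V V'); \<phi> \<in> carrier (hom1 C W W')\<rbrakk>
        \<Longrightarrow> ten01 C M (ten00 C M f g) \<phi> = ten01 C M f (ten01 C M g \<phi>)"
    and unit_ob: "tob M (munit M) U = U \<and> tob M U (munit M) = U"
    and unit_0: "f \<in> carrier (hom0 C U V) \<Longrightarrow>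
        ten00 C M (idc C (munit M)) f = f \<and> ten00 C M f (idc C (munit M)) = f"
    and unit_1: "\<phi> \<in> carrier (hom1 C U V) \<Longrightarrow>
        ten01 C M (idc C (munit M)) \<phi> = \<phi> \<and> ten10 C M \<phi> (idc C (munit M)) = \<phi>"
    and braid_symmetric: "pob2 (braid M) V U \<bullet>\<^bsub>C\<^esub> pob2 (braid M) U V = idc C (tob M U V)"
    and hexagon: "pob2 (braid M) U (tob M V W) =
        ten00 C M (idc C V) (pob2 (braid M) U W) \<bullet>\<^bsub>C\<^esub> ten00 C M (pob2 (braid M) U V) (idc C W)"

section \<open>Infinitesimal 2-braidings\<close>

locale infinitesimal_2_braiding =
  symmetric_strict_monoidal C M + t: pseudonatural "box C C" C "tensor M" "tensor M" t
  for C :: "('r::comm_ring_1, 'o, 'a, 'b) ch_cat" and M :: "('r, 'o, 'a, 'b) smon"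
    and t :: "('o \<times> 'o, ('r, 'o, 'o, 'a, 'a) box0, 'a, 'b) pnat"

definition strict_braiding :: "('r::comm_ring_1, 'o, 'a, 'b) ch_cat \<Rightarrow> ('r, 'o, 'a, 'b) smon \<Rightarrow>
    ('o \<times> 'o, ('r, 'o, 'o, 'a, 'a) box0, 'a, 'b) pnat \<Rightarrow> bool" where
  "strict_braiding C M t \<longleftrightarrow>
     (let one = idc C; \<gamma> = pob2 (braid M); tc = pob2 t; th = htpy2 C t in
       (\<forall>U V W.
         tc U (tob M V W) = ten00 C M (tc U V) (one W) +\<^sub>0\<^bsub>C\<^esub>
           ten00 C M (\<gamma> V U) (one W) \<bullet>\<^bsub>C\<^esub> ten00 C M (one V) (tc U W) \<bullet>\<^bsub>C\<^esub> ten00 C M (\<gamma> U V) (one W) \<and>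
         tc (tob M U V) W = ten00 C M (one U) (tc V W) +\<^sub>0\<^bsub>C\<^esub>
           ten00 C M (one U) (\<gamma> W V) \<bullet>\<^bsub>C\<^esub> ten00 C M (tc U W) (one V) \<bullet>\<^bsub>C\<^esub> ten00 C M (one U) (\<gamma> V W)) \<and>
       (\<forall>U U' V V' W W'. \<forall>f\<in>carrier (hom0 C U U'). \<forall>g\<in>carrier (hom0 C V V').
          \<forall>k\<in>carrier (hom0 C W W').
         th f (ten00 C M g k) = ten10 C M (th f g) k +\<^sub>1\<^bsub>C\<^esub>
           ten00 C M (\<gamma> V' U') (one W') \<triangleright>\<^bsub>C\<^esub> ten01 C M g (th f k) \<triangleleft>\<^bsub>C\<^esub> ten00 C M (\<gamma> U V) (one W) \<and>
         th (ten00 C M f g) k = ten01 C M f (th g k) +\<^sub>1\<^bsub>C\<^esub>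
           ten00 C M (one U') (\<gamma> W' V') \<triangleright>\<^bsub>C\<^esub> ten10 C M (th f k) g \<triangleleft>\<^bsub>C\<^esub> ten00 C M (one U) (\<gamma> V W)))"

definition symmetric_braiding :: "('r::comm_ring_1, 'o, 'a, 'b) ch_cat \<Rightarrow> ('r, 'o, 'a, 'b) smon \<Rightarrow>
    ('o \<times> 'o, ('r, 'o, 'o, 'a, 'a) box0, 'a, 'b) pnat \<Rightarrow> bool" where
  "symmetric_braiding C M t \<longleftrightarrow>
     (let \<gamma> = pob2 (braid M); tc = pob2 t; th = htpy2 C t in
       (\<forall>U V. \<gamma> U V \<bullet>\<^bsub>C\<^esub> tc U V = tc V U \<bullet>\<^bsub>C\<^esub> \<gamma> U V) \<and>
       (\<forall>U U' V V'. \<forall>f\<in>carrier (hom0 C U U'). \<forall>g\<in>carrier (hom0 C V V').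
          \<gamma> U' V' \<triangleright>\<^bsub>C\<^esub> th f g = th g f \<triangleleft>\<^bsub>C\<^esub> \<gamma> U V))"

definition totally_symmetric_braiding ::
    "('r::comm_ring_1, 'o, 'a, 'b) ch_cat \<Rightarrow> ('r, 'o, 'a, 'b) smon \<Rightarrow>
    ('o \<times> 'o, ('r, 'o, 'o, 'a, 'a) box0, 'a, 'b) pnat \<Rightarrow> bool" where
  "totally_symmetric_braiding C M t \<longleftrightarrow> symmetric_braiding C M t \<and>
     (\<forall>U V W. htpy2 C t (pob2 (braid M) U V) (idc C W) =
        \<zero>\<^bsub>hom1 C (tob M (tob M U V) W) (tob M (tob M V U) W)\<^esub>)"

definition relator_L :: "('r::comm_ring_1, 'o, 'a, 'b) ch_cat \<Rightarrow>
    ('o \<times> 'o, ('r, 'o, 'o, 'a, 'a) box0, 'a, 'b) pnat \<Rightarrow> 'o \<Rightarrow> 'o \<Rightarrow> 'o \<Rightarrow> 'b" where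
  "relator_L C t U V W = htpy2 C t (pob2 t U V) (idc C W)"

definition relator_R :: "('r::comm_ring_1, 'o, 'a, 'b) ch_cat \<Rightarrow>
    ('o \<times> 'o, ('r, 'o, 'o, 'a, 'a) box0, 'a, 'b) pnat \<Rightarrow> 'o \<Rightarrow> 'o \<Rightarrow> 'o \<Rightarrow> 'b" where
  "relator_R C t U V W = htpy2 C t (idc C U) (pob2 t V W)"

definition coherent_braiding :: "('r::comm_ring_1, 'o, 'a, 'b) ch_cat \<Rightarrow> ('r, 'o, 'a, 'b) smon \<Rightarrow>
    ('o \<times> 'o, ('r, 'o, 'o, 'a, 'a) box0, 'a, 'b) pnat \<Rightarrow> bool" where
  "coherent_braiding C M t \<longleftrightarrow>
     (let one = idc C; \<gamma> = pob2 (braid M); tc = pob2 t; th = htpy2 C t in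
       \<forall>U V W.
         neg1 C (ten00 C M (\<gamma> V U) (one W) \<triangleright>\<^bsub>C\<^esub> th (one V) (tc U W) \<triangleleft>\<^bsub>C\<^esub> ten00 C M (\<gamma> U V) (one W))
           = th (tc U V) (one W) +\<^sub>1\<^bsub>C\<^esub> th (one U) (tc V W) \<and>
         th (tc U V) (one W) +\<^sub>1\<^bsub>C\<^esub> th (one U) (tc V W)
           = neg1 C (ten00 C M (one U) (\<gamma> W V) \<triangleright>\<^bsub>C\<^esub> th (tc U W) (one V) \<triangleleft>\<^bsub>C\<^esub> ten00 C M (one U) (\<gamma> V W)))"

text \<open>The iterated tensor product functor on the tensor cube and the two pseudonatural
  endomorphisms of it whose values on a pure tensor of \<open>f, g, k\<close> are
  the tensor products of \<open>t(f, g)\<close> with \<open>k\<close> and of \<open>f\<close> with \<open>t(g, k)\<close>.\<close>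

type_synonym ('r, 'o, 'a) cube0 = "('r, 'o \<times> 'o, 'o, ('r, 'o, 'o, 'a, 'a) box0, 'a) box0"

definition tensor2 :: "('r::comm_ring_1, 'o, 'a, 'b) ch_cat \<Rightarrow> ('r, 'o, 'a, 'b) smon \<Rightarrow>
    (('o \<times> 'o) \<times> 'o, ('r, 'o, 'a) cube0,
     ('r, 'o \<times> 'o, 'o, ('r, 'o, 'o, 'a, 'a) box0, ('r, 'o, 'o, 'a, 'b, 'a, 'b) box1, 'a, 'b) box1,
     'o, 'a, 'b) ch_fun" where
  "tensor2 C M = fun_comp (tensor M) (box_fun C C (tensor M) id_fun)"

definition t12 :: "('r::comm_ring_1, 'o, 'a, 'b) ch_cat \<Rightarrow> ('r, 'o, 'a, 'b) smon \<Rightarrow>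
    ('o \<times> 'o, ('r, 'o, 'o, 'a, 'a) box0, 'a, 'b) pnat \<Rightarrow>
    (('o \<times> 'o) \<times> 'o, ('r, 'o, 'a) cube0, 'a, 'b) pnat" where
  "t12 C M t =
     \<lparr>pob = (\<lambda>((U, V), W). ten00 C M (pob2 t U V) (idc C W)),
      phtpy = (\<lambda>(A, B, X). lin_ext (hom1 C (fob (tensor2 C M) A) (fob (tensor2 C M) B))
                 (\<lambda>(x, k). ten10 C M (phtpy t x) k) (rep X))\<rparr>"

definition t23 :: "('r::comm_ring_1, 'o, 'a, 'b) ch_cat \<Rightarrow> ('r, 'o, 'a, 'b) smon \<Rightarrow>
    ('o \<times> 'o, ('r, 'o, 'o, 'a, 'a) box0, 'a, 'b) pnat \<Rightarrow>
    (('o \<times> 'o) \<times> 'o, ('r, 'o, 'a) cube0, 'a, 'b) pnat" where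
  "t23 C M t =
     \<lparr>pob = (\<lambda>((U, V), W). ten00 C M (idc C U) (pob2 t V W)),
      phtpy = (\<lambda>(A, B, X). let N = hom1 C (fob (tensor2 C M) A) (fob (tensor2 C M) B) in
                 lin_ext N (\<lambda>((_, _, Y), k).
                   lin_ext N (\<lambda>(f, g). ten01 C M f (htpy2 C t g k)) (rep Y)) (rep X))\<rparr>"

section \<open>The Breen polytope axiom\<close>

definition breen_axiom :: "('r::comm_ring_1, 'o, 'a, 'b) ch_cat \<Rightarrow> ('r, 'o, 'a, 'b) smon \<Rightarrow>
    (('o \<times> 'o) \<times> 'o, ('r, 'o, 'a) cube0, 'a, 'b) pnat \<Rightarrow>
    ('o \<times> 'o, ('r, 'o, 'o, 'a, 'a) box0, 'a, 'b) pnat \<Rightarrow>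
    ('o \<Rightarrow> 'o \<Rightarrow> 'o \<Rightarrow> 'b) \<Rightarrow> ('o \<Rightarrow> 'o \<Rightarrow> 'o \<Rightarrow> 'b) \<Rightarrow> bool" where
  "breen_axiom C M \<alpha> \<sigma> HL HR \<longleftrightarrow>
     (let one = idc C; a = pob3 \<alpha>; ai = pob3 (pn_inverse (box (box C C) C) C \<alpha>);
          s = pob2 \<sigma>; sh = htpy2 C \<sigma> in
       \<forall>U V W.
         neg1 C (a W V U \<bullet>\<^bsub>C\<^esub> ten00 C M (s V W) (one U) \<bullet>\<^bsub>C\<^esub> ai V W U \<triangleright>\<^bsub>C\<^esub> HL U V W)
           +\<^sub>1\<^bsub>C\<^esub> a W V U \<triangleright>\<^bsub>C\<^esub> sh (one U) (s V W) \<triangleleft>\<^bsub>C\<^esub> a U V W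
           +\<^sub>1\<^bsub>C\<^esub> HL U W V \<triangleleft>\<^bsub>C\<^esub> ai U W V \<triangleleft>\<^bsub>C\<^esub> ten00 C M (one U) (s V W) \<triangleleft>\<^bsub>C\<^esub> a U V W
         = neg1 C (a W V U \<triangleright>\<^bsub>C\<^esub> HR V U W \<triangleleft>\<^bsub>C\<^esub> a V U W \<triangleleft>\<^bsub>C\<^esub> ten00 C M (s U V) (one W))
           -\<^sub>1\<^bsub>C\<^esub> sh (s U V) (one W)
           +\<^sub>1\<^bsub>C\<^esub> ten00 C M (one W) (s U V) \<bullet>\<^bsub>C\<^esub> a W U V \<triangleright>\<^bsub>C\<^esub> HR U V W \<triangleleft>\<^bsub>C\<^esub> a U V W)"

section \<open>Extension of scalars to power series modulo the cube of the parameter\<close>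

text \<open>\<open>Trunc a b c\<close> stands for \<open>a + h b + h^2 c\<close>. For a commutative ring of coefficients
  this is the polynomial ring modulo \<open>h^3\<close>; with coefficients in a module it is the tensor
  product of that module with this (free) truncated polynomial ring.\<close>

datatype 'a trunc = Trunc (coef0: 'a) (coef1: 'a) (coef2: 'a)

instantiation trunc :: (comm_ring_1) comm_ring_1
begin

definition zero_trunc :: "'a trunc" where "zero_trunc = Trunc 0 0 0"
definition one_trunc :: "'a trunc" where "one_trunc = Trunc 1 0 0"
definition plus_trunc :: "'a trunc \<Rightarrow> 'a trunc \<Rightarrow> 'a trunc" where
  "plus_trunc x y = Trunc (coef0 x + coef0 y) (coef1 x + coef1 y) (coef2 x + coef2 y)"
definition minus_trunc :: "'a trunc \<Rightarrow> 'a trunc \<Rightarrow> 'a trunc" where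
  "minus_trunc x y = Trunc (coef0 x - coef0 y) (coef1 x - coef1 y) (coef2 x - coef2 y)"
definition uminus_trunc :: "'a trunc \<Rightarrow> 'a trunc" where
  "uminus_trunc x = Trunc (- coef0 x) (- coef1 x) (- coef2 x)"
definition times_trunc :: "'a trunc \<Rightarrow> 'a trunc \<Rightarrow> 'a trunc" where
  "times_trunc x y = Trunc (coef0 x * coef0 y) (coef0 x * coef1 y + coef1 x * coef0 y)
     (coef0 x * coef2 y + coef1 x * coef1 y + coef2 x * coef0 y)"

instance
  by standard
    (simp_all add: zero_trunc_def one_trunc_def plus_trunc_def minus_trunc_def uminus_trunc_def
      times_trunc_def algebra_simps)

end

definition trunc_of_poly :: "'a::comm_ring_1 poly \<Rightarrow> 'a trunc" where
  "trunc_of_poly p = Trunc (coeff p 0) (coeff p 1) (coeff p 2)"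

lemma trunc_of_poly_hom:
  "trunc_of_poly 1 = 1"
  "trunc_of_poly (p + q) = trunc_of_poly p + trunc_of_poly q"
  "trunc_of_poly (p * q) = trunc_of_poly p * trunc_of_poly q"
  by (simp_all add: trunc_of_poly_def one_trunc_def plus_trunc_def times_trunc_def
      coeff_mult numeral_2_eq_2 algebra_simps)

lemma surj_trunc_of_poly: "surj (trunc_of_poly :: 'a::comm_ring_1 poly \<Rightarrow> 'a trunc)"
proof (rule surjI)
  fix x :: "'a trunc"
  show "trunc_of_poly [:coef0 x, coef1 x, coef2 x:] = x"
    by (simp add: trunc_of_poly_def numeral_2_eq_2)
qed

lemma trunc_of_poly_eq_0_iff:
  "trunc_of_poly (p :: 'a::comm_ring_1 poly) = 0 \<longleftrightarrow> [:0, 1:] ^ 3 dvd p"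
proof -
  have "[:0, 1:] ^ 3 dvd p \<longleftrightarrow> monom 1 3 dvd p" by (simp add: monom_altdef)
  also have "\<dots> \<longleftrightarrow> (\<forall>k<3. coeff p k = 0)" by (rule monom_1_dvd_iff')
  also have "\<dots> \<longleftrightarrow> trunc_of_poly p = 0"
    by (auto simp: trunc_of_poly_def zero_trunc_def numeral_3_eq_3 numeral_2_eq_2 less_Suc_eq)
  finally show ?thesis ..
qed

definition trunc_module :: "('k::comm_ring_1, 'm) module \<Rightarrow> ('k trunc, 'm trunc) module" where
  "trunc_module M =
     \<lparr>carrier = {x. set_trunc x \<subseteq> carrier M}, monoid.mult = undefined, one = undefined,
      ring.zero = Trunc \<zero>\<^bsub>M\<^esub> \<zero>\<^bsub>M\<^esub> \<zero>\<^bsub>M\<^esub>,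
      add = (\<lambda>x y. Trunc (coef0 x \<oplus>\<^bsub>M\<^esub> coef0 y) (coef1 x \<oplus>\<^bsub>M\<^esub> coef1 y) (coef2 x \<oplus>\<^bsub>M\<^esub> coef2 y)),
      smult = (\<lambda>r x. Trunc (coef0 r \<odot>\<^bsub>M\<^esub> coef0 x)
        (coef0 r \<odot>\<^bsub>M\<^esub> coef1 x \<oplus>\<^bsub>M\<^esub> coef1 r \<odot>\<^bsub>M\<^esub> coef0 x)
        (coef0 r \<odot>\<^bsub>M\<^esub> coef2 x \<oplus>\<^bsub>M\<^esub> coef1 r \<odot>\<^bsub>M\<^esub> coef1 x \<oplus>\<^bsub>M\<^esub> coef2 r \<odot>\<^bsub>M\<^esub> coef0 x))\<rparr>"

text \<open>Extension of a bilinear map with values in \<open>N\<close>.\<close>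

definition trunc_bilin ::
  "('k, 'c) module \<Rightarrow> ('a \<Rightarrow> 'b \<Rightarrow> 'c) \<Rightarrow> 'a trunc \<Rightarrow> 'b trunc \<Rightarrow> 'c trunc" where
  "trunc_bilin N \<beta> x y = Trunc (\<beta> (coef0 x) (coef0 y))
     (\<beta> (coef0 x) (coef1 y) \<oplus>\<^bsub>N\<^esub> \<beta> (coef1 x) (coef0 y))
     (\<beta> (coef0 x) (coef2 y) \<oplus>\<^bsub>N\<^esub> \<beta> (coef1 x) (coef1 y) \<oplus>\<^bsub>N\<^esub> \<beta> (coef2 x) (coef0 y))"

definition trunc_cat :: "('k::comm_ring_1, 'o, 'a, 'b) ch_cat \<Rightarrow>
    ('k trunc, 'o, 'a trunc, 'b trunc) ch_cat" where
  "trunc_cat C =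
     \<lparr>hom0 = (\<lambda>U V. trunc_module (hom0 C U V)), hom1 = (\<lambda>U V. trunc_module (hom1 C U V)),
      src0 = src0 C \<circ> coef0, tgt0 = tgt0 C \<circ> coef0, src1 = src1 C \<circ> coef0, tgt1 = tgt1 C \<circ> coef0,
      bd = map_trunc (bd C),
      idc = (\<lambda>U. Trunc (idc C U) \<zero>\<^bsub>hom0 C U U\<^esub> \<zero>\<^bsub>hom0 C U U\<^esub>),
      comp0 = (\<lambda>g f. trunc_bilin (hom0 C (src0 C (coef0 f)) (tgt0 C (coef0 g))) (comp0 C) g f),
      lcomp = (\<lambda>g \<phi>. trunc_bilin (hom1 C (src1 C (coef0 \<phi>)) (tgt0 C (coef0 g))) (lcomp C) g \<phi>),
      rcomp = (\<lambda>\<phi> f. trunc_bilin (hom1 C (src0 C (coef0 f)) (tgt1 C (coef0 \<phi>))) (rcomp C) \<phi> f)\<rparr>"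

text \<open>Extension of a functor on the tensor square, and of a pseudonatural transformation between
  functors \<open>F, G\<close> on it: coefficients are multiplied out on pure tensors, and the result is
  extended linearly over the truncated polynomial ring.\<close>

definition trunc_tensor_fun :: "('k::comm_ring_1, 'o, 'a, 'b) ch_cat \<Rightarrow>
    ('o \<times> 'o, ('k, 'o, 'o, 'a, 'a) box0, ('k, 'o, 'o, 'a, 'b, 'a, 'b) box1, 'o, 'a, 'b) ch_fun \<Rightarrow>
    ('o \<times> 'o, ('k trunc, 'o, 'o, 'a trunc, 'a trunc) box0,
     ('k trunc, 'o, 'o, 'a trunc, 'b trunc, 'a trunc, 'b trunc) box1, 'o, 'a trunc, 'b trunc) ch_fun" where
  "trunc_tensor_fun C F =
     \<lparr>fob = fob F,
      fmap0 = (\<lambda>(A, B, X). let N = hom0 C (fob F A) (fob F B) in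
        lin_ext (trunc_module N)
          (\<lambda>(f, g). trunc_bilin N (\<lambda>a b. fmap0 F (pure00 C C a b)) f g) (rep X)),
      fmap1 = (\<lambda>(A, B, X). let N = hom1 C (fob F A) (fob F B) in
        lin_ext (trunc_module N)
          (case_sum (\<lambda>(\<phi>, g). trunc_bilin N (\<lambda>a b. fmap1 F (pure10 C C a b)) \<phi> g)
                    (\<lambda>(f, \<psi>). trunc_bilin N (\<lambda>a b. fmap1 F (pure01 C C a b)) f \<psi>)) (rep X))\<rparr>"

definition trunc_pnat :: "('k::comm_ring_1, 'o, 'a, 'b) ch_cat \<Rightarrow>
    ('o \<times> 'o, ('k, 'o, 'o, 'a, 'a) box0, ('k, 'o, 'o, 'a, 'b, 'a, 'b) box1, 'o, 'a, 'b) ch_fun \<Rightarrow>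
    ('o \<times> 'o, ('k, 'o, 'o, 'a, 'a) box0, ('k, 'o, 'o, 'a, 'b, 'a, 'b) box1, 'o, 'a, 'b) ch_fun \<Rightarrow>
    ('o \<times> 'o, ('k, 'o, 'o, 'a, 'a) box0, 'a, 'b) pnat \<Rightarrow>
    ('o \<times> 'o, ('k trunc, 'o, 'o, 'a trunc, 'a trunc) box0, 'a trunc, 'b trunc) pnat" where
  "trunc_pnat C F G \<xi> =
     \<lparr>pob = (\<lambda>A. let z = \<zero>\<^bsub>hom0 C (fob F A) (fob G A)\<^esub> in Trunc (pob \<xi> A) z z),
      phtpy = (\<lambda>(A, B, X). let N = hom1 C (fob F A) (fob G B) in
        lin_ext (trunc_module N) (\<lambda>(f, g). trunc_bilin N (htpy2 C \<xi>) f g) (rep X))\<rparr>"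

definition trunc_smon :: "('k::comm_ring_1, 'o, 'a, 'b) ch_cat \<Rightarrow> ('k, 'o, 'a, 'b) smon \<Rightarrow>
    ('k trunc, 'o, 'a trunc, 'b trunc) smon" where
  "trunc_smon C M =
     \<lparr>tensor = trunc_tensor_fun C (tensor M), munit = munit M,
      braid = trunc_pnat C (tensor M) (fun_comp (tensor M) (swap_fun C C)) (braid M)\<rparr>"

definition trunc_braiding :: "('k::comm_ring_1, 'o, 'a, 'b) ch_cat \<Rightarrow> ('k, 'o, 'a, 'b) smon \<Rightarrow>
    ('o \<times> 'o, ('k, 'o, 'o, 'a, 'a) box0, 'a, 'b) pnat \<Rightarrow>
    ('o \<times> 'o, ('k trunc, 'o, 'o, 'a trunc, 'a trunc) box0, 'a trunc, 'b trunc) pnat" where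
  "trunc_braiding C M t = trunc_pnat C (tensor M) (tensor M) t"

section \<open>The deformed monoidal data\<close>

text \<open>Below, \<open>C\<close>, \<open>M\<close> and \<open>t\<close> are already extended to the truncated polynomial ring.\<close>

definition defo_assoc :: "('k::field_char_0 trunc, 'o, 'a, 'b) ch_cat \<Rightarrow> ('k trunc, 'o, 'a, 'b) smon \<Rightarrow>
    ('o \<times> 'o, ('k trunc, 'o, 'o, 'a, 'a) box0, 'a, 'b) pnat \<Rightarrow>
    (('o \<times> 'o) \<times> 'o, ('k trunc, 'o, 'a) cube0, 'a, 'b) pnat" where
  "defo_assoc C M t = (let C3 = box (box C C) C in
     pn_add C (pn_id C3 C (tensor2 C M))
       (pn_scale C (Trunc 0 0 (1/24)) (pn_commutator C3 C (t12 C M t) (t23 C M t))))"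

definition defo_braid :: "('k::field_char_0 trunc, 'o, 'a, 'b) ch_cat \<Rightarrow> ('k trunc, 'o, 'a, 'b) smon \<Rightarrow>
    ('o \<times> 'o, ('k trunc, 'o, 'o, 'a, 'a) box0, 'a, 'b) pnat \<Rightarrow>
    ('o \<times> 'o, ('k trunc, 'o, 'o, 'a, 'a) box0, 'a, 'b) pnat" where
  "defo_braid C M t = (let C2 = box C C in
     pn_comp C2 C (braid M)
       (pn_add C (pn_add C (pn_id C2 C (tensor M)) (pn_scale C (Trunc 0 (1/2) 0) t))
         (pn_scale C (Trunc 0 0 (1/8)) (pn_comp C2 C t t))))"

definition defo_HL :: "('k::field_char_0 trunc, 'o, 'a, 'b) ch_cat \<Rightarrow> ('k trunc, 'o, 'a, 'b) smon \<Rightarrow>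
    ('o \<times> 'o, ('k trunc, 'o, 'o, 'a, 'a) box0, 'a, 'b) pnat \<Rightarrow> 'o \<Rightarrow> 'o \<Rightarrow> 'o \<Rightarrow> 'b" where
  "defo_HL C M t U V W = scale1 C (Trunc 0 0 (1/24))
     (pob2 (braid M) U (tob M V W) \<triangleright>\<^bsub>C\<^esub>
       (scale1 C 2 (relator_L C t U V W) +\<^sub>1\<^bsub>C\<^esub> relator_R C t U V W))"

definition defo_HR :: "('k::field_char_0 trunc, 'o, 'a, 'b) ch_cat \<Rightarrow> ('k trunc, 'o, 'a, 'b) smon \<Rightarrow>
    ('o \<times> 'o, ('k trunc, 'o, 'o, 'a, 'a) box0, 'a, 'b) pnat \<Rightarrow> 'o \<Rightarrow> 'o \<Rightarrow> 'o \<Rightarrow> 'b" where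
  "defo_HR C M t U V W = scale1 C (Trunc 0 0 (1/24))
     (pob2 (braid M) (tob M U V) W \<triangleright>\<^bsub>C\<^esub>
       (relator_L C t U V W +\<^sub>1\<^bsub>C\<^esub> scale1 C 2 (relator_R C t U V W)))"

end

theory Submission
  imports Defs
begin

text \<open>Why the axiom is equivalent to coherence. Every term of the Breen polytope axiom is of
  second order in the parameter \<open>h\<close>. For the four terms with a hexagonator this is visible in the
  factor \<open>h^2/24\<close>. In the other two, \<open>\<sigma>(1, \<sigma>)\<close> and \<open>\<sigma>(\<sigma>, 1)\<close>, the lower orders involve the
  homotopies \<open>\<gamma>(f, g)\<close>, \<open>t(1, \<gamma>)\<close> and \<open>t(\<gamma>, 1)\<close>, all of which vanish (\<open>t_htpy_one_\<gamma>\<close>); what is left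
  is \<open>h^2/4\<close> times \<open>\<gamma> (1 \<otimes> \<gamma>) R\<close> or \<open>\<gamma> (\<gamma> \<otimes> 1) L\<close>, where \<open>L = t(t, 1)\<close> and \<open>R = t(1, t)\<close>
  (\<open>\<sigma>_htpy\<close>). Composition with a cell of second order sees only the constant coefficients of the
  other factors, so all associators may be replaced by identities and all remaining \<open>\<sigma>\<close> by \<open>\<gamma>\<close>.
  The axiom becomes one equation between 2-cells over the ground field.

  By naturality of \<open>\<gamma>\<close> and the two hexagons, all composites of \<open>\<gamma>\<close> from \<open>UVW\<close> to \<open>WVU\<close> that occur
  are the same isomorphism (\<open>reversal_eq\<close>), and it can be cancelled. Moving \<open>L\<close> and \<open>R\<close> past the
  braidings produces \<open>L\<close> and \<open>R\<close> again (\<open>L_commute\<close>, \<open>R_commute\<close>) together with two new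
  2-cells: the conjugate \<open>A\<close> of \<open>L\<close> at \<open>UWV\<close> and the conjugate \<open>B\<close> of \<open>R\<close> at \<open>VUW\<close>. After
  multiplication by 24 the equation reads \<open>2 A + 2 B + 4 (L + R) = 0\<close>. Symmetry of \<open>t\<close> and the second
  hexagon give \<open>A = B\<close> (\<open>outer_eq\<close>), so in characteristic 0 it says \<open>L + R = - A\<close>. Coherence demands
  \<open>L + R = - A = - B\<close>, which is therefore the same condition (\<open>breen_module_identity\<close>,
  \<open>coherent_iff\<close>).

  The rest of the work is to evaluate the cells in the axiom. Tensor products are modules of
  cosets of formal sums, and functors and transformations act on them through a chosen
  representative. The laws \<open>lin_ext_rep\<close>, \<open>push_rep\<close> and \<open>push2_rep\<close> say that the choice is
  immaterial as soon as the relations are respected; they give the values on pure tensors, over the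
  ground field as well as over the truncated polynomial ring.\<close>

section \<open>Modules over a ring of scalars\<close>

lemma scalars_simps [simp]:
  "carrier (scalars :: 'r::comm_ring_1 ring) = UNIV"
  "x \<otimes>\<^bsub>scalars\<^esub> y = x * y" "x \<oplus>\<^bsub>scalars\<^esub> y = x + y" "\<one>\<^bsub>scalars\<^esub> = 1" "\<zero>\<^bsub>scalars\<^esub> = 0"
  for x y :: "'r::comm_ring_1"
  by (simp_all add: scalars_def)

lemma cring_scalars: "cring (scalars :: 'r::comm_ring_1 ring)"
proof (rule cringI)
  show "abelian_group (scalars :: 'r ring)"
  proof (rule abelian_groupI)
    fix x :: 'r
    show "\<exists>y\<in>carrier scalars. y \<oplus>\<^bsub>scalars\<^esub> x = \<zero>\<^bsub>scalars\<^esub>"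
      by (rule bexI[of _ "- x"]) simp_all
  qed (auto simp: algebra_simps)
  show "comm_monoid (scalars :: 'r ring)"
    by (rule comm_monoidI) (auto simp: algebra_simps)
qed (auto simp: algebra_simps)

lemma scalars_moduleI:
  assumes "\<And>x y. x \<in> carrier N \<Longrightarrow> y \<in> carrier N \<Longrightarrow> x \<oplus>\<^bsub>N\<^esub> y \<in> carrier N"
    and "\<zero>\<^bsub>N\<^esub> \<in> carrier N"
    and "\<And>x y z. x \<in> carrier N \<Longrightarrow> y \<in> carrier N \<Longrightarrow> z \<in> carrier N \<Longrightarrow>
      (x \<oplus>\<^bsub>N\<^esub> y) \<oplus>\<^bsub>N\<^esub> z = x \<oplus>\<^bsub>N\<^esub> (y \<oplus>\<^bsub>N\<^esub> z)"
    and "\<And>x y. x \<in> carrier N \<Longrightarrow> y \<in> carrier N \<Longrightarrow> x \<oplus>\<^bsub>N\<^esub> y = y \<oplus>\<^bsub>N\<^esub> x"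
    and "\<And>x. x \<in> carrier N \<Longrightarrow> \<zero>\<^bsub>N\<^esub> \<oplus>\<^bsub>N\<^esub> x = x"
    and "\<And>x. x \<in> carrier N \<Longrightarrow> (- 1) \<odot>\<^bsub>N\<^esub> x \<oplus>\<^bsub>N\<^esub> x = \<zero>\<^bsub>N\<^esub>"
    and "\<And>r x. x \<in> carrier N \<Longrightarrow> r \<odot>\<^bsub>N\<^esub> x \<in> carrier N"
    and "\<And>r s x. x \<in> carrier N \<Longrightarrow> (r + s) \<odot>\<^bsub>N\<^esub> x = r \<odot>\<^bsub>N\<^esub> x \<oplus>\<^bsub>N\<^esub> s \<odot>\<^bsub>N\<^esub> x"
    and "\<And>r x y. x \<in> carrier N \<Longrightarrow> y \<in> carrier N \<Longrightarrow>
      r \<odot>\<^bsub>N\<^esub> (x \<oplus>\<^bsub>N\<^esub> y) = r \<odot>\<^bsub>N\<^esub> x \<oplus>\<^bsub>N\<^esub> r \<odot>\<^bsub>N\<^esub> y"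
    and "\<And>r s x. x \<in> carrier N \<Longrightarrow> (r * s) \<odot>\<^bsub>N\<^esub> x = r \<odot>\<^bsub>N\<^esub> (s \<odot>\<^bsub>N\<^esub> x)"
    and "\<And>x. x \<in> carrier N \<Longrightarrow> 1 \<odot>\<^bsub>N\<^esub> x = x"
  shows "Module.module (scalars :: 'r::comm_ring_1 ring) N"
proof (rule moduleI)
  show "abelian_group N"
  proof (rule abelian_groupI)
    show "\<exists>y\<in>carrier N. y \<oplus>\<^bsub>N\<^esub> x = \<zero>\<^bsub>N\<^esub>" if "x \<in> carrier N" for x
      using assms(6,7)[OF that] by blast
  qed (rule assms; assumption)+
qed (simp_all add: cring_scalars assms(7-11))

lemma (in Module.module) smult_minus_one:
  assumes "x \<in> carrier M"
  shows "(\<ominus> \<one>) \<odot>\<^bsub>M\<^esub> x = \<ominus>\<^bsub>M\<^esub> x"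
  using assms by (simp add: smult_l_minus)

lemma (in abelian_group) minus_zero_iff:
  assumes "x \<in> carrier G" "y \<in> carrier G"
  shows "x \<ominus> y = \<zero> \<longleftrightarrow> x = y"
  using assms by (metis a_minus_def minus_equality minus_minus r_neg a_inv_closed)

lemma neg_scalars [simp]: "\<ominus>\<^bsub>scalars\<^esub> x = - (x :: 'r::comm_ring_1)"
proof -
  interpret cring "scalars :: 'r ring" by (rule cring_scalars)
  have "x \<oplus>\<^bsub>scalars\<^esub> (- x) = \<zero>\<^bsub>scalars\<^esub>" by simp
  then show ?thesis using minus_equality[of "- x" x] by simp
qed

text \<open>The module axioms in terms of the ring operations of the type, as rewrite rules for
  expressions in scalars.\<close>

lemma
  assumes N: "Module.module (scalars :: 'r::comm_ring_1 ring) N"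
  shows smod_closed: "x \<in> carrier N \<Longrightarrow> r \<odot>\<^bsub>N\<^esub> x \<in> carrier N"
    and smod_add_left: "x \<in> carrier N \<Longrightarrow> (r + s) \<odot>\<^bsub>N\<^esub> x = r \<odot>\<^bsub>N\<^esub> x \<oplus>\<^bsub>N\<^esub> s \<odot>\<^bsub>N\<^esub> x"
    and smod_add_right: "x \<in> carrier N \<Longrightarrow> y \<in> carrier N \<Longrightarrow>
      r \<odot>\<^bsub>N\<^esub> (x \<oplus>\<^bsub>N\<^esub> y) = r \<odot>\<^bsub>N\<^esub> x \<oplus>\<^bsub>N\<^esub> r \<odot>\<^bsub>N\<^esub> y"
    and smod_mult: "x \<in> carrier N \<Longrightarrow> (r * s) \<odot>\<^bsub>N\<^esub> x = r \<odot>\<^bsub>N\<^esub> (s \<odot>\<^bsub>N\<^esub> x)"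
    and smod_one: "x \<in> carrier N \<Longrightarrow> 1 \<odot>\<^bsub>N\<^esub> x = x"
    and smod_zero_left: "x \<in> carrier N \<Longrightarrow> 0 \<odot>\<^bsub>N\<^esub> x = \<zero>\<^bsub>N\<^esub>"
    and smod_zero_right: "r \<odot>\<^bsub>N\<^esub> \<zero>\<^bsub>N\<^esub> = \<zero>\<^bsub>N\<^esub>"
    and smod_neg_left: "x \<in> carrier N \<Longrightarrow> (- r) \<odot>\<^bsub>N\<^esub> x = \<ominus>\<^bsub>N\<^esub> (r \<odot>\<^bsub>N\<^esub> x)"
proof -
  interpret N: Module.module "scalars :: 'r ring" N by (rule N)
  show "x \<in> carrier N \<Longrightarrow> r \<odot>\<^bsub>N\<^esub> x \<in> carrier N"
    "x \<in> carrier N \<Longrightarrow> (r + s) \<odot>\<^bsub>N\<^esub> x = r \<odot>\<^bsub>N\<^esub> x \<oplus>\<^bsub>N\<^esub> s \<odot>\<^bsub>N\<^esub> x"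
    "x \<in> carrier N \<Longrightarrow> y \<in> carrier N \<Longrightarrow> r \<odot>\<^bsub>N\<^esub> (x \<oplus>\<^bsub>N\<^esub> y) = r \<odot>\<^bsub>N\<^esub> x \<oplus>\<^bsub>N\<^esub> r \<odot>\<^bsub>N\<^esub> y"
    "x \<in> carrier N \<Longrightarrow> (r * s) \<odot>\<^bsub>N\<^esub> x = r \<odot>\<^bsub>N\<^esub> (s \<odot>\<^bsub>N\<^esub> x)"
    "x \<in> carrier N \<Longrightarrow> 1 \<odot>\<^bsub>N\<^esub> x = x"
    "x \<in> carrier N \<Longrightarrow> 0 \<odot>\<^bsub>N\<^esub> x = \<zero>\<^bsub>N\<^esub>" "r \<odot>\<^bsub>N\<^esub> \<zero>\<^bsub>N\<^esub> = \<zero>\<^bsub>N\<^esub>"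
    "x \<in> carrier N \<Longrightarrow> (- r) \<odot>\<^bsub>N\<^esub> x = \<ominus>\<^bsub>N\<^esub> (r \<odot>\<^bsub>N\<^esub> x)"
    using N.smult_l_distr[of r s x] N.smult_r_distr[of r x y] N.smult_assoc1[of r s x]
      N.smult_one[of x] N.smult_l_null[of x] N.smult_r_null[of r] N.smult_l_minus[of r x]
    by auto
qed

lemmas smod = smod_closed smod_add_left smod_add_right smod_mult smod_one smod_zero_left
  smod_zero_right smod_neg_left

lemma
  assumes "linear_map M N \<phi>"
  shows linear_map_closed: "x \<in> carrier M \<Longrightarrow> \<phi> x \<in> carrier N"
    and linear_map_add: "x \<in> carrier M \<Longrightarrow> y \<in> carrier M \<Longrightarrow> \<phi> (x \<oplus>\<^bsub>M\<^esub> y) = \<phi> x \<oplus>\<^bsub>N\<^esub> \<phi> y"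
    and linear_map_smult: "x \<in> carrier M \<Longrightarrow> \<phi> (r \<odot>\<^bsub>M\<^esub> x) = r \<odot>\<^bsub>N\<^esub> \<phi> x"
  using assms unfolding linear_map_def by blast+

lemma linear_map_zero:
  assumes M: "Module.module scalars M" and N: "Module.module scalars N" and "linear_map M N \<phi>"
  shows "\<phi> \<zero>\<^bsub>M\<^esub> = \<zero>\<^bsub>N\<^esub>"
proof -
  interpret M: Module.module scalars M by (rule M)
  interpret N: Module.module scalars N by (rule N)
  have "\<phi> (0 \<odot>\<^bsub>M\<^esub> \<zero>\<^bsub>M\<^esub>) = 0 \<odot>\<^bsub>N\<^esub> \<phi> \<zero>\<^bsub>M\<^esub>"
    using linear_map_smult[OF assms(3)] by blast
  then show ?thesis
    using M.smult_l_null[of "\<zero>\<^bsub>M\<^esub>"] N.smult_l_null[of "\<phi> \<zero>\<^bsub>M\<^esub>"]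
      linear_map_closed[OF assms(3), of "\<zero>\<^bsub>M\<^esub>"] by simp
qed

lemma linear_map_neg:
  assumes M: "Module.module scalars M" and N: "Module.module scalars N" and "linear_map M N \<phi>"
    and x: "x \<in> carrier M"
  shows "\<phi> (\<ominus>\<^bsub>M\<^esub> x) = \<ominus>\<^bsub>N\<^esub> \<phi> x"
proof -
  interpret M: Module.module scalars M by (rule M)
  interpret N: Module.module scalars N by (rule N)
  show ?thesis
    using linear_map_smult[OF assms(3) x, of "- 1"] M.smult_minus_one[OF x]
      N.smult_minus_one[of "\<phi> x"] linear_map_closed[OF assms(3) x] by simp
qed

section \<open>Linear extension from formal sums\<close>

text \<open>Cosets are taken modulo spans in this module.\<close>

interpretation fs: Modules.module "\<lambda>(r::'r::comm_ring_1) (p::'x \<Rightarrow> 'r) x. r * p x"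
  by standard (auto simp: algebra_simps fun_eq_iff)

text \<open>The left-hand sides of these laws are abstractions, and as rewrite rules they would apply to
  pointwise products in general.\<close>

declare fs.scale_scale [simp del] fs.scale_one [simp del] fs.scale_zero_left [simp del]
  fs.scale_minus_left [simp del] fs.scale_zero_right [simp del] fs.scale_minus_right [simp del]

lemma
  shows formal_sums_zero: "0 \<in> formal_sums X"
    and formal_sums_add: "p \<in> formal_sums X \<Longrightarrow> q \<in> formal_sums X \<Longrightarrow> p + q \<in> formal_sums X"
    and formal_sums_scale: "p \<in> formal_sums X \<Longrightarrow> (\<lambda>x. r * p x) \<in> formal_sums X"
    and formal_sums_diff: "p \<in> formal_sums X \<Longrightarrow> q \<in> formal_sums X \<Longrightarrow> p - q \<in> formal_sums X"
proof -
  show "p + q \<in> formal_sums X" if "p \<in> formal_sums X" "q \<in> formal_sums X"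
  proof -
    have "{x. (p + q) x \<noteq> 0} \<subseteq> {x. p x \<noteq> 0} \<union> {x. q x \<noteq> 0}" by auto
    with that show ?thesis by (auto simp: formal_sums_def intro: finite_subset)
  qed
  show "(\<lambda>x. r * p x) \<in> formal_sums X" if "p \<in> formal_sums X"
  proof -
    have "{x. r * p x \<noteq> 0} \<subseteq> {x. p x \<noteq> 0}" by auto
    with that show ?thesis by (auto simp: formal_sums_def intro: finite_subset)
  qed
  show "p - q \<in> formal_sums X" if "p \<in> formal_sums X" "q \<in> formal_sums X"
  proof -
    have "{x. (p - q) x \<noteq> 0} \<subseteq> {x. p x \<noteq> 0} \<union> {x. q x \<noteq> 0}" by auto
    with that show ?thesis by (auto simp: formal_sums_def intro: finite_subset)
  qed
qed (auto simp: formal_sums_def)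

lemma formal_sums_gen:
  assumes "x \<in> X"
  shows "(gen x :: 'x \<Rightarrow> 'r::comm_ring_1) \<in> formal_sums X"
proof -
  have "{y. gen x y \<noteq> (0::'r)} \<subseteq> {x}" by (auto simp: gen_def)
  with assms show ?thesis by (auto simp: formal_sums_def intro: finite_subset)
qed

lemma span_formal_sums:
  assumes "S \<subseteq> formal_sums X"
  shows "fs.span S \<subseteq> formal_sums X"
  by (rule fs.span_minimal[OF assms])
     (auto simp: fs.subspace_def formal_sums_zero formal_sums_add formal_sums_scale)

lemma lin_ext_superset:
  assumes N: "Module.module scalars N" and "finite A" "{x. p x \<noteq> 0} \<subseteq> A"
    and "\<And>x. x \<in> A \<Longrightarrow> \<phi> x \<in> carrier N"
  shows "lin_ext N \<phi> p = (\<Oplus>\<^bsub>N\<^esub>x\<in>A. p x \<odot>\<^bsub>N\<^esub> \<phi> x)"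
proof -
  interpret N: Module.module scalars N by (rule N)
  show ?thesis unfolding lin_ext_def
    by (rule N.add.finprod_mono_neutral_cong_left)
       (use assms N.smult_l_null in \<open>auto simp: Pi_def\<close>)
qed

context
  fixes N :: "('r::comm_ring_1, 'm) module" and \<phi> :: "'x \<Rightarrow> 'm" and X
  assumes N: "Module.module scalars N" and \<phi>: "\<And>x. x \<in> X \<Longrightarrow> \<phi> x \<in> carrier N"
begin

interpretation N: Module.module scalars N by (rule N)

lemma lin_ext_closed:
  assumes "p \<in> formal_sums X" shows "lin_ext N \<phi> p \<in> carrier N"
  unfolding lin_ext_def using assms \<phi> by (auto intro!: N.finsum_closed simp: formal_sums_def)

lemma lin_ext_gen: "x \<in> X \<Longrightarrow> lin_ext N \<phi> (gen x) = \<phi> x"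
  by (subst lin_ext_superset[OF N, of "{x}"]) (use \<phi> N.smult_one in \<open>auto simp: gen_def\<close>)

lemma lin_ext_add:
  assumes "p \<in> formal_sums X" "q \<in> formal_sums X"
  shows "lin_ext N \<phi> (p + q) = lin_ext N \<phi> p \<oplus>\<^bsub>N\<^esub> lin_ext N \<phi> q"
proof -
  let ?A = "{x. p x \<noteq> 0} \<union> {x. q x \<noteq> 0}"
  have A: "finite ?A" "?A \<subseteq> X" using assms by (auto simp: formal_sums_def)
  then have c: "x \<in> ?A \<Longrightarrow> \<phi> x \<in> carrier N" for x using \<phi> by blast
  have "lin_ext N \<phi> (p + q) = (\<Oplus>\<^bsub>N\<^esub>x\<in>?A. (p + q) x \<odot>\<^bsub>N\<^esub> \<phi> x)"
    by (rule lin_ext_superset[OF N A(1) _ c]) auto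
  also have "\<dots> = (\<Oplus>\<^bsub>N\<^esub>x\<in>?A. p x \<odot>\<^bsub>N\<^esub> \<phi> x \<oplus>\<^bsub>N\<^esub> q x \<odot>\<^bsub>N\<^esub> \<phi> x)"
    by (rule N.finsum_cong') (use c N.smult_l_distr in \<open>auto simp: Pi_def\<close>)
  also have "\<dots> = (\<Oplus>\<^bsub>N\<^esub>x\<in>?A. p x \<odot>\<^bsub>N\<^esub> \<phi> x) \<oplus>\<^bsub>N\<^esub> (\<Oplus>\<^bsub>N\<^esub>x\<in>?A. q x \<odot>\<^bsub>N\<^esub> \<phi> x)"
    by (rule N.finsum_addf) (use c in auto)
  also have "(\<Oplus>\<^bsub>N\<^esub>x\<in>?A. p x \<odot>\<^bsub>N\<^esub> \<phi> x) = lin_ext N \<phi> p"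
    by (rule lin_ext_superset[OF N A(1) _ c, symmetric]) auto
  also have "(\<Oplus>\<^bsub>N\<^esub>x\<in>?A. q x \<odot>\<^bsub>N\<^esub> \<phi> x) = lin_ext N \<phi> q"
    by (rule lin_ext_superset[OF N A(1) _ c, symmetric]) auto
  finally show ?thesis .
qed

lemma lin_ext_scale:
  assumes "p \<in> formal_sums X"
  shows "lin_ext N \<phi> (\<lambda>x. r * p x) = r \<odot>\<^bsub>N\<^esub> lin_ext N \<phi> p"
proof -
  let ?A = "{x. p x \<noteq> 0}"
  have A: "finite ?A" "?A \<subseteq> X" using assms by (auto simp: formal_sums_def)
  then have c: "x \<in> ?A \<Longrightarrow> \<phi> x \<in> carrier N" for x using \<phi> by blast
  have "lin_ext N \<phi> (\<lambda>x. r * p x) = (\<Oplus>\<^bsub>N\<^esub>x\<in>?A. (r * p x) \<odot>\<^bsub>N\<^esub> \<phi> x)"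
    by (rule lin_ext_superset[OF N A(1) _ c]) auto
  also have "\<dots> = (\<Oplus>\<^bsub>N\<^esub>x\<in>?A. r \<odot>\<^bsub>N\<^esub> (p x \<odot>\<^bsub>N\<^esub> \<phi> x))"
    by (rule N.finsum_cong') (use c N.smult_assoc1 in \<open>auto simp: Pi_def\<close>)
  also have "\<dots> = r \<odot>\<^bsub>N\<^esub> lin_ext N \<phi> p"
    unfolding lin_ext_def using c by (subst N.finsum_smult_ldistr) (auto simp: A)
  finally show ?thesis .
qed

lemma lin_ext_diff:
  assumes "p \<in> formal_sums X" "q \<in> formal_sums X"
  shows "lin_ext N \<phi> (p - q) = lin_ext N \<phi> p \<ominus>\<^bsub>N\<^esub> lin_ext N \<phi> q"
proof -
  have e: "p - q = p + (\<lambda>x. - 1 * q x)" by (auto simp: fun_eq_iff)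
  show ?thesis
    using lin_ext_closed[OF assms(2)] N.smult_minus_one[of "lin_ext N \<phi> q"]
    unfolding e lin_ext_add[OF assms(1) formal_sums_scale[OF assms(2)]] lin_ext_scale[OF assms(2)]
    by (simp add: a_minus_def)
qed

text \<open>The set \<open>K\<close> is meant to be a submodule: the zero submodule when relations are to be
  annihilated, or the span of the relations of the target.\<close>

lemma lin_ext_span:
  assumes S: "S \<subseteq> formal_sums X" and SK: "\<And>s. s \<in> S \<Longrightarrow> lin_ext N \<phi> s \<in> K"
    and K: "\<zero>\<^bsub>N\<^esub> \<in> K" "\<And>x y. x \<in> K \<Longrightarrow> y \<in> K \<Longrightarrow> x \<oplus>\<^bsub>N\<^esub> y \<in> K"
      "\<And>r x. x \<in> K \<Longrightarrow> r \<odot>\<^bsub>N\<^esub> x \<in> K"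
    and p: "p \<in> fs.span S"
  shows "lin_ext N \<phi> p \<in> K"
proof -
  have "p \<in> formal_sums X \<and> lin_ext N \<phi> p \<in> K"
    using p
  proof (induction rule: fs.span_induct_alt)
    case base
    have "lin_ext N \<phi> 0 = \<zero>\<^bsub>N\<^esub>" by (simp add: lin_ext_def)
    then show ?case using formal_sums_zero[of X] K(1) by metis
  next
    case (step c x y)
    then have x: "x \<in> formal_sums X" and y: "y \<in> formal_sums X" using S by auto
    note cx = formal_sums_scale[OF x, of c]
    show ?case
      using formal_sums_add[OF cx y] step SK K
      unfolding lin_ext_add[OF cx y] lin_ext_scale[OF x] by blast
  qed
  then show ?thesis by simp
qed

end

lemma relcoset_eqI: "p - q \<in> fs.span S \<Longrightarrow> relcoset S p = relcoset S q"
proof -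
  assume a: "p - q \<in> fs.span S"
  have "r - p \<in> fs.span S \<longleftrightarrow> r - q \<in> fs.span S" for r
  proof -
    have "r - q = (r - p) + (p - q)" by simp
    then show ?thesis using fs.span_add_eq2[OF a, of "r - p"] by metis
  qed
  then show ?thesis by (auto simp: relcoset_def)
qed

lemma rep_relcoset: "rep (relcoset S p) - p \<in> fs.span S"
proof -
  have "p \<in> relcoset S p" by (auto simp: relcoset_def fs.span_zero)
  then have "rep (relcoset S p) \<in> relcoset S p" 
    unfolding rep_def by (rule someI[of "\<lambda>q. q \<in> relcoset S p"])
  then show ?thesis by (simp add: relcoset_def)
qed

lemma rep_formal_sums:
  assumes "S \<subseteq> formal_sums X" "p \<in> formal_sums X"
  shows "rep (relcoset S p) \<in> formal_sums X"
proof -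
  have "rep (relcoset S p) = (rep (relcoset S p) - p) + p" by simp
  then show ?thesis using span_formal_sums[OF assms(1)] rep_relcoset[of S p] assms(2)
    by (metis formal_sums_add subsetD)
qed

lemma presented_simps:
  "carrier (presented X S) = relcoset S ` formal_sums X"
  "\<zero>\<^bsub>presented X S\<^esub> = relcoset S 0"
  "relcoset S p \<oplus>\<^bsub>presented X S\<^esub> relcoset S q = relcoset S (p + q)"
  "r \<odot>\<^bsub>presented X S\<^esub> relcoset S p = relcoset S (\<lambda>x. r * p x)"
proof -
  have "(rep (relcoset S p) + rep (relcoset S q)) - (p + q) \<in> fs.span S"
    using fs.span_add[OF rep_relcoset[of S p] rep_relcoset[of S q]] by (simp add: algebra_simps)
  then show "relcoset S p \<oplus>\<^bsub>presented X S\<^esub> relcoset S q = relcoset S (p + q)"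
    by (simp add: presented_def) (rule relcoset_eqI)
  have "(\<lambda>x. r * rep (relcoset S p) x) - (\<lambda>x. r * p x) \<in> fs.span S"
    using fs.span_scale[OF rep_relcoset[of S p], of r] by (simp add: algebra_simps fun_diff_def)
  then show "r \<odot>\<^bsub>presented X S\<^esub> relcoset S p = relcoset S (\<lambda>x. r * p x)"
    by (simp add: presented_def) (rule relcoset_eqI)
qed (auto simp: presented_def)

text \<open>A linear extension that annihilates the relations does not depend on the representative of
  a coset, since two representatives differ by an element of the span of the relations.\<close>

lemma lin_ext_rep:
  assumes N: "Module.module scalars N" and \<phi>: "\<And>x. x \<in> X \<Longrightarrow> \<phi> x \<in> carrier N"
    and S: "S \<subseteq> formal_sums X" and 0: "\<And>s. s \<in> S \<Longrightarrow> lin_ext N \<phi> s = \<zero>\<^bsub>N\<^esub>"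
    and p: "p \<in> formal_sums X"
  shows "lin_ext N \<phi> (rep (relcoset S p)) = lin_ext N \<phi> p"
proof -
  interpret N: Module.module scalars N by (rule N)
  note rp = rep_formal_sums[OF S p]
  have "lin_ext N \<phi> (rep (relcoset S p) - p) \<in> {\<zero>\<^bsub>N\<^esub>}"
    by (rule lin_ext_span[OF N \<phi> S _ _ _ _ rep_relcoset]) (use 0 N.smult_r_null in auto)
  then have "lin_ext N \<phi> (rep (relcoset S p)) \<ominus>\<^bsub>N\<^esub> lin_ext N \<phi> p = \<zero>\<^bsub>N\<^esub>"
    using lin_ext_diff[OF N \<phi> rp p] by simp
  then show ?thesis
    using N.minus_zero_iff lin_ext_closed[OF N, of X \<phi>, OF \<phi>] rp p by blast
qed

section \<open>Bilinear extension from formal sums\<close>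

text \<open>As maps into a module of functions, the extensions \<open>push\<close> and \<open>push2\<close> are instances of
  \<open>lin_ext\<close> and inherit its linearity.\<close>

definition function_module :: "('r::comm_ring_1, 'z \<Rightarrow> 'r) module" where
  "function_module =
     \<lparr>carrier = UNIV, monoid.mult = undefined, one = undefined, ring.zero = 0, add = (+),
      smult = (\<lambda>r p x. r * p x)\<rparr>"

lemma function_module_simps:
  "carrier function_module = UNIV" "\<zero>\<^bsub>function_module\<^esub> = 0"
  "p \<oplus>\<^bsub>function_module\<^esub> q = p + q" "r \<odot>\<^bsub>function_module\<^esub> p = (\<lambda>x. r * p x)"
  by (simp_all add: function_module_def)

lemma module_function_module: "Module.module scalars function_module"
  by (rule scalars_moduleI)
     (auto simp: function_module_simps algebra_simps)

lemma minus_function_module: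
  fixes p q :: "'z \<Rightarrow> 'r::comm_ring_1"
  shows "p \<ominus>\<^bsub>function_module\<^esub> q = p - q"
proof -
  interpret F: Module.module scalars "function_module :: ('r, 'z \<Rightarrow> 'r) module"
    by (rule module_function_module)
  have "p - q \<oplus>\<^bsub>function_module\<^esub> q = p" by (simp add: function_module_simps)
  then show ?thesis
    using F.add.inv_solve_right[of "p - q" p q] by (simp add: a_minus_def function_module_simps)
qed

lemma finsum_function_module:
  fixes \<phi> :: "'x \<Rightarrow> 'z \<Rightarrow> 'r::comm_ring_1"
  assumes "finite A"
  shows "(\<Oplus>\<^bsub>function_module\<^esub>x\<in>A. \<phi> x) = (\<lambda>z. \<Sum>x\<in>A. \<phi> x z)"
proof -
  interpret F: Module.module scalars "function_module :: ('r, 'z \<Rightarrow> 'r) module"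
    by (rule module_function_module)
  show ?thesis using assms
    by (induction rule: finite_induct)
       (auto simp: function_module_simps fun_eq_iff)
qed

lemma lin_ext_function_module:
  assumes "p \<in> formal_sums X"
  shows "lin_ext function_module \<phi> p z = (\<Sum>x | p x \<noteq> 0. p x * \<phi> x z)"
  using assms by (simp add: lin_ext_def formal_sums_def finsum_function_module function_module_simps)

lemma push_eq_lin_ext:
  assumes "p \<in> formal_sums X"
  shows "push \<phi> p = lin_ext function_module (\<lambda>x. gen (\<phi> x)) p"
proof
  fix z
  have fin: "finite {x. p x \<noteq> 0}" using assms by (simp add: formal_sums_def)
  have "push \<phi> p z = (\<Sum>x\<in>{x \<in> {x. p x \<noteq> 0}. \<phi> x = z}. p x)"
    by (simp add: push_def conj_commute)
  also have "\<dots> = (\<Sum>x | p x \<noteq> 0. if \<phi> x = z then p x else 0)"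
    using fin by (rule sum.inter_filter)
  also have "\<dots> = lin_ext function_module (\<lambda>x. gen (\<phi> x)) p z"
    unfolding lin_ext_function_module[OF assms] by (intro sum.cong) (auto simp: gen_def)
  finally show "push \<phi> p z = lin_ext function_module (\<lambda>x. gen (\<phi> x)) p z" .
qed

lemma push2_eq_lin_ext:
  assumes p: "p \<in> formal_sums X" and q: "q \<in> formal_sums Y"
  shows "push2 \<beta> p q = lin_ext function_module (\<lambda>x. push (\<beta> x) q) p"
proof
  fix z
  let ?A = "{x. p x \<noteq> 0}" and ?B = "{y. q y \<noteq> 0}"
  have fin: "finite ?A" "finite ?B" using p q by (auto simp: formal_sums_def)
  have "push2 \<beta> p q z = (\<Sum>w\<in>{w \<in> ?A \<times> ?B. \<beta> (fst w) (snd w) = z}. p (fst w) * q (snd w))"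
    unfolding push2_def by (intro sum.cong) auto
  also have "\<dots> = (\<Sum>w\<in>?A \<times> ?B. if \<beta> (fst w) (snd w) = z then p (fst w) * q (snd w) else 0)"
    by (rule sum.inter_filter) (use fin in auto)
  also have "\<dots> = (\<Sum>x\<in>?A. \<Sum>y\<in>?B. if \<beta> x y = z then p x * q y else 0)"
    by (subst sum.cartesian_product) (simp add: case_prod_beta)
  also have "\<dots> = (\<Sum>x\<in>?A. p x * push (\<beta> x) q z)"
    unfolding push_eq_lin_ext[OF q] lin_ext_function_module[OF q] sum_distrib_left
    by (intro sum.cong) (auto simp: gen_def)
  also have "\<dots> = lin_ext function_module (\<lambda>x. push (\<beta> x) q) p z"
    by (simp add: lin_ext_function_module[OF p])
  finally show "push2 \<beta> p q z = lin_ext function_module (\<lambda>x. push (\<beta> x) q) p z" .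
qed

lemma push2_flip: "push2 \<beta> p q = push2 (\<lambda>y x. \<beta> x y) q p"
  unfolding push2_def
  by (intro ext sum.reindex_bij_witness[of _ prod.swap prod.swap]) (auto simp: mult.commute)

lemma push_diff:
  assumes "p \<in> formal_sums X" "q \<in> formal_sums X"
  shows "push \<phi> (p - q) = push \<phi> p - push \<phi> q"
  using assms
  by (simp add: push_eq_lin_ext[where X = X] formal_sums_diff
      lin_ext_diff[OF module_function_module, where X = X] function_module_simps
      minus_function_module)

lemma push_scale:
  assumes "p \<in> formal_sums X"
  shows "push \<phi> (\<lambda>x. r * p x) = (\<lambda>x. r * push \<phi> p x)"
  using assms
  by (simp add: push_eq_lin_ext[where X = X] formal_sums_scale
      lin_ext_scale[OF module_function_module, where X = X] function_module_simps)

lemma push_gen [simp]: "push \<phi> (gen x) = gen (\<phi> x)"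
  by (subst push_eq_lin_ext[where X = "{x}"])
     (auto intro: formal_sums_gen lin_ext_gen[OF module_function_module, where X = "{x}"]
       simp: function_module_simps)

lemma push_span:
  assumes "S \<subseteq> formal_sums X" and "\<And>s. s \<in> S \<Longrightarrow> push \<phi> s \<in> fs.span T" and "p \<in> fs.span S"
  shows "push \<phi> p \<in> fs.span T"
proof -
  have "lin_ext function_module (\<lambda>x. gen (\<phi> x)) p \<in> fs.span T"
  proof (rule lin_ext_span[OF module_function_module _ assms(1) _ _ _ _ assms(3)])
    show "lin_ext function_module (\<lambda>x. gen (\<phi> x)) s \<in> fs.span T" if "s \<in> S" for s
      using assms(2)[OF that] push_eq_lin_ext[OF subsetD[OF assms(1) that], of \<phi>] by simp
  qed (simp_all add: function_module_simps fs.span_zero fs.span_add fs.span_scale)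
  moreover have "p \<in> formal_sums X" using span_formal_sums[OF assms(1)] assms(3) by blast
  ultimately show ?thesis by (simp add: push_eq_lin_ext)
qed

lemma push_rep:
  assumes S: "S \<subseteq> formal_sums X" and "\<And>s. s \<in> S \<Longrightarrow> push \<phi> s \<in> fs.span T" and p: "p \<in> formal_sums X"
  shows "relcoset T (push \<phi> (rep (relcoset S p))) = relcoset T (push \<phi> p)"
proof (rule relcoset_eqI)
  have "push \<phi> (rep (relcoset S p) - p) \<in> fs.span T"
    by (rule push_span[OF S assms(2) rep_relcoset])
  then show "push \<phi> (rep (relcoset S p)) - push \<phi> p \<in> fs.span T"
    by (simp add: push_diff[OF rep_formal_sums[OF S p] p])
qed

text \<open>Expanding the second argument into generators reduces the claim to one generator \<open>y\<close> at a
  time.\<close>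

lemma push2_span:
  assumes S: "S \<subseteq> formal_sums X"
    and SY: "\<And>s y. s \<in> S \<Longrightarrow> y \<in> Y \<Longrightarrow> push (\<lambda>x. \<beta> x y) s \<in> fs.span T"
    and p: "p \<in> fs.span S" and q: "q \<in> formal_sums Y"
  shows "push2 \<beta> p q \<in> fs.span T"
proof -
  have pX: "p \<in> formal_sums X" using p span_formal_sums[OF S] by blast
  have fin: "finite {y. q y \<noteq> 0}" "{y. q y \<noteq> 0} \<subseteq> Y" using q by (auto simp: formal_sums_def)
  have "push2 \<beta> p q = (\<lambda>z. \<Sum>y | q y \<noteq> 0. q y * push (\<lambda>x. \<beta> x y) p z)"
    unfolding push2_flip[of \<beta>]
    by (simp add: push2_eq_lin_ext[OF q pX] lin_ext_function_module[OF q] fun_eq_iff)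
  also have "\<dots> = (\<Sum>y | q y \<noteq> 0. (\<lambda>z. q y * push (\<lambda>x. \<beta> x y) p z))"
    using fin(1) by (induction rule: finite_induct) (auto simp: fun_eq_iff)
  also have "\<dots> \<in> fs.span T"
  proof (rule fs.span_sum)
    fix y assume "y \<in> {y. q y \<noteq> 0}"
    then have "push (\<lambda>x. \<beta> x y) p \<in> fs.span T" using push_span[OF S SY p] fin(2) by blast
    then show "(\<lambda>z. q y * push (\<lambda>x. \<beta> x y) p z) \<in> fs.span T" by (rule fs.span_scale)
  qed
  finally show ?thesis .
qed

lemma push2_diff:
  assumes "p \<in> formal_sums X" "p' \<in> formal_sums X" "q \<in> formal_sums Y"
  shows "push2 \<beta> (p - p') q = push2 \<beta> p q - push2 \<beta> p' q"
  using assms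
  by (simp add: push2_eq_lin_ext[where X = X and Y = Y] formal_sums_diff
      lin_ext_diff[OF module_function_module, where X = X] function_module_simps
      minus_function_module)

text \<open>Changing one representative at a time splits the difference into two terms to which
  \<open>push2_span\<close> applies.\<close>

lemma push2_rep:
  assumes S: "S \<subseteq> formal_sums X" and S': "S' \<subseteq> formal_sums Y"
    and SY: "\<And>s y. s \<in> S \<Longrightarrow> y \<in> Y \<Longrightarrow> push (\<lambda>x. \<beta> x y) s \<in> fs.span T"
    and XS: "\<And>x s. x \<in> X \<Longrightarrow> s \<in> S' \<Longrightarrow> push (\<beta> x) s \<in> fs.span T"
    and p: "p \<in> formal_sums X" and q: "q \<in> formal_sums Y"
  shows "relcoset T (push2 \<beta> (rep (relcoset S p)) (rep (relcoset S' q))) = relcoset T (push2 \<beta> p q)"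
proof (rule relcoset_eqI)
  let ?p = "rep (relcoset S p)" and ?q = "rep (relcoset S' q)"
  note rp = rep_formal_sums[OF S p] and rq = rep_formal_sums[OF S' q]
  have "push2 \<beta> (?p - p) ?q \<in> fs.span T"
    by (rule push2_span[OF S SY rep_relcoset rq])
  moreover have "push2 (\<lambda>y x. \<beta> x y) (?q - q) p \<in> fs.span T"
    by (rule push2_span[OF S' XS rep_relcoset p])
  ultimately have "(push2 \<beta> ?p ?q - push2 \<beta> p ?q) + (push2 \<beta> p ?q - push2 \<beta> p q) \<in> fs.span T"
    using push2_diff[OF rp p rq, of \<beta>] push2_diff[OF rq q p, of "\<lambda>y x. \<beta> x y"]
    by (intro fs.span_add) (simp_all add: push2_flip[of \<beta> p])
  then show "push2 \<beta> ?p ?q - push2 \<beta> p q \<in> fs.span T" by simp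
qed

lemma push2_gen: "push2 \<beta> (gen x) (gen y) = gen (\<beta> x y)"
  by (simp add: push2_eq_lin_ext[OF formal_sums_gen formal_sums_gen, where X = "{x}" and Y = "{y}"]
      lin_ext_gen[OF module_function_module, where X = "{x}"] function_module_simps)

section \<open>Tensor products of modules\<close>

lemma
  assumes "bilinear_map M N P \<beta>"
  shows bilinear_left: "y \<in> carrier N \<Longrightarrow> linear_map M P (\<lambda>x. \<beta> x y)"
    and bilinear_right: "x \<in> carrier M \<Longrightarrow> linear_map N P (\<beta> x)"
  using assms by (auto simp: bilinear_map_def)

lemma
  assumes "bilinear_map M N P \<beta>" "x \<in> carrier M" "y \<in> carrier N"
  shows bilinear_closed: "\<beta> x y \<in> carrier P"
    and bilinear_add_left: "x' \<in> carrier M \<Longrightarrow> \<beta> (x \<oplus>\<^bsub>M\<^esub> x') y = \<beta> x y \<oplus>\<^bsub>P\<^esub> \<beta> x' y"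
    and bilinear_add_right: "y' \<in> carrier N \<Longrightarrow> \<beta> x (y \<oplus>\<^bsub>N\<^esub> y') = \<beta> x y \<oplus>\<^bsub>P\<^esub> \<beta> x y'"
    and bilinear_smult_left: "\<beta> (r \<odot>\<^bsub>M\<^esub> x) y = r \<odot>\<^bsub>P\<^esub> \<beta> x y"
    and bilinear_smult_right: "\<beta> x (r \<odot>\<^bsub>N\<^esub> y) = r \<odot>\<^bsub>P\<^esub> \<beta> x y"
  using assms by (auto simp: bilinear_map_def linear_map_def)

lemma bilinear_map_cong:
  assumes "bilinear_map M N P \<beta>" "Module.module scalars M" "Module.module scalars N"
    and eq: "\<And>x y. x \<in> carrier M \<Longrightarrow> y \<in> carrier N \<Longrightarrow> \<beta>' x y = \<beta> x y"
  shows "bilinear_map M N P \<beta>'"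
proof -
  interpret M: Module.module scalars M by fact
  interpret N: Module.module scalars N by fact
  show ?thesis using assms(1) eq smod_closed[OF assms(2)] smod_closed[OF assms(3)]
    by (simp add: bilinear_map_def linear_map_def)
qed

lemma bilinear_linear:
  assumes "bilinear_map M N P \<beta>" "linear_map P Q \<phi>"
  shows "bilinear_map M N Q (\<lambda>x y. \<phi> (\<beta> x y))"
  using assms unfolding bilinear_map_def linear_map_def by simp

lemma tensor_relsI:
  assumes "m \<in> carrier M" "n \<in> carrier N"
  shows "m' \<in> carrier M \<Longrightarrow>
      gen (m \<oplus>\<^bsub>M\<^esub> m', n) - gen (m, n) - gen (m', n) \<in> tensor_rels M N id"
    and "n' \<in> carrier N \<Longrightarrow>
      gen (m, n \<oplus>\<^bsub>N\<^esub> n') - gen (m, n) - gen (m, n') \<in> tensor_rels M N id"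
    and "gen (r \<odot>\<^bsub>M\<^esub> m, n) - (\<lambda>x. r * gen (m, n) x) \<in> tensor_rels M N id"
    and "gen (m, r \<odot>\<^bsub>N\<^esub> n) - (\<lambda>x. r * gen (m, n) x) \<in> tensor_rels M N id"
  using assms by (simp_all add: tensor_rels_def) blast+

lemma tensor_rels_formal_sums:
  assumes M: "Module.module scalars M" and N: "Module.module scalars N"
  shows "tensor_rels M N id \<subseteq> formal_sums (carrier M \<times> carrier N)"
proof -
  interpret M: Module.module scalars M by (rule M)
  interpret N: Module.module scalars N by (rule N)
  show ?thesis unfolding tensor_rels_def
    by (auto intro!: formal_sums_diff formal_sums_scale formal_sums_gen)
qed

lemma lin_ext_tensor_rels:
  assumes M: "Module.module scalars M" and N: "Module.module scalars N"
    and P: "Module.module scalars P"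
    and \<beta>: "bilinear_map M N P \<beta>" and s: "s \<in> tensor_rels M N id"
  shows "lin_ext P (\<lambda>(x, y). \<beta> x y) s = \<zero>\<^bsub>P\<^esub>"
proof -
  interpret M: Module.module scalars M by (rule M)
  interpret N: Module.module scalars N by (rule N)
  interpret P: Module.module scalars P by (rule P)
  let ?X = "carrier M \<times> carrier N" and ?l = "lin_ext P (\<lambda>(x, y). \<beta> x y)"
  have c: "\<And>z. z \<in> ?X \<Longrightarrow> (\<lambda>(x, y). \<beta> x y) z \<in> carrier P"
    using bilinear_closed[OF \<beta>] by auto
  note D = lin_ext_diff[OF P c] and G = lin_ext_gen[OF P c] and Sc = lin_ext_scale[OF P c]
  have z: "((a \<oplus>\<^bsub>P\<^esub> b) \<ominus>\<^bsub>P\<^esub> a) \<ominus>\<^bsub>P\<^esub> b = \<zero>\<^bsub>P\<^esub>" if "a \<in> carrier P" "b \<in> carrier P" for a b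
    using that P.r_neg[of "a \<oplus>\<^bsub>P\<^esub> b"] by (simp add: a_minus_def P.a_assoc P.minus_add)
  have r: "a \<ominus>\<^bsub>P\<^esub> a = \<zero>\<^bsub>P\<^esub>" if "a \<in> carrier P" for a
    using that by (simp add: a_minus_def P.r_neg)
  show ?thesis using s unfolding tensor_rels_def
    by (auto simp: D G Sc formal_sums_diff formal_sums_scale formal_sums_gen z
        bilinear_closed[OF \<beta>] bilinear_add_left[OF \<beta>] bilinear_add_right[OF \<beta>]
        bilinear_smult_left[OF \<beta>] bilinear_smult_right[OF \<beta>] r)
qed

text \<open>Linear maps on the factors carry relations to relations of the same kind. The second form, with
  the factors exchanged, serves the swap functor.\<close>

lemma push_tensor_rels:
  assumes M: "Module.module scalars M" and N: "Module.module scalars N"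
    and f: "linear_map M M' f" and g: "linear_map N N' g"
    and s: "s \<in> tensor_rels M N id"
  shows "push (map_prod f g) s \<in> tensor_rels M' N' id"
    and "push (\<lambda>(x, y). (g y, f x)) s \<in> tensor_rels N' M' id"
proof -
  interpret M: Module.module scalars M by (rule M)
  interpret N: Module.module scalars N by (rule N)
  note D = push_diff[where X = "carrier M \<times> carrier N"]
    and Sc = push_scale[where X = "carrier M \<times> carrier N"]
  note F = formal_sums_diff formal_sums_gen formal_sums_scale[OF formal_sums_gen]
  note L = linear_map_closed[OF f] linear_map_closed[OF g]
    linear_map_add[OF f] linear_map_add[OF g] linear_map_smult[OF f] linear_map_smult[OF g]
  consider m m' n where "m \<in> carrier M" "m' \<in> carrier M" "n \<in> carrier N"
      "s = gen (m \<oplus>\<^bsub>M\<^esub> m', n) - gen (m, n) - gen (m', n)"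
    | m n n' where "m \<in> carrier M" "n \<in> carrier N" "n' \<in> carrier N"
      "s = gen (m, n \<oplus>\<^bsub>N\<^esub> n') - gen (m, n) - gen (m, n')"
    | r m n where "m \<in> carrier M" "n \<in> carrier N"
      "s = gen (r \<odot>\<^bsub>M\<^esub> m, n) - (\<lambda>x. r * gen (m, n) x)"
    | r m n where "m \<in> carrier M" "n \<in> carrier N"
      "s = gen (m, r \<odot>\<^bsub>N\<^esub> n) - (\<lambda>x. r * gen (m, n) x)"
    using s unfolding tensor_rels_def by auto
  note cases = this
  show "push (map_prod f g) s \<in> tensor_rels M' N' id"
    by (cases rule: cases) (simp_all add: D Sc F L tensor_relsI)
  show "push (\<lambda>(x, y). (g y, f x)) s \<in> tensor_rels N' M' id"
    by (cases rule: cases) (simp_all add: D Sc F L tensor_relsI)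
qed

section \<open>Pure tensors of cells\<close>

lemma box_rels0_formal_sums:
  assumes "\<And>U V. Module.module scalars (hom0 C U V)" "\<And>U V. Module.module scalars (hom0 D U V)"
  shows "box_rels0 C D A B \<subseteq> formal_sums (box_gens0 C D A B)"
  unfolding box_rels0_def box_gens0_def by (rule tensor_rels_formal_sums[OF assms])

text \<open>This evaluates everything that is defined on the tensor product of two categories by linear
  extension of a bilinear map: the extended tensor functor, and the homotopy components of the
  extended transformations.\<close>

lemma lin_ext_pure:
  assumes C: "\<And>U V. Module.module scalars (hom0 C U V)" and D: "\<And>U V. Module.module scalars (hom0 D U V)"
    and P: "Module.module scalars P"
    and \<beta>: "bilinear_map (hom0 C (fst A) (fst B)) (hom0 D (snd A) (snd B)) P \<beta>"
    and "f \<in> carrier (hom0 C (fst A) (fst B))" "g \<in> carrier (hom0 D (snd A) (snd B))"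
  shows "lin_ext P (\<lambda>(x, y). \<beta> x y) (rep (relcoset (box_rels0 C D A B) (gen (f, g)))) = \<beta> f g"
proof -
  have c: "\<And>z. z \<in> box_gens0 C D A B \<Longrightarrow> (\<lambda>(x, y). \<beta> x y) z \<in> carrier P"
    using bilinear_closed[OF \<beta>] by (auto simp: box_gens0_def)
  have g: "(f, g) \<in> box_gens0 C D A B" using assms by (simp add: box_gens0_def)
  have "lin_ext P (\<lambda>(x, y). \<beta> x y) (rep (relcoset (box_rels0 C D A B) (gen (f, g))))
      = lin_ext P (\<lambda>(x, y). \<beta> x y) (gen (f, g))"
    using lin_ext_tensor_rels[OF C D P \<beta>]
    by (intro lin_ext_rep[OF P c box_rels0_formal_sums[OF C D] _ formal_sums_gen[OF g]])
       (auto simp: box_rels0_def)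
  also have "\<dots> = \<beta> f g" using lin_ext_gen[OF P c g] by simp
  finally show ?thesis .
qed

context
  fixes C :: "('r::comm_ring_1, 'o, 'a, 'b) ch_cat" and D :: "('r, 'p, 'c, 'd) ch_cat"
  assumes C: "ch_category C" and D: "ch_category D"
begin

interpretation C: ch_category C by (rule C)
interpretation D: ch_category D by (rule D)

lemma pure00_eq:
  assumes "f \<in> carrier (hom0 C U U')" "g \<in> carrier (hom0 D V V')"
  shows "pure00 C D f g = ((U, V), (U', V'), relcoset (box_rels0 C D (U, V) (U', V')) (gen (f, g)))"
  using C.ends0[OF assms(1)] D.ends0[OF assms(2)] by (simp add: pure00_def Let_def)

lemma pure00_bilinear:
  "bilinear_map (hom0 C U U') (hom0 D V V') (hom0 (box C D) (U, V) (U', V')) (pure00 C D)"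
proof -
  interpret M: Module.module scalars "hom0 C U U'" by (rule C.module0)
  interpret N: Module.module scalars "hom0 D V V'" by (rule D.module0)
  let ?G = "box_gens0 C D (U, V) (U', V')" and ?S = "box_rels0 C D (U, V) (U', V')"
  let ?X = "carrier (hom0 C U U') \<times> carrier (hom0 D V V')"
  have G: "gen x \<in> formal_sums ?G" if "x \<in> ?X" for x
    using that by (intro formal_sums_gen) (simp add: box_gens0_def)
  have S: "s \<in> tensor_rels (hom0 C U U') (hom0 D V V') id \<Longrightarrow> s \<in> fs.span ?S" for s
    by (rule fs.span_base) (simp add: box_rels0_def)
  have h: "hom0 (box C D) (U, V) (U', V') = tagged (U, V) (U', V') (presented ?G ?S)"
    by (simp add: box_def)
  have a1: "relcoset ?S (gen (m \<oplus>\<^bsub>hom0 C U U'\<^esub> m', n)) = relcoset ?S (gen (m, n) + gen (m', n))"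
    if "m \<in> carrier (hom0 C U U')" "m' \<in> carrier (hom0 C U U')" "n \<in> carrier (hom0 D V V')" for m m' n
    by (rule relcoset_eqI, rule S)
       (use that in \<open>auto simp: tensor_rels_def diff_diff_eq\<close>)
  have a2: "relcoset ?S (gen (m, n \<oplus>\<^bsub>hom0 D V V'\<^esub> n')) = relcoset ?S (gen (m, n) + gen (m, n'))"
    if "m \<in> carrier (hom0 C U U')" "n' \<in> carrier (hom0 D V V')" "n \<in> carrier (hom0 D V V')" for m n n'
    by (rule relcoset_eqI, rule S)
       (use that in \<open>auto simp: tensor_rels_def diff_diff_eq\<close>)
  have s1: "relcoset ?S (gen (r \<odot>\<^bsub>hom0 C U U'\<^esub> m, n)) = relcoset ?S (\<lambda>x. r * gen (m, n) x)"
    if "m \<in> carrier (hom0 C U U')" "n \<in> carrier (hom0 D V V')" for r m n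
    by (rule relcoset_eqI, rule S) (use that in \<open>auto simp: tensor_rels_def\<close>)
  have s2: "relcoset ?S (gen (m, r \<odot>\<^bsub>hom0 D V V'\<^esub> n)) = relcoset ?S (\<lambda>x. r * gen (m, n) x)"
    if "m \<in> carrier (hom0 C U U')" "n \<in> carrier (hom0 D V V')" for r m n
    by (rule relcoset_eqI, rule S) (use that in \<open>auto simp: tensor_rels_def\<close>)
  show ?thesis unfolding bilinear_map_def linear_map_def h
    by (auto simp: pure00_eq[where U = U and U' = U' and V = V and V' = V'] tagged_def presented_simps
        a1 a2 s1 s2 G)
qed

lemma idc_box: "idc (box C D) (U, V) = pure00 C D (idc C U) (idc D V)"
  by (simp add: pure00_eq[OF C.id_cell D.id_cell]) (simp add: box_def)

text \<open>Composition with a fixed pure tensor is linear in each factor, so it maps relations to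
  relations; hence the composite may be computed on the chosen generators.\<close>

lemma pure00_comp:
  assumes "f' \<in> carrier (hom0 C U' U'')" "f \<in> carrier (hom0 C U U')"
    and "g' \<in> carrier (hom0 D V' V'')" "g \<in> carrier (hom0 D V V')"
  shows "pure00 C D f' g' \<bullet>\<^bsub>box C D\<^esub> pure00 C D f g = pure00 C D (f' \<bullet>\<^bsub>C\<^esub> f) (g' \<bullet>\<^bsub>D\<^esub> g)"
proof -
  note c = bilinear_closed[OF C.comp0_bilinear assms(1,2)] bilinear_closed[OF D.comp0_bilinear assms(3,4)]
  let ?b = "\<lambda>(f', g') (f, g). (f' \<bullet>\<^bsub>C\<^esub> f, g' \<bullet>\<^bsub>D\<^esub> g)"
  let ?T = "box_rels0 C D (U, V) (U'', V'')"
  let ?S = "box_rels0 C D (U', V') (U'', V'')" and ?S' = "box_rels0 C D (U, V) (U', V')"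
  let ?X = "box_gens0 C D (U', V') (U'', V'')" and ?Y = "box_gens0 C D (U, V) (U', V')"
  have "relcoset ?T (push2 ?b (rep (relcoset ?S (gen (f', g')))) (rep (relcoset ?S' (gen (f, g)))))
      = relcoset ?T (push2 ?b (gen (f', g')) (gen (f, g)))"
  proof (rule push2_rep[where X = ?X and Y = ?Y])
    show "?S \<subseteq> formal_sums ?X" "?S' \<subseteq> formal_sums ?Y"
      by (rule box_rels0_formal_sums; rule C.module0 D.module0)+
    show "gen (f', g') \<in> formal_sums ?X" "gen (f, g) \<in> formal_sums ?Y"
      using assms by (auto intro!: formal_sums_gen simp: box_gens0_def)
    show "push (\<lambda>x. ?b x y) s \<in> fs.span ?T" if s: "s \<in> ?S" and y: "y \<in> ?Y" for s y
    proof -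
      have e: "(\<lambda>x. ?b x y) = map_prod (\<lambda>f'. f' \<bullet>\<^bsub>C\<^esub> fst y) (\<lambda>g'. g' \<bullet>\<^bsub>D\<^esub> snd y)"
        by (auto simp: fun_eq_iff split: prod.splits)
      have "push (\<lambda>x. ?b x y) s \<in> tensor_rels (hom0 C U U'') (hom0 D V V'') id"
        unfolding e
        by (rule push_tensor_rels(1)[OF C.module0 D.module0])
           (use s y bilinear_left[OF C.comp0_bilinear] bilinear_left[OF D.comp0_bilinear] in
             \<open>auto simp: box_rels0_def box_gens0_def\<close>)
      then show ?thesis by (intro fs.span_base) (simp add: box_rels0_def)
    qed
    show "push (?b x) s \<in> fs.span ?T" if s: "s \<in> ?S'" and x: "x \<in> ?X" for s x
    proof -
      have e: "?b x = map_prod (\<lambda>f. fst x \<bullet>\<^bsub>C\<^esub> f) (\<lambda>g. snd x \<bullet>\<^bsub>D\<^esub> g)"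
        by (auto simp: fun_eq_iff split: prod.splits)
      have "push (?b x) s \<in> tensor_rels (hom0 C U U'') (hom0 D V V'') id"
        unfolding e
        by (rule push_tensor_rels(1)[OF C.module0 D.module0])
           (use s x bilinear_right[OF C.comp0_bilinear] bilinear_right[OF D.comp0_bilinear] in
             \<open>auto simp: box_rels0_def box_gens0_def\<close>)
      then show ?thesis by (intro fs.span_base) (simp add: box_rels0_def)
    qed
  qed
  then show ?thesis
    using pure00_eq[OF assms(1,3)] pure00_eq[OF assms(2,4)] pure00_eq[OF c]
    by (simp add: push2_gen) (simp add: box_def)
qed

lemma swap_pure00:
  assumes f: "f \<in> carrier (hom0 C U U')" and g: "g \<in> carrier (hom0 D V V')"
  shows "fmap0 (swap_fun C D) (pure00 C D f g) = pure00 D C g f"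
proof -
  let ?T = "box_rels0 D C (V, U) (V', U')" and ?S = "box_rels0 C D (U, V) (U', V')"
  have "relcoset ?T (push prod.swap (rep (relcoset ?S (gen (f, g)))))
     = relcoset ?T (push prod.swap (gen (f, g)))"
  proof (rule push_rep[where X = "box_gens0 C D (U, V) (U', V')"])
    show "?S \<subseteq> formal_sums (box_gens0 C D (U, V) (U', V'))"
      by (rule box_rels0_formal_sums; rule C.module0 D.module0)
    show "gen (f, g) \<in> formal_sums (box_gens0 C D (U, V) (U', V'))"
      using assms by (auto intro!: formal_sums_gen simp: box_gens0_def)
    fix s assume s: "s \<in> ?S"
    have e: "prod.swap = (\<lambda>(x, y). (id y, id x))" by (auto simp: fun_eq_iff)
    have "push prod.swap s \<in> tensor_rels (hom0 D V V') (hom0 C U U') id"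
      unfolding e
      by (rule push_tensor_rels(2)[OF C.module0 D.module0])
         (use s in \<open>auto simp: box_rels0_def linear_map_def\<close>)
    then show "push prod.swap s \<in> fs.span ?T"
      by (intro fs.span_base) (simp add: box_rels0_def)
  qed
  then show ?thesis
    using C.ends0[OF f] D.ends0[OF g]
    by (simp add: swap_fun_def pure00_def Let_def)
qed

end

section \<open>Cells of a symmetric strict monoidal category\<close>

context ch_category
begin

lemma comp0_closed:
  "\<lbrakk>g \<in> carrier (hom0 C V W); f \<in> carrier (hom0 C U V)\<rbrakk> \<Longrightarrow> g \<bullet> f \<in> carrier (hom0 C U W)"
  by (rule bilinear_closed[OF comp0_bilinear])

lemma lcomp_closed:
  "\<lbrakk>g \<in> carrier (hom0 C V W); \<phi> \<in> carrier (hom1 C U V)\<rbrakk> \<Longrightarrow> g \<triangleright> \<phi> \<in> carrier (hom1 C U W)"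
  by (rule bilinear_closed[OF lcomp_bilinear])

lemma rcomp_closed:
  "\<lbrakk>\<phi> \<in> carrier (hom1 C V W); f \<in> carrier (hom0 C U V)\<rbrakk> \<Longrightarrow> \<phi> \<triangleleft> f \<in> carrier (hom1 C U W)"
  by (rule bilinear_closed[OF rcomp_bilinear])

lemmas closed = comp0_closed lcomp_closed rcomp_closed id_cell

lemma lcomp_zero: "g \<in> carrier (hom0 C V W) \<Longrightarrow> g \<triangleright> \<zero>\<^bsub>hom1 C U V\<^esub> = \<zero>\<^bsub>hom1 C U W\<^esub>"
  by (rule linear_map_zero[OF module1 module1 bilinear_right[OF lcomp_bilinear]])

lemma rcomp_zero: "f \<in> carrier (hom0 C U V) \<Longrightarrow> \<zero>\<^bsub>hom1 C V W\<^esub> \<triangleleft> f = \<zero>\<^bsub>hom1 C U W\<^esub>"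
  by (rule linear_map_zero[OF module1 module1 bilinear_left[OF rcomp_bilinear]])

lemma comp0_zero_right: "g \<in> carrier (hom0 C V W) \<Longrightarrow> g \<bullet> \<zero>\<^bsub>hom0 C U V\<^esub> = \<zero>\<^bsub>hom0 C U W\<^esub>"
  by (rule linear_map_zero[OF module0 module0 bilinear_right[OF comp0_bilinear]])

lemma comp0_zero_left: "f \<in> carrier (hom0 C U V) \<Longrightarrow> \<zero>\<^bsub>hom0 C V W\<^esub> \<bullet> f = \<zero>\<^bsub>hom0 C U W\<^esub>"
  by (rule linear_map_zero[OF module0 module0 bilinear_left[OF comp0_bilinear]])

lemma add0_eq: "f \<in> carrier (hom0 C U V) \<Longrightarrow> f +\<^sub>0 g = f \<oplus>\<^bsub>hom0 C U V\<^esub> g"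
  and diff0_eq: "f \<in> carrier (hom0 C U V) \<Longrightarrow> f -\<^sub>0 g = f \<ominus>\<^bsub>hom0 C U V\<^esub> g"
  and scale0_eq: "f \<in> carrier (hom0 C U V) \<Longrightarrow> scale0 C r f = r \<odot>\<^bsub>hom0 C U V\<^esub> f"
  using ends0[of f U V] by (auto simp: add0_def diff0_def scale0_def)

lemma add1_eq: "\<phi> \<in> carrier (hom1 C U V) \<Longrightarrow> \<phi> +\<^sub>1 \<psi> = \<phi> \<oplus>\<^bsub>hom1 C U V\<^esub> \<psi>"
  and diff1_eq: "\<phi> \<in> carrier (hom1 C U V) \<Longrightarrow> \<phi> -\<^sub>1 \<psi> = \<phi> \<ominus>\<^bsub>hom1 C U V\<^esub> \<psi>"
  and neg1_eq: "\<phi> \<in> carrier (hom1 C U V) \<Longrightarrow> neg1 C \<phi> = \<ominus>\<^bsub>hom1 C U V\<^esub> \<phi>"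
  and scale1_eq: "\<phi> \<in> carrier (hom1 C U V) \<Longrightarrow> scale1 C r \<phi> = r \<odot>\<^bsub>hom1 C U V\<^esub> \<phi>"
  using ends1[of \<phi> U V] by (auto simp: add1_def diff1_def neg1_def scale1_def)

text \<open>The next three laws bring every term of the axiom into the form of one 1-cell applied to a linear
  combination of 2-cells: scalars and 1-cells are collected, and a 1-cell composed on the right is
  moved to the left.\<close>

lemma lcomp_smult_lcomp:
  assumes "g \<in> carrier (hom0 C V W)" "h \<in> carrier (hom0 C U' V)" "x \<in> carrier (hom1 C U U')"
  shows "g \<triangleright> (r \<odot>\<^bsub>hom1 C U V\<^esub> (h \<triangleright> x)) = g \<bullet> h \<triangleright> (r \<odot>\<^bsub>hom1 C U U'\<^esub> x)"
  using assms lcomp_closed[OF assms(2,3)] assoc001[OF assms(1,2) smod_closed[OF module1 assms(3), of r]]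
  by (simp add: bilinear_smult_right[OF lcomp_bilinear assms(2,3), symmetric])

lemma smult_lcomp_rcomp:
  assumes g: "g \<in> carrier (hom0 C V W)" and k: "k \<in> carrier (hom0 C U V)"
    and y: "y \<in> carrier (hom1 C V V)" and y': "y' \<in> carrier (hom1 C U U)"
    and c: "y \<triangleleft> k = k \<triangleright> y'"
  shows "(r \<odot>\<^bsub>hom1 C V W\<^esub> (g \<triangleright> y)) \<triangleleft> k = g \<bullet> k \<triangleright> (r \<odot>\<^bsub>hom1 C U U\<^esub> y')"
proof -
  have "(r \<odot>\<^bsub>hom1 C V W\<^esub> (g \<triangleright> y)) \<triangleleft> k = r \<odot>\<^bsub>hom1 C U W\<^esub> (g \<triangleright> (y \<triangleleft> k))"
    using bilinear_smult_left[OF rcomp_bilinear lcomp_closed[OF g y] k] assoc010[OF g y k] by simp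
  also have "\<dots> = r \<odot>\<^bsub>hom1 C U W\<^esub> (g \<bullet> k \<triangleright> y')"
    unfolding c using assoc001[OF g k y'] by simp
  also have "\<dots> = g \<bullet> k \<triangleright> (r \<odot>\<^bsub>hom1 C U U\<^esub> y')"
    using bilinear_smult_right[OF lcomp_bilinear comp0_closed[OF g k] y'] by simp
  finally show ?thesis .
qed

lemma comb_commute:
  assumes k: "k \<in> carrier (hom0 C U V)"
    and "x \<in> carrier (hom1 C V V)" "y \<in> carrier (hom1 C V V)"
    and "x' \<in> carrier (hom1 C U U)" "y' \<in> carrier (hom1 C U U)"
    and "x \<triangleleft> k = k \<triangleright> x'" "y \<triangleleft> k = k \<triangleright> y'"
  shows "(r \<odot>\<^bsub>hom1 C V V\<^esub> x \<oplus>\<^bsub>hom1 C V V\<^esub> s \<odot>\<^bsub>hom1 C V V\<^esub> y) \<triangleleft> k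
    = k \<triangleright> (r \<odot>\<^bsub>hom1 C U U\<^esub> x' \<oplus>\<^bsub>hom1 C U U\<^esub> s \<odot>\<^bsub>hom1 C U U\<^esub> y')"
  using assms linear_map_add[OF bilinear_left[OF rcomp_bilinear k]]
    linear_map_add[OF bilinear_right[OF lcomp_bilinear k]]
    linear_map_smult[OF bilinear_left[OF rcomp_bilinear k]]
    linear_map_smult[OF bilinear_right[OF lcomp_bilinear k]]
  by (simp add: smod_closed[OF module1])

end

context symmetric_strict_monoidal
begin

text \<open>Strict associativity of objects is used as a rewrite rule from left to right; together with the
  right-associative notation, triple tensor products have one normal form.\<close>

abbreviation hom :: "'o \<Rightarrow> 'o \<Rightarrow> 'a set" where "hom U V \<equiv> carrier (hom0 C U V)"
abbreviation htp :: "'o \<Rightarrow> 'o \<Rightarrow> 'b set" where "htp U V \<equiv> carrier (hom1 C U V)"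
abbreviation ob_tensor :: "'o \<Rightarrow> 'o \<Rightarrow> 'o" (infixr "\<diamondop>" 75) where "U \<diamondop> V \<equiv> tob M U V"
abbreviation cell_tensor :: "'a \<Rightarrow> 'a \<Rightarrow> 'a" (infixr "\<star>" 75) where "f \<star> g \<equiv> ten00 C M f g"
abbreviation \<gamma> :: "'o \<Rightarrow> 'o \<Rightarrow> 'a" where "\<gamma> \<equiv> pob2 (braid M)"
abbreviation one :: "'o \<Rightarrow> 'a" where "one \<equiv> idc C"

lemma ten00_bilinear:
  "bilinear_map (hom0 C U U') (hom0 C V V') (hom0 C (U \<diamondop> V) (U' \<diamondop> V')) (ten00 C M)"
  using bilinear_linear[OF pure00_bilinear[OF ch_category_axioms ch_category_axioms]
      tensor.fmap0_linear]
  unfolding ten00_def tob_def .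

lemma ten00_closed: "f \<in> hom U U' \<Longrightarrow> g \<in> hom V V' \<Longrightarrow> f \<star> g \<in> hom (U \<diamondop> V) (U' \<diamondop> V')"
  by (rule bilinear_closed[OF ten00_bilinear])

lemma pure00_closed:
  "f \<in> hom U U' \<Longrightarrow> g \<in> hom V V' \<Longrightarrow> pure00 C C f g \<in> carrier (hom0 (box C C) (U, V) (U', V'))"
  by (rule bilinear_closed[OF pure00_bilinear[OF ch_category_axioms ch_category_axioms]])

lemma ten00_comp:
  assumes "f' \<in> hom U' U''" "f \<in> hom U U'" "g' \<in> hom V' V''" "g \<in> hom V V'"
  shows "f' \<star> g' \<bullet>\<^bsub>C\<^esub> f \<star> g = (f' \<bullet>\<^bsub>C\<^esub> f) \<star> (g' \<bullet>\<^bsub>C\<^esub> g)"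
  unfolding ten00_def pure00_comp[OF ch_category_axioms ch_category_axioms assms, symmetric]
  by (rule tensor.fmap_comp0[symmetric, OF pure00_closed[OF assms(1,3)] pure00_closed[OF assms(2,4)]])

lemma ten00_id: "one U \<star> one V = one (U \<diamondop> V)"
  unfolding ten00_def tob_def
  by (simp add: idc_box[OF ch_category_axioms ch_category_axioms, symmetric] tensor.fmap_id)

lemma \<gamma>_cell: "\<gamma> U V \<in> hom (U \<diamondop> V) (V \<diamondop> U)"
  using braid.pob_cell[of "(U, V)"] by (simp add: pob2_def tob_def fun_comp_def swap_fun_def)

lemma htpy2_braid:
  assumes "f \<in> hom U U'" "g \<in> hom V V'"
  shows "htpy2 C (braid M) f g = \<zero>\<^bsub>hom1 C (U \<diamondop> V) (V' \<diamondop> U')\<^esub>"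
  using braid.phtpy_zero[OF pure00_closed[OF assms]]
  by (simp add: htpy2_def tob_def fun_comp_def swap_fun_def)

lemma \<gamma>_natural:
  assumes f: "f \<in> hom U U'" and g: "g \<in> hom V V'"
  shows "g \<star> f \<bullet>\<^bsub>C\<^esub> \<gamma> U V = \<gamma> U' V' \<bullet>\<^bsub>C\<^esub> f \<star> g"
proof -
  interpret N: Module.module scalars "hom0 C (U \<diamondop> V) (V' \<diamondop> U')" by (rule module0)
  note p = pure00_closed[OF f g]
  have l: "g \<star> f \<bullet>\<^bsub>C\<^esub> \<gamma> U V \<in> hom (U \<diamondop> V) (V' \<diamondop> U')"
    by (rule closed ten00_closed[OF g f] \<gamma>_cell)+
  have r: "\<gamma> U' V' \<bullet>\<^bsub>C\<^esub> f \<star> g \<in> hom (U \<diamondop> V) (V' \<diamondop> U')"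
    by (rule closed ten00_closed[OF f g] \<gamma>_cell)+
  have "g \<star> f \<bullet>\<^bsub>C\<^esub> \<gamma> U V -\<^sub>0\<^bsub>C\<^esub> \<gamma> U' V' \<bullet>\<^bsub>C\<^esub> f \<star> g = bd C (phtpy (braid M) (pure00 C C f g))"
    using braid.pnat0[OF p] swap_pure00[OF ch_category_axioms ch_category_axioms f g]
    by (simp add: ten00_def pob2_def fun_comp_def)
  also have "\<dots> = \<zero>\<^bsub>hom0 C (U \<diamondop> V) (V' \<diamondop> U')\<^esub>"
    using htpy2_braid[OF f g] linear_map_zero[OF module1 module0 bd_linear]
    by (simp add: htpy2_def)
  finally show ?thesis using N.minus_zero_iff[OF l r] by (simp add: diff0_eq[OF l])
qed

lemma three_cells:
  shows \<gamma>_one: "\<gamma> U V \<star> one W \<in> hom (U \<diamondop> V \<diamondop> W) (V \<diamondop> U \<diamondop> W)"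
    and one_\<gamma>: "one U \<star> \<gamma> V W \<in> hom (U \<diamondop> V \<diamondop> W) (U \<diamondop> W \<diamondop> V)"
    and \<gamma>_right: "\<gamma> U (V \<diamondop> W) \<in> hom (U \<diamondop> V \<diamondop> W) (V \<diamondop> W \<diamondop> U)"
    and \<gamma>_left: "\<gamma> (U \<diamondop> V) W \<in> hom (U \<diamondop> V \<diamondop> W) (W \<diamondop> U \<diamondop> V)"
  using ten00_closed[OF \<gamma>_cell id_cell, of U V W] ten00_closed[OF id_cell \<gamma>_cell, of U V W]
    \<gamma>_cell[of U "V \<diamondop> W"] \<gamma>_cell[of "U \<diamondop> V" W]
  by (simp_all add: assoc_ob)

lemma \<gamma>_one_inverse: "\<gamma> V U \<star> one W \<bullet>\<^bsub>C\<^esub> \<gamma> U V \<star> one W = one (U \<diamondop> V \<diamondop> W)"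
  using ten00_comp[OF \<gamma>_cell \<gamma>_cell id_cell id_cell] comp0_id[OF id_cell]
  by (simp add: braid_symmetric ten00_id assoc_ob)

lemma one_\<gamma>_inverse: "one U \<star> \<gamma> W V \<bullet>\<^bsub>C\<^esub> one U \<star> \<gamma> V W = one (U \<diamondop> V \<diamondop> W)"
  using ten00_comp[OF id_cell id_cell \<gamma>_cell \<gamma>_cell] comp0_id[OF id_cell]
  by (simp add: braid_symmetric ten00_id assoc_ob)

text \<open>Symmetry turns the given hexagon into the one for a tensor product in the first argument: both
  sides are right inverse to the same invertible braiding.\<close>

lemma hexagon':
  "\<gamma> (U \<diamondop> V) W = \<gamma> U W \<star> one V \<bullet>\<^bsub>C\<^esub> one U \<star> \<gamma> V W"
proof -
  let ?X = "\<gamma> U W \<star> one V \<bullet>\<^bsub>C\<^esub> one U \<star> \<gamma> V W"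
  have X: "?X \<in> hom (U \<diamondop> V \<diamondop> W) (W \<diamondop> U \<diamondop> V)" by (rule closed three_cells)+
  have "\<gamma> W (U \<diamondop> V) \<bullet>\<^bsub>C\<^esub> ?X
      = one U \<star> \<gamma> W V \<bullet>\<^bsub>C\<^esub> (\<gamma> W U \<star> one V \<bullet>\<^bsub>C\<^esub> (\<gamma> U W \<star> one V \<bullet>\<^bsub>C\<^esub> one U \<star> \<gamma> V W))"
    unfolding hexagon[of W U V] by (rule assoc000[OF one_\<gamma> \<gamma>_one X])
  also have "\<gamma> W U \<star> one V \<bullet>\<^bsub>C\<^esub> (\<gamma> U W \<star> one V \<bullet>\<^bsub>C\<^esub> one U \<star> \<gamma> V W) = one U \<star> \<gamma> V W"
    using assoc000[OF \<gamma>_one[of W U V] \<gamma>_one[of U W V] one_\<gamma>[of U V W]] comp0_id[OF one_\<gamma>[of U V W]]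
    by (simp add: \<gamma>_one_inverse)
  finally have i: "\<gamma> W (U \<diamondop> V) \<bullet>\<^bsub>C\<^esub> ?X = one (U \<diamondop> V \<diamondop> W)" by (simp add: one_\<gamma>_inverse)
  have "\<gamma> (U \<diamondop> V) W = \<gamma> (U \<diamondop> V) W \<bullet>\<^bsub>C\<^esub> (\<gamma> W (U \<diamondop> V) \<bullet>\<^bsub>C\<^esub> ?X)"
    using comp0_id[OF \<gamma>_left[of U V W]] by (simp add: i)
  also have "\<dots> = ?X"
    using assoc000[OF \<gamma>_left \<gamma>_right X] comp0_id[OF X] braid_symmetric[of "U \<diamondop> V" W]
    by (simp add: assoc_ob)
  finally show ?thesis .
qed

definition reversal :: "'o \<Rightarrow> 'o \<Rightarrow> 'o \<Rightarrow> 'a" where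
  "reversal U V W = \<gamma> U (W \<diamondop> V) \<bullet>\<^bsub>C\<^esub> one U \<star> \<gamma> V W"

lemma reversal_cell: "reversal U V W \<in> hom (U \<diamondop> V \<diamondop> W) (W \<diamondop> V \<diamondop> U)"
  unfolding reversal_def by (rule closed three_cells)+

text \<open>The first and the last identity are naturality of \<open>\<gamma>\<close> at a braiding. In the middle one, the two
  hexagons expand both sides into the same product of three braidings.\<close>

lemma reversal_eq:
  shows "\<gamma> V W \<star> one U \<bullet>\<^bsub>C\<^esub> \<gamma> U (V \<diamondop> W) = reversal U V W"
    and "one W \<star> \<gamma> U V \<bullet>\<^bsub>C\<^esub> \<gamma> (U \<diamondop> V) W = reversal U V W"
    and "\<gamma> (V \<diamondop> U) W \<bullet>\<^bsub>C\<^esub> \<gamma> U V \<star> one W = reversal U V W"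
proof -
  show "\<gamma> V W \<star> one U \<bullet>\<^bsub>C\<^esub> \<gamma> U (V \<diamondop> W) = reversal U V W"
    unfolding reversal_def by (rule \<gamma>_natural[OF id_cell \<gamma>_cell])
  show e: "one W \<star> \<gamma> U V \<bullet>\<^bsub>C\<^esub> \<gamma> (U \<diamondop> V) W = reversal U V W"
    unfolding reversal_def hexagon[of U W V] hexagon'[of U V W]
    by (rule assoc000[OF one_\<gamma> \<gamma>_one one_\<gamma>, symmetric])
  show "\<gamma> (V \<diamondop> U) W \<bullet>\<^bsub>C\<^esub> \<gamma> U V \<star> one W = reversal U V W"
    unfolding e[symmetric] by (rule \<gamma>_natural[OF \<gamma>_cell id_cell, symmetric])
qed

text \<open>A one-sided inverse is enough to cancel the reversal.\<close>

lemma reversal_retract: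
  obtains k where "k \<in> hom (W \<diamondop> V \<diamondop> U) (U \<diamondop> V \<diamondop> W)"
    and "k \<bullet>\<^bsub>C\<^esub> reversal U V W = one (U \<diamondop> V \<diamondop> W)"
proof
  let ?k = "one U \<star> \<gamma> W V \<bullet>\<^bsub>C\<^esub> \<gamma> (W \<diamondop> V) U"
  show "?k \<in> hom (W \<diamondop> V \<diamondop> U) (U \<diamondop> V \<diamondop> W)" by (rule closed three_cells)+
  have "?k \<bullet>\<^bsub>C\<^esub> reversal U V W
      = one U \<star> \<gamma> W V \<bullet>\<^bsub>C\<^esub> (\<gamma> (W \<diamondop> V) U \<bullet>\<^bsub>C\<^esub> (\<gamma> U (W \<diamondop> V) \<bullet>\<^bsub>C\<^esub> one U \<star> \<gamma> V W))"
    unfolding reversal_def by (rule assoc000) (rule closed three_cells)+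
  also have "\<gamma> (W \<diamondop> V) U \<bullet>\<^bsub>C\<^esub> (\<gamma> U (W \<diamondop> V) \<bullet>\<^bsub>C\<^esub> one U \<star> \<gamma> V W) = one U \<star> \<gamma> V W"
    using assoc000[OF \<gamma>_left[of W V U] \<gamma>_right[of U W V] one_\<gamma>[of U V W]] comp0_id[OF one_\<gamma>[of U V W]]
    by (simp add: braid_symmetric)
  finally show "?k \<bullet>\<^bsub>C\<^esub> reversal U V W = one (U \<diamondop> V \<diamondop> W)" by (simp add: one_\<gamma>_inverse)
qed

end

section \<open>Homotopy components of infinitesimal 2-braidings\<close>

context infinitesimal_2_braiding
begin

abbreviation t_cell :: "'o \<Rightarrow> 'o \<Rightarrow> 'a" where "t_cell \<equiv> pob2 t"
abbreviation t_htpy :: "'a \<Rightarrow> 'a \<Rightarrow> 'b" where "t_htpy \<equiv> htpy2 C t"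

lemma t_cell: "t_cell U V \<in> hom (U \<diamondop> V) (U \<diamondop> V)"
  using t.pob_cell[of "(U, V)"] by (simp add: pob2_def tob_def)

lemma t_htpy_bilinear:
  "bilinear_map (hom0 C U U') (hom0 C V V') (hom1 C (U \<diamondop> V) (U' \<diamondop> V')) t_htpy"
  using bilinear_linear[OF pure00_bilinear[OF ch_category_axioms ch_category_axioms]
      t.phtpy_linear]
  unfolding htpy2_def tob_def .

lemma t_htpy_closed: "f \<in> hom U U' \<Longrightarrow> g \<in> hom V V' \<Longrightarrow> t_htpy f g \<in> htp (U \<diamondop> V) (U' \<diamondop> V')"
  by (rule bilinear_closed[OF t_htpy_bilinear])

lemma t_htpy_comp:
  assumes "f' \<in> hom U' U''" "f \<in> hom U U'" "g' \<in> hom V' V''" "g \<in> hom V V'"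
  shows "t_htpy (f' \<bullet>\<^bsub>C\<^esub> f) (g' \<bullet>\<^bsub>C\<^esub> g) =
    t_htpy f' g' \<triangleleft>\<^bsub>C\<^esub> f \<star> g \<oplus>\<^bsub>hom1 C (U \<diamondop> V) (U'' \<diamondop> V'')\<^esub> f' \<star> g' \<triangleright>\<^bsub>C\<^esub> t_htpy f g"
proof -
  have "t_htpy f' g' \<triangleleft>\<^bsub>C\<^esub> f \<star> g \<in> htp (U \<diamondop> V) (U'' \<diamondop> V'')"
    by (rule closed t_htpy_closed ten00_closed assms)+
  then show ?thesis
    using t.phtpy_comp[OF pure00_closed[OF assms(1,3)] pure00_closed[OF assms(2,4)]]
    by (simp add: htpy2_def ten00_def add1_eq
        pure00_comp[OF ch_category_axioms ch_category_axioms assms])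
qed

end

locale totally_symmetric_2_braiding = infinitesimal_2_braiding C M t
  for C :: "('r::comm_ring_1, 'o, 'a, 'b) ch_cat" and M :: "('r, 'o, 'a, 'b) smon"
    and t :: "('o \<times> 'o, ('r, 'o, 'o, 'a, 'a) box0, 'a, 'b) pnat" +
  assumes totally_symmetric: "totally_symmetric_braiding C M t"
begin

lemma \<gamma>_t_cell: "\<gamma> U V \<bullet>\<^bsub>C\<^esub> t_cell U V = t_cell V U \<bullet>\<^bsub>C\<^esub> \<gamma> U V"
  using totally_symmetric
  by (simp add: totally_symmetric_braiding_def symmetric_braiding_def Let_def)

lemma \<gamma>_t_htpy:
  assumes "f \<in> hom U U'" "g \<in> hom V V'"
  shows "\<gamma> U' V' \<triangleright>\<^bsub>C\<^esub> t_htpy f g = t_htpy g f \<triangleleft>\<^bsub>C\<^esub> \<gamma> U V"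
  using totally_symmetric assms
  by (simp add: totally_symmetric_braiding_def symmetric_braiding_def Let_def)

lemma t_htpy_\<gamma>_one:
  "t_htpy (\<gamma> U V) (one W) = \<zero>\<^bsub>hom1 C (U \<diamondop> V \<diamondop> W) (V \<diamondop> U \<diamondop> W)\<^esub>"
  using totally_symmetric by (simp add: totally_symmetric_braiding_def assoc_ob)

text \<open>Total symmetry speaks of the first argument only; the symmetry of the homotopy components
  transports it to the second.\<close>

lemma t_htpy_one_\<gamma>:
  "t_htpy (one U) (\<gamma> V W) = \<zero>\<^bsub>hom1 C (U \<diamondop> V \<diamondop> W) (U \<diamondop> W \<diamondop> V)\<^esub>" (is "?h = _")
proof -
  have h: "?h \<in> htp (U \<diamondop> V \<diamondop> W) (U \<diamondop> W \<diamondop> V)" by (rule t_htpy_closed id_cell \<gamma>_cell)+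
  have "?h = \<gamma> (W \<diamondop> V) U \<triangleright>\<^bsub>C\<^esub> (\<gamma> U (W \<diamondop> V) \<triangleright>\<^bsub>C\<^esub> ?h)"
    using assoc001[OF \<gamma>_cell \<gamma>_cell h] comp1_id[OF h] by (simp add: braid_symmetric)
  also have "\<gamma> U (W \<diamondop> V) \<triangleright>\<^bsub>C\<^esub> ?h = t_htpy (\<gamma> V W) (one U) \<triangleleft>\<^bsub>C\<^esub> \<gamma> U (V \<diamondop> W)"
    by (rule \<gamma>_t_htpy[OF id_cell \<gamma>_cell])
  also have "\<dots> = \<zero>\<^bsub>hom1 C (U \<diamondop> V \<diamondop> W) (W \<diamondop> V \<diamondop> U)\<^esub>"
    by (simp add: t_htpy_\<gamma>_one rcomp_zero[OF \<gamma>_right])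
  finally show ?thesis by (simp add: lcomp_zero[OF \<gamma>_left])
qed

abbreviation L :: "'o \<Rightarrow> 'o \<Rightarrow> 'o \<Rightarrow> 'b" where "L \<equiv> relator_L C t"
abbreviation R :: "'o \<Rightarrow> 'o \<Rightarrow> 'o \<Rightarrow> 'b" where "R \<equiv> relator_R C t"

lemma L_closed: "L U V W \<in> htp (U \<diamondop> V \<diamondop> W) (U \<diamondop> V \<diamondop> W)"
  using t_htpy_closed[OF t_cell id_cell, of U V W] by (simp add: relator_L_def assoc_ob)

lemma R_closed: "R U V W \<in> htp (U \<diamondop> V \<diamondop> W) (U \<diamondop> V \<diamondop> W)"
  unfolding relator_R_def by (rule t_htpy_closed[OF id_cell t_cell])

lemma
  shows one_t: "one U \<star> t_cell V W \<in> hom (U \<diamondop> V \<diamondop> W) (U \<diamondop> V \<diamondop> W)"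
    and t_one: "t_cell U V \<star> one W \<in> hom (U \<diamondop> V \<diamondop> W) (U \<diamondop> V \<diamondop> W)"
  using ten00_closed[OF id_cell t_cell, of U V W] ten00_closed[OF t_cell id_cell, of U V W]
  by (simp_all add: assoc_ob)

text \<open>The product rule for homotopy components: the term with \<open>t(\<gamma>, 1)\<close> vanishes.\<close>

lemma t_htpy_\<gamma>t_one: "t_htpy (\<gamma> U V \<bullet>\<^bsub>C\<^esub> t_cell U V) (one W) = \<gamma> U V \<star> one W \<triangleright>\<^bsub>C\<^esub> L U V W"
  and t_htpy_t\<gamma>_one: "t_htpy (t_cell V U \<bullet>\<^bsub>C\<^esub> \<gamma> U V) (one W) = L V U W \<triangleleft>\<^bsub>C\<^esub> \<gamma> U V \<star> one W"
proof -
  interpret N: Module.module scalars "hom1 C (U \<diamondop> V \<diamondop> W) (V \<diamondop> U \<diamondop> W)" by (rule module1)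
  have "\<gamma> U V \<star> one W \<triangleright>\<^bsub>C\<^esub> L U V W \<in> htp (U \<diamondop> V \<diamondop> W) (V \<diamondop> U \<diamondop> W)"
    by (rule closed three_cells L_closed)+
  then show "t_htpy (\<gamma> U V \<bullet>\<^bsub>C\<^esub> t_cell U V) (one W) = \<gamma> U V \<star> one W \<triangleright>\<^bsub>C\<^esub> L U V W"
    using t_htpy_comp[OF \<gamma>_cell t_cell id_cell id_cell, of U V W] comp0_id[OF id_cell, of W]
      rcomp_zero[OF t_one[of U V W]]
    by (simp add: t_htpy_\<gamma>_one relator_L_def assoc_ob)
  have "L V U W \<triangleleft>\<^bsub>C\<^esub> \<gamma> U V \<star> one W \<in> htp (U \<diamondop> V \<diamondop> W) (V \<diamondop> U \<diamondop> W)"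
    by (rule closed three_cells L_closed)+
  then show "t_htpy (t_cell V U \<bullet>\<^bsub>C\<^esub> \<gamma> U V) (one W) = L V U W \<triangleleft>\<^bsub>C\<^esub> \<gamma> U V \<star> one W"
    using t_htpy_comp[OF t_cell \<gamma>_cell id_cell id_cell, of V U W] comp0_id[OF id_cell, of W]
      lcomp_zero[OF t_one[of V U W]]
    by (simp add: t_htpy_\<gamma>_one relator_L_def assoc_ob)
qed

lemma t_htpy_one_\<gamma>t: "t_htpy (one U) (\<gamma> V W \<bullet>\<^bsub>C\<^esub> t_cell V W) = one U \<star> \<gamma> V W \<triangleright>\<^bsub>C\<^esub> R U V W"
  and t_htpy_one_t\<gamma>: "t_htpy (one U) (t_cell W V \<bullet>\<^bsub>C\<^esub> \<gamma> V W) = R U W V \<triangleleft>\<^bsub>C\<^esub> one U \<star> \<gamma> V W"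
proof -
  interpret N: Module.module scalars "hom1 C (U \<diamondop> V \<diamondop> W) (U \<diamondop> W \<diamondop> V)" by (rule module1)
  have "one U \<star> \<gamma> V W \<triangleright>\<^bsub>C\<^esub> R U V W \<in> htp (U \<diamondop> V \<diamondop> W) (U \<diamondop> W \<diamondop> V)"
    by (rule closed three_cells R_closed)+
  then show "t_htpy (one U) (\<gamma> V W \<bullet>\<^bsub>C\<^esub> t_cell V W) = one U \<star> \<gamma> V W \<triangleright>\<^bsub>C\<^esub> R U V W"
    using t_htpy_comp[OF id_cell id_cell \<gamma>_cell t_cell, of U V W] comp0_id[OF id_cell, of U]
      rcomp_zero[OF one_t[of U V W]]
    by (simp add: t_htpy_one_\<gamma> relator_R_def)
  have "R U W V \<triangleleft>\<^bsub>C\<^esub> one U \<star> \<gamma> V W \<in> htp (U \<diamondop> V \<diamondop> W) (U \<diamondop> W \<diamondop> V)"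
    by (rule closed three_cells R_closed)+
  then show "t_htpy (one U) (t_cell W V \<bullet>\<^bsub>C\<^esub> \<gamma> V W) = R U W V \<triangleleft>\<^bsub>C\<^esub> one U \<star> \<gamma> V W"
    using t_htpy_comp[OF id_cell id_cell t_cell \<gamma>_cell, of U W V] comp0_id[OF id_cell, of U]
      lcomp_zero[OF one_t[of U W V]]
    by (simp add: t_htpy_one_\<gamma> relator_R_def)
qed

lemma L_commute: "L V U W \<triangleleft>\<^bsub>C\<^esub> \<gamma> U V \<star> one W = \<gamma> U V \<star> one W \<triangleright>\<^bsub>C\<^esub> L U V W"
  using t_htpy_\<gamma>t_one[of U V W] t_htpy_t\<gamma>_one[of V U W] \<gamma>_t_cell[of U V] by simp

lemma R_commute: "R U W V \<triangleleft>\<^bsub>C\<^esub> one U \<star> \<gamma> V W = one U \<star> \<gamma> V W \<triangleright>\<^bsub>C\<^esub> R U V W"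
  using t_htpy_one_\<gamma>t[of U V W] t_htpy_one_t\<gamma>[of U W V] \<gamma>_t_cell[of V W] by simp

text \<open>The third relator on \<open>UVW\<close>, belonging to the strands \<open>U\<close> and \<open>W\<close> as \<open>L\<close> and \<open>R\<close> belong to
  \<open>U, V\<close> and \<open>V, W\<close>.\<close>

definition outer :: "'o \<Rightarrow> 'o \<Rightarrow> 'o \<Rightarrow> 'b" where
  "outer U V W = one U \<star> \<gamma> W V \<triangleright>\<^bsub>C\<^esub> L U W V \<triangleleft>\<^bsub>C\<^esub> one U \<star> \<gamma> V W"

lemma outer_closed: "outer U V W \<in> htp (U \<diamondop> V \<diamondop> W) (U \<diamondop> V \<diamondop> W)"
  unfolding outer_def by (rule closed three_cells L_closed)+

text \<open>By symmetry of \<open>t\<close>, the braiding \<open>\<gamma>\<close> of \<open>UW\<close> with \<open>V\<close> carries \<open>t(t, 1)\<close> to \<open>t(1, t)\<close>. The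
  hexagon writes it as a braiding of \<open>V\<close> past \<open>W\<close> followed by one past \<open>U\<close>, which is the difference
  between the two conjugations.\<close>

lemma outer_eq: "\<gamma> V U \<star> one W \<triangleright>\<^bsub>C\<^esub> R V U W \<triangleleft>\<^bsub>C\<^esub> \<gamma> U V \<star> one W = outer U V W"
proof -
  have n: "\<gamma> (U \<diamondop> W) V \<triangleright>\<^bsub>C\<^esub> L U W V = R V U W \<triangleleft>\<^bsub>C\<^esub> \<gamma> (U \<diamondop> W) V"
    unfolding relator_L_def relator_R_def by (rule \<gamma>_t_htpy[OF t_cell id_cell])
  have h: "\<gamma> U V \<star> one W = \<gamma> (U \<diamondop> W) V \<bullet>\<^bsub>C\<^esub> one U \<star> \<gamma> V W"
    using assoc000[OF \<gamma>_one[of U V W] one_\<gamma>[of U W V] one_\<gamma>[of U V W]] comp0_id[OF \<gamma>_one[of U V W]]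
    by (simp add: hexagon' one_\<gamma>_inverse)
  have i: "\<gamma> V U \<star> one W \<bullet>\<^bsub>C\<^esub> \<gamma> (U \<diamondop> W) V = one U \<star> \<gamma> W V"
    using assoc000[OF \<gamma>_one[of V U W] \<gamma>_one[of U V W] one_\<gamma>[of U W V]] comp0_id[OF one_\<gamma>[of U W V]]
    by (simp add: hexagon' \<gamma>_one_inverse)
  have "\<gamma> V U \<star> one W \<triangleright>\<^bsub>C\<^esub> R V U W \<triangleleft>\<^bsub>C\<^esub> \<gamma> U V \<star> one W
      = \<gamma> V U \<star> one W \<triangleright>\<^bsub>C\<^esub> R V U W \<triangleleft>\<^bsub>C\<^esub> \<gamma> (U \<diamondop> W) V \<triangleleft>\<^bsub>C\<^esub> one U \<star> \<gamma> V W"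
    unfolding h by (rule assoc100[symmetric]) (rule closed three_cells R_closed)+
  also have "\<gamma> V U \<star> one W \<triangleright>\<^bsub>C\<^esub> R V U W \<triangleleft>\<^bsub>C\<^esub> \<gamma> (U \<diamondop> W) V
      = \<gamma> V U \<star> one W \<triangleright>\<^bsub>C\<^esub> (\<gamma> (U \<diamondop> W) V \<triangleright>\<^bsub>C\<^esub> L U W V)"
    unfolding n by (rule assoc010) (rule closed three_cells R_closed)+
  also have "\<dots> = one U \<star> \<gamma> W V \<triangleright>\<^bsub>C\<^esub> L U W V"
    unfolding i[symmetric] by (rule assoc001[symmetric]) (rule closed three_cells L_closed)+
  finally show ?thesis by (simp add: outer_def)
qed

lemma L_outer: "L U W V \<triangleleft>\<^bsub>C\<^esub> one U \<star> \<gamma> V W = one U \<star> \<gamma> V W \<triangleright>\<^bsub>C\<^esub> outer U V W"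
proof -
  have c: "L U W V \<triangleleft>\<^bsub>C\<^esub> one U \<star> \<gamma> V W \<in> htp (U \<diamondop> V \<diamondop> W) (U \<diamondop> W \<diamondop> V)"
    by (rule closed three_cells L_closed)+
  have "outer U V W = one U \<star> \<gamma> W V \<triangleright>\<^bsub>C\<^esub> (L U W V \<triangleleft>\<^bsub>C\<^esub> one U \<star> \<gamma> V W)"
    unfolding outer_def by (rule assoc010) (rule closed three_cells L_closed)+
  then show ?thesis
    using assoc001[OF one_\<gamma> one_\<gamma> c] comp1_id[OF c] by (simp add: one_\<gamma>_inverse)
qed

lemma R_outer: "R V U W \<triangleleft>\<^bsub>C\<^esub> \<gamma> U V \<star> one W = \<gamma> U V \<star> one W \<triangleright>\<^bsub>C\<^esub> outer U V W"
proof -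
  have c: "R V U W \<triangleleft>\<^bsub>C\<^esub> \<gamma> U V \<star> one W \<in> htp (U \<diamondop> V \<diamondop> W) (V \<diamondop> U \<diamondop> W)"
    by (rule closed three_cells R_closed)+
  have "outer U V W = \<gamma> V U \<star> one W \<triangleright>\<^bsub>C\<^esub> (R V U W \<triangleleft>\<^bsub>C\<^esub> \<gamma> U V \<star> one W)"
    unfolding outer_eq[symmetric] by (rule assoc010) (rule closed three_cells R_closed)+
  then show ?thesis
    using assoc001[OF \<gamma>_one \<gamma>_one c] comp1_id[OF c] by (simp add: \<gamma>_one_inverse)
qed

text \<open>Both outer members of the coherence condition are \<open>- outer\<close>, so its two equations are one.\<close>

lemma coherent_iff:
  "coherent_braiding C M t \<longleftrightarrow>
    (\<forall>U V W. L U V W \<oplus>\<^bsub>hom1 C (U \<diamondop> V \<diamondop> W) (U \<diamondop> V \<diamondop> W)\<^esub> R U V W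
       = \<ominus>\<^bsub>hom1 C (U \<diamondop> V \<diamondop> W) (U \<diamondop> V \<diamondop> W)\<^esub> outer U V W)"
proof -
  have "neg1 C (outer U V W) = \<ominus>\<^bsub>hom1 C (U \<diamondop> V \<diamondop> W) (U \<diamondop> V \<diamondop> W)\<^esub> outer U V W" for U V W
    by (rule neg1_eq[OF outer_closed])
  moreover have "L U V W +\<^sub>1\<^bsub>C\<^esub> R U V W = L U V W \<oplus>\<^bsub>hom1 C (U \<diamondop> V \<diamondop> W) (U \<diamondop> V \<diamondop> W)\<^esub> R U V W" for U V W
    by (rule add1_eq[OF L_closed])
  ultimately show ?thesis
    using outer_eq unfolding coherent_braiding_def outer_def relator_L_def relator_R_def Let_def
    by metis
qed

end

section \<open>Extension of scalars\<close>

lemma trunc_module_carrier: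
  "x \<in> carrier (trunc_module N) \<longleftrightarrow>
    coef0 x \<in> carrier N \<and> coef1 x \<in> carrier N \<and> coef2 x \<in> carrier N"
  by (cases x) (simp add: trunc_module_def)

lemma trunc_module_simps:
  "\<zero>\<^bsub>trunc_module N\<^esub> = Trunc \<zero>\<^bsub>N\<^esub> \<zero>\<^bsub>N\<^esub> \<zero>\<^bsub>N\<^esub>"
  "x \<oplus>\<^bsub>trunc_module N\<^esub> y =
     Trunc (coef0 x \<oplus>\<^bsub>N\<^esub> coef0 y) (coef1 x \<oplus>\<^bsub>N\<^esub> coef1 y) (coef2 x \<oplus>\<^bsub>N\<^esub> coef2 y)"
  "r \<odot>\<^bsub>trunc_module N\<^esub> x = Trunc (coef0 r \<odot>\<^bsub>N\<^esub> coef0 x)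
        (coef0 r \<odot>\<^bsub>N\<^esub> coef1 x \<oplus>\<^bsub>N\<^esub> coef1 r \<odot>\<^bsub>N\<^esub> coef0 x)
        (coef0 r \<odot>\<^bsub>N\<^esub> coef2 x \<oplus>\<^bsub>N\<^esub> coef1 r \<odot>\<^bsub>N\<^esub> coef1 x \<oplus>\<^bsub>N\<^esub> coef2 r \<odot>\<^bsub>N\<^esub> coef0 x)"
  by (simp_all add: trunc_module_def)

lemma module_trunc_module:
  assumes N: "Module.module scalars N"
  shows "Module.module scalars (trunc_module N)"
proof -
  interpret N: Module.module scalars N by (rule N)
  show ?thesis
    by (rule scalars_moduleI)
      (auto simp: trunc_module_carrier trunc_module_simps smod[OF N] N.a_ac N.l_neg N.r_neg
        zero_trunc_def one_trunc_def plus_trunc_def times_trunc_def uminus_trunc_def trunc.expand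
        intro!: trunc.expand)
qed

lemma trunc_bilin_bilinear:
  assumes M: "Module.module scalars M" and N: "Module.module scalars N"
    and P: "Module.module scalars P" and \<beta>: "bilinear_map M N P \<beta>"
  shows "bilinear_map (trunc_module M) (trunc_module N) (trunc_module P) (trunc_bilin P \<beta>)"
proof -
  interpret M: Module.module scalars M by (rule M)
  interpret N: Module.module scalars N by (rule N)
  interpret P: Module.module scalars P by (rule P)
  note b = bilinear_closed[OF \<beta>] bilinear_add_left[OF \<beta>] bilinear_add_right[OF \<beta>]
    bilinear_smult_left[OF \<beta>] bilinear_smult_right[OF \<beta>]
  show ?thesis
    unfolding bilinear_map_def linear_map_def
    by (auto simp: trunc_module_carrier trunc_module_simps trunc_bilin_def b
        smod[OF M] smod[OF N] smod[OF P] P.a_ac)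
qed

text \<open>A general associativity law that covers the four associativity axioms of an enriched category,
  which differ only in the kinds of cells involved.\<close>

lemma trunc_bilin_assoc:
  assumes Q: "Module.module scalars Q"
    and P: "Module.module scalars P" and S: "Module.module scalars S"
    and \<beta>: "bilinear_map M N P \<beta>" and \<alpha>: "bilinear_map P L Q \<alpha>"
    and \<epsilon>: "bilinear_map N L S \<epsilon>" and \<delta>: "bilinear_map M S Q \<delta>"
    and eq: "\<And>x y z. \<lbrakk>x \<in> carrier M; y \<in> carrier N; z \<in> carrier L\<rbrakk> \<Longrightarrow> \<alpha> (\<beta> x y) z = \<delta> x (\<epsilon> y z)"
    and "x \<in> carrier (trunc_module M)" "y \<in> carrier (trunc_module N)" "z \<in> carrier (trunc_module L)"
  shows "trunc_bilin Q \<alpha> (trunc_bilin P \<beta> x y) z = trunc_bilin Q \<delta> x (trunc_bilin S \<epsilon> y z)"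
proof -
  interpret P: Module.module scalars P by (rule P)
  interpret Q: Module.module scalars Q by (rule Q)
  interpret S: Module.module scalars S by (rule S)
  note b = bilinear_closed[OF \<beta>] bilinear_closed[OF \<alpha>] bilinear_closed[OF \<epsilon>] bilinear_closed[OF \<delta>]
    bilinear_add_left[OF \<alpha>] bilinear_add_right[OF \<delta>]
  show ?thesis using assms(9-)
    by (simp add: trunc_bilin_def trunc_module_carrier b eq Q.a_ac)
qed

lemma map_trunc_linear:
  assumes M: "Module.module scalars M" and N: "Module.module scalars N" and \<phi>: "linear_map M N \<phi>"
  shows "linear_map (trunc_module M) (trunc_module N) (map_trunc \<phi>)"
proof -
  interpret M: Module.module scalars M by (rule M)
  show ?thesis
    using linear_map_closed[OF \<phi>] linear_map_add[OF \<phi>] linear_map_smult[OF \<phi>]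
    by (auto simp: linear_map_def trunc_module_carrier trunc_module_simps trunc.map_sel smod[OF M])
qed

lemma map_trunc_bilin:
  assumes \<phi>: "linear_map P Q \<phi>" and \<beta>: "bilinear_map M N P \<beta>"
    and P: "Module.module scalars P"
    and "x \<in> carrier (trunc_module M)" "y \<in> carrier (trunc_module N)"
  shows "map_trunc \<phi> (trunc_bilin P \<beta> x y) = trunc_bilin Q (\<lambda>x y. \<phi> (\<beta> x y)) x y"
proof -
  interpret P: Module.module scalars P by (rule P)
  show ?thesis using assms(4-)
    by (simp add: trunc_bilin_def trunc_module_carrier linear_map_add[OF \<phi>] bilinear_closed[OF \<beta>])
qed

context ch_category
begin

abbreviation Ch :: "('r trunc, 'o, 'a trunc, 'b trunc) ch_cat" where "Ch \<equiv> trunc_cat C"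

lemma trunc_cat_hom:
  "hom0 Ch U V = trunc_module (hom0 C U V)" "hom1 Ch U V = trunc_module (hom1 C U V)"
  by (simp_all add: trunc_cat_def)

lemma trunc_cat_ends0: "f \<in> carrier (hom0 Ch U V) \<Longrightarrow> src0 C (coef0 f) = U \<and> tgt0 C (coef0 f) = V"
  and trunc_cat_ends1: "\<phi> \<in> carrier (hom1 Ch U V) \<Longrightarrow> src1 C (coef0 \<phi>) = U \<and> tgt1 C (coef0 \<phi>) = V"
  using ends0[of "coef0 f" U V] ends1[of "coef0 \<phi>" U V]
  by (simp_all add: trunc_cat_hom trunc_module_carrier)

lemma
  shows trunc_comp0: "\<lbrakk>g \<in> carrier (hom0 Ch V W); f \<in> carrier (hom0 Ch U V)\<rbrakk> \<Longrightarrow>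
      g \<bullet>\<^bsub>Ch\<^esub> f = trunc_bilin (hom0 C U W) (\<bullet>) g f"
    and trunc_lcomp: "\<lbrakk>g \<in> carrier (hom0 Ch V W); \<phi> \<in> carrier (hom1 Ch U V)\<rbrakk> \<Longrightarrow>
      g \<triangleright>\<^bsub>Ch\<^esub> \<phi> = trunc_bilin (hom1 C U W) (\<triangleright>) g \<phi>"
    and trunc_rcomp: "\<lbrakk>\<phi> \<in> carrier (hom1 Ch V W); f \<in> carrier (hom0 Ch U V)\<rbrakk> \<Longrightarrow>
      \<phi> \<triangleleft>\<^bsub>Ch\<^esub> f = trunc_bilin (hom1 C U W) (\<triangleleft>) \<phi> f"
  using trunc_cat_ends0[of g V W] trunc_cat_ends0[of f U V] trunc_cat_ends1[of \<phi> U V]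
    trunc_cat_ends1[of \<phi> V W]
  by (simp_all add: trunc_cat_def)

lemma trunc_id: "idc Ch U = Trunc (idc C U) \<zero>\<^bsub>hom0 C U U\<^esub> \<zero>\<^bsub>hom0 C U U\<^esub>"
  by (simp add: trunc_cat_def)

lemma trunc_comp_bilinear:
  "bilinear_map (hom0 Ch V W) (hom0 Ch U V) (hom0 Ch U W) (trunc_bilin (hom0 C U W) (\<bullet>))"
  "bilinear_map (hom0 Ch V W) (hom1 Ch U V) (hom1 Ch U W) (trunc_bilin (hom1 C U W) (\<triangleright>))"
  "bilinear_map (hom1 Ch V W) (hom0 Ch U V) (hom1 Ch U W) (trunc_bilin (hom1 C U W) (\<triangleleft>))"
  unfolding trunc_cat_hom
  by (rule trunc_bilin_bilinear; rule module0 module1 comp0_bilinear lcomp_bilinear rcomp_bilinear)+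

text \<open>Each axiom holds coefficientwise, by bilinearity and the same axiom over the ground ring.\<close>

lemma ch_category_trunc: "ch_category Ch"
proof (rule ch_category.intro)
  have m0: "Module.module scalars (hom0 Ch U V)" and m1: "Module.module scalars (hom1 Ch U V)" for U V
    by (simp_all add: trunc_cat_hom module_trunc_module module0 module1)
  show "Module.module scalars (hom0 Ch U V)" "Module.module scalars (hom1 Ch U V)" for U V
    by (rule m0 m1)+
  show "src0 Ch f = U \<and> tgt0 Ch f = V" if "f \<in> carrier (hom0 Ch U V)" for f U V
    using trunc_cat_ends0[OF that] by (simp add: trunc_cat_def)
  show "src1 Ch f = U \<and> tgt1 Ch f = V" if "f \<in> carrier (hom1 Ch U V)" for f U V
    using trunc_cat_ends1[OF that] by (simp add: trunc_cat_def)
  have bd: "bd Ch = map_trunc (bd C)" by (simp add: trunc_cat_def)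
  show bl: "linear_map (hom1 Ch U V) (hom0 Ch U V) (bd Ch)" for U V
    unfolding bd trunc_cat_hom by (rule map_trunc_linear[OF module1 module0 bd_linear])
  have z0: "\<zero>\<^bsub>hom0 C U V\<^esub> \<in> carrier (hom0 C U V)" for U V
  proof -
    interpret Module.module scalars "hom0 C U V" by (rule module0)
    show ?thesis by simp
  qed
  show "idc Ch U \<in> carrier (hom0 Ch U U)" for U
    by (simp add: trunc_cat_hom trunc_module_carrier trunc_id id_cell z0)
  show c0: "bilinear_map (hom0 Ch V W) (hom0 Ch U V) (hom0 Ch U W) (comp0 Ch)" for U V W
    by (rule bilinear_map_cong[OF trunc_comp_bilinear(1) m0 m0 trunc_comp0])
  show l0: "bilinear_map (hom0 Ch V W) (hom1 Ch U V) (hom1 Ch U W) (lcomp Ch)" for U V W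
    by (rule bilinear_map_cong[OF trunc_comp_bilinear(2) m0 m1 trunc_lcomp])
  show r0: "bilinear_map (hom1 Ch V W) (hom0 Ch U V) (hom1 Ch U W) (rcomp Ch)" for U V W
    by (rule bilinear_map_cong[OF trunc_comp_bilinear(3) m1 m0 trunc_rcomp])
  note cl = bilinear_closed[OF c0] bilinear_closed[OF l0] bilinear_closed[OF r0]
  show "f \<bullet>\<^bsub>Ch\<^esub> idc Ch U = f \<and> idc Ch V \<bullet>\<^bsub>Ch\<^esub> f = f" if f: "f \<in> carrier (hom0 Ch U V)" for f U V
  proof -
    interpret Module.module scalars "hom0 C U V" by (rule module0)
    show ?thesis using f trunc_cat_ends0[OF f] ends0[OF id_cell[of U]] ends0[OF id_cell[of V]]
      by (cases f) (simp add: trunc_cat_def trunc_bilin_def trunc_module_carrier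
          comp0_id[where U = U and V = V] comp0_zero_left[where U = U and V = V and W = V]
          comp0_zero_right[where U = U and V = U and W = V])
  qed
  show "\<phi> \<triangleleft>\<^bsub>Ch\<^esub> idc Ch U = \<phi> \<and> idc Ch V \<triangleright>\<^bsub>Ch\<^esub> \<phi> = \<phi>" if f: "\<phi> \<in> carrier (hom1 Ch U V)" for \<phi> U V
  proof -
    interpret Module.module scalars "hom1 C U V" by (rule module1)
    interpret H: Module.module scalars "hom0 C U U" by (rule module0)
    interpret K: Module.module scalars "hom0 C V V" by (rule module0)
    have z: "\<psi> \<triangleleft> \<zero>\<^bsub>hom0 C U U\<^esub> = \<zero>\<^bsub>hom1 C U V\<^esub>" "\<zero>\<^bsub>hom0 C V V\<^esub> \<triangleright> \<psi> = \<zero>\<^bsub>hom1 C U V\<^esub>"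
      if "\<psi> \<in> carrier (hom1 C U V)" for \<psi>
      using linear_map_zero[OF module0 module1 bilinear_right[OF rcomp_bilinear that]]
        linear_map_zero[OF module0 module1 bilinear_left[OF lcomp_bilinear that]] by auto
    show ?thesis using f trunc_cat_ends1[OF f] ends0[OF id_cell[of U]] ends0[OF id_cell[of V]]
      by (cases \<phi>) (simp add: trunc_cat_def trunc_bilin_def trunc_module_carrier
          comp1_id[where U = U and V = V] z)
  qed
  show "h \<bullet>\<^bsub>Ch\<^esub> g \<bullet>\<^bsub>Ch\<^esub> f = h \<bullet>\<^bsub>Ch\<^esub> (g \<bullet>\<^bsub>Ch\<^esub> f)"
    if "h \<in> carrier (hom0 Ch W X)" "g \<in> carrier (hom0 Ch V W)" "f \<in> carrier (hom0 Ch U V)"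
    for h g f U V W X
    using that cl(1)[OF that(1,2)] cl(1)[OF that(2,3)]
    by (simp add: trunc_comp0[where V = W] trunc_comp0[where V = V])
      (rule trunc_bilin_assoc[OF module0 module0 module0 comp0_bilinear comp0_bilinear
          comp0_bilinear comp0_bilinear assoc000]; simp add: trunc_cat_hom)
  show "(h \<bullet>\<^bsub>Ch\<^esub> g) \<triangleright>\<^bsub>Ch\<^esub> f = h \<triangleright>\<^bsub>Ch\<^esub> (g \<triangleright>\<^bsub>Ch\<^esub> f)"
    if "h \<in> carrier (hom0 Ch W X)" "g \<in> carrier (hom0 Ch V W)" "f \<in> carrier (hom1 Ch U V)"
    for h g f U V W X
    using that cl(1)[OF that(1,2)] cl(2)[OF that(2,3)]
    by (simp add: trunc_comp0[where V = W] trunc_lcomp[where V = W] trunc_lcomp[where V = V])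
      (rule trunc_bilin_assoc[OF module1 module0 module1 comp0_bilinear lcomp_bilinear
          lcomp_bilinear lcomp_bilinear assoc001]; simp add: trunc_cat_hom)
  show "(h \<triangleright>\<^bsub>Ch\<^esub> g) \<triangleleft>\<^bsub>Ch\<^esub> f = h \<triangleright>\<^bsub>Ch\<^esub> (g \<triangleleft>\<^bsub>Ch\<^esub> f)"
    if "h \<in> carrier (hom0 Ch W X)" "g \<in> carrier (hom1 Ch V W)" "f \<in> carrier (hom0 Ch U V)"
    for h g f U V W X
    using that cl(2)[OF that(1,2)] cl(3)[OF that(2,3)]
    by (simp add: trunc_lcomp[where V = W] trunc_rcomp[where V = V])
      (rule trunc_bilin_assoc[OF module1 module1 module1 lcomp_bilinear rcomp_bilinear
          rcomp_bilinear lcomp_bilinear assoc010]; simp add: trunc_cat_hom)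
  show "(h \<triangleleft>\<^bsub>Ch\<^esub> g) \<triangleleft>\<^bsub>Ch\<^esub> f = h \<triangleleft>\<^bsub>Ch\<^esub> (g \<bullet>\<^bsub>Ch\<^esub> f)"
    if "h \<in> carrier (hom1 Ch W X)" "g \<in> carrier (hom0 Ch V W)" "f \<in> carrier (hom0 Ch U V)"
    for h g f U V W X
    using that cl(3)[OF that(1,2)] cl(1)[OF that(2,3)]
    by (simp add: trunc_comp0[where V = V] trunc_rcomp[where V = W] trunc_rcomp[where V = V])
      (rule trunc_bilin_assoc[OF module1 module1 module0 rcomp_bilinear rcomp_bilinear
          comp0_bilinear rcomp_bilinear assoc100]; simp add: trunc_cat_hom)
  show "bd Ch (f \<triangleright>\<^bsub>Ch\<^esub> \<phi>) = f \<bullet>\<^bsub>Ch\<^esub> bd Ch \<phi>"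
    if "f \<in> carrier (hom0 Ch V W)" "\<phi> \<in> carrier (hom1 Ch U V)" for f \<phi> U V W
    using that linear_map_closed[OF bl that(2)] unfolding bd
    by (simp add: trunc_comp0[where V = V] trunc_lcomp[where V = V] trunc_cat_hom
        map_trunc_bilin[OF bd_linear lcomp_bilinear module1])
      (simp add: trunc_bilin_def trunc_module_carrier bd_lcomp[where U = U and V = V and W = W] trunc.map_sel)
  show "bd Ch (\<phi> \<triangleleft>\<^bsub>Ch\<^esub> f) = bd Ch \<phi> \<bullet>\<^bsub>Ch\<^esub> f"
    if "\<phi> \<in> carrier (hom1 Ch V W)" "f \<in> carrier (hom0 Ch U V)" for f \<phi> U V W
    using that linear_map_closed[OF bl that(1)] unfolding bd
    by (simp add: trunc_comp0[where V = V] trunc_rcomp[where V = V] trunc_cat_hom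
        map_trunc_bilin[OF bd_linear rcomp_bilinear module1])
      (simp add: trunc_bilin_def trunc_module_carrier bd_rcomp[where U = U and V = V and W = W] trunc.map_sel)
  show "bd Ch \<phi> \<triangleright>\<^bsub>Ch\<^esub> \<phi>' = \<phi> \<triangleleft>\<^bsub>Ch\<^esub> bd Ch \<phi>'"
    if "\<phi> \<in> carrier (hom1 Ch V W)" "\<phi>' \<in> carrier (hom1 Ch U V)" for \<phi> \<phi>' U V W
    using that linear_map_closed[OF bl that(1)] linear_map_closed[OF bl that(2)] unfolding bd
    by (simp add: trunc_lcomp[where V = V] trunc_rcomp[where V = V] trunc_cat_hom)
      (simp add: trunc_bilin_def trunc_module_carrier bd_swap[where U = U and V = V and W = W] trunc.map_sel)
qed

end

definition trunc_const :: "('r, 'm) module \<Rightarrow> 'm \<Rightarrow> 'm trunc" where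
  "trunc_const N x = Trunc x \<zero>\<^bsub>N\<^esub> \<zero>\<^bsub>N\<^esub>"

text \<open>A cell that is a multiple of \<open>h^2\<close>.\<close>

definition trunc_top :: "('r, 'm) module \<Rightarrow> 'm \<Rightarrow> 'm trunc" where
  "trunc_top N x = Trunc \<zero>\<^bsub>N\<^esub> \<zero>\<^bsub>N\<^esub> x"

lemma trunc_const_coef [simp]:
  "coef0 (trunc_const N x) = x" "coef1 (trunc_const N x) = \<zero>\<^bsub>N\<^esub>" "coef2 (trunc_const N x) = \<zero>\<^bsub>N\<^esub>"
  by (simp_all add: trunc_const_def)

lemma trunc_top_inject [simp]: "trunc_top N x = trunc_top N y \<longleftrightarrow> x = y"
  by (simp add: trunc_top_def)

lemma trunc_module_coef [simp]:
  "coef0 (x \<oplus>\<^bsub>trunc_module N\<^esub> y) = coef0 x \<oplus>\<^bsub>N\<^esub> coef0 y"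
  "coef1 (x \<oplus>\<^bsub>trunc_module N\<^esub> y) = coef1 x \<oplus>\<^bsub>N\<^esub> coef1 y"
  "coef0 (r \<odot>\<^bsub>trunc_module N\<^esub> x) = coef0 r \<odot>\<^bsub>N\<^esub> coef0 x"
  "coef1 (r \<odot>\<^bsub>trunc_module N\<^esub> x) = coef0 r \<odot>\<^bsub>N\<^esub> coef1 x \<oplus>\<^bsub>N\<^esub> coef1 r \<odot>\<^bsub>N\<^esub> coef0 x"
  by (simp_all add: trunc_module_simps)

context
  fixes N :: "('r::comm_ring_1, 'm) module"
  assumes N: "Module.module scalars N"
begin

interpretation N: Module.module scalars N by (rule N)

lemma trunc_const_closed: "x \<in> carrier N \<Longrightarrow> trunc_const N x \<in> carrier (trunc_module N)"
  by (simp add: trunc_module_carrier)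

lemma trunc_top_closed: "x \<in> carrier N \<Longrightarrow> trunc_top N x \<in> carrier (trunc_module N)"
  by (simp add: trunc_module_carrier trunc_top_def)

lemma trunc_top_smult:
  "x \<in> carrier (trunc_module N) \<Longrightarrow> Trunc 0 0 r \<odot>\<^bsub>trunc_module N\<^esub> x = trunc_top N (r \<odot>\<^bsub>N\<^esub> coef0 x)"
  by (simp add: trunc_module_simps trunc_module_carrier trunc_top_def smod[OF N])

lemma trunc_top_add:
  "trunc_top N x \<oplus>\<^bsub>trunc_module N\<^esub> trunc_top N y = trunc_top N (x \<oplus>\<^bsub>N\<^esub> y)"
  by (simp add: trunc_module_simps trunc_top_def)

lemma trunc_top_neg:
  assumes "x \<in> carrier N"
  shows "\<ominus>\<^bsub>trunc_module N\<^esub> trunc_top N x = trunc_top N (\<ominus>\<^bsub>N\<^esub> x)"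
proof -
  interpret T: Module.module scalars "trunc_module N" by (rule module_trunc_module[OF N])
  have "trunc_top N (\<ominus>\<^bsub>N\<^esub> x) \<oplus>\<^bsub>trunc_module N\<^esub> trunc_top N x = \<zero>\<^bsub>trunc_module N\<^esub>"
    using assms unfolding trunc_top_add by (simp add: N.l_neg trunc_top_def trunc_module_simps)
  then show ?thesis
    using assms by (intro T.minus_equality) (simp_all add: trunc_top_closed)
qed

end

context ch_category
begin

lemma trunc_id_const: "idc Ch U = trunc_const (hom0 C U U) (idc C U)"
  by (simp add: trunc_id trunc_const_def)

lemma trunc_comp_coef0 [simp]:
  "coef0 (g \<bullet>\<^bsub>Ch\<^esub> f) = coef0 g \<bullet> coef0 f"
  "coef0 (g \<triangleright>\<^bsub>Ch\<^esub> \<phi>) = coef0 g \<triangleright> coef0 \<phi>"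
  "coef0 (\<phi> \<triangleleft>\<^bsub>Ch\<^esub> f) = coef0 \<phi> \<triangleleft> coef0 f"
  by (simp_all add: trunc_cat_def trunc_bilin_def)

text \<open>Multiples of \<open>h^2\<close> are annihilated by the higher coefficients of the other factor.\<close>

lemma trunc_lcomp_top:
  assumes "g \<in> carrier (hom0 Ch V W)" "x \<in> carrier (hom1 C U V)"
  shows "g \<triangleright>\<^bsub>Ch\<^esub> trunc_top (hom1 C U V) x = trunc_top (hom1 C U W) (coef0 g \<triangleright> x)"
proof -
  interpret N: Module.module scalars "hom1 C U W" by (rule module1)
  have "trunc_top (hom1 C U V) x \<in> carrier (hom1 Ch U V)"
    using trunc_top_closed[OF module1 assms(2)] by (simp add: trunc_cat_hom)
  then show ?thesis
    using assms lcomp_closed[OF _ assms(2)]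
    by (simp add: trunc_lcomp[where V = V] trunc_bilin_def trunc_top_def trunc_cat_hom
        trunc_module_carrier lcomp_zero[where U = U and V = V and W = W])
qed

lemma trunc_rcomp_top:
  assumes "x \<in> carrier (hom1 C V W)" "f \<in> carrier (hom0 Ch U V)"
  shows "trunc_top (hom1 C V W) x \<triangleleft>\<^bsub>Ch\<^esub> f = trunc_top (hom1 C U W) (x \<triangleleft> coef0 f)"
proof -
  interpret N: Module.module scalars "hom1 C U W" by (rule module1)
  have "trunc_top (hom1 C V W) x \<in> carrier (hom1 Ch V W)"
    using trunc_top_closed[OF module1 assms(1)] by (simp add: trunc_cat_hom)
  then show ?thesis
    using assms rcomp_closed[OF assms(1)]
    by (simp add: trunc_rcomp[where V = V] trunc_bilin_def trunc_top_def trunc_cat_hom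
        trunc_module_carrier rcomp_zero[where U = U and V = V and W = W])
qed

text \<open>Modulo \<open>h^3\<close>, the square of a multiple of \<open>h^2\<close> vanishes; so the inverse of \<open>1 + c h^2\<close> is
  \<open>1 - c h^2\<close>.\<close>

lemma inverse0_trunc:
  assumes c: "c \<in> carrier (hom0 C U U)"
  defines "z \<equiv> \<zero>\<^bsub>hom0 C U U\<^esub>"
  shows "inverse0 Ch (Trunc (idc C U) z c) = Trunc (idc C U) z (\<ominus>\<^bsub>hom0 C U U\<^esub> c)"
proof -
  interpret Ch: ch_category Ch by (rule ch_category_trunc)
  interpret N: Module.module scalars "hom0 C U U" by (rule module0)
  let ?a = "\<lambda>c. Trunc (idc C U) z c"
  have a: "?a d \<in> carrier (hom0 Ch U U)" if "d \<in> carrier (hom0 C U U)" for d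
    using that by (simp add: trunc_cat_hom trunc_module_carrier id_cell z_def)
  have comp: "?a d \<bullet>\<^bsub>Ch\<^esub> ?a e = ?a (d \<oplus>\<^bsub>hom0 C U U\<^esub> e)"
    if "d \<in> carrier (hom0 C U U)" "e \<in> carrier (hom0 C U U)" for d e
    using that comp0_id[of _ U U] comp0_zero_left[of _ U U U] comp0_zero_right[of _ U U U] N.a_comm
    unfolding trunc_comp0[OF a[OF that(1)] a[OF that(2)]]
    by (simp add: trunc_bilin_def z_def id_cell)
  have i: "idc Ch U = ?a z" by (simp add: trunc_id z_def)
  have ends: "src0 Ch (?a c) = U" "tgt0 Ch (?a c) = U" using Ch.ends0[OF a[OF c]] by simp_all
  have n: "\<ominus>\<^bsub>hom0 C U U\<^esub> c \<in> carrier (hom0 C U U)" using c by simp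
  have 1: "?a (\<ominus>\<^bsub>hom0 C U U\<^esub> c) \<bullet>\<^bsub>Ch\<^esub> ?a c = idc Ch U"
    and 2: "?a c \<bullet>\<^bsub>Ch\<^esub> ?a (\<ominus>\<^bsub>hom0 C U U\<^esub> c) = idc Ch U"
    using c n by (simp_all add: comp i N.l_neg N.r_neg) (simp_all add: z_def)
  show ?thesis
    unfolding inverse0_def ends
  proof (rule the_equality)
    fix g assume g: "g \<in> carrier (hom0 Ch U U) \<and> g \<bullet>\<^bsub>Ch\<^esub> ?a c = idc Ch U \<and> ?a c \<bullet>\<^bsub>Ch\<^esub> g = idc Ch U"
    then have "g = g \<bullet>\<^bsub>Ch\<^esub> (?a c \<bullet>\<^bsub>Ch\<^esub> ?a (\<ominus>\<^bsub>hom0 C U U\<^esub> c))"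
      using 2 Ch.comp0_id[of g U U] by simp
    also have "\<dots> = ?a (\<ominus>\<^bsub>hom0 C U U\<^esub> c)"
      using g Ch.assoc000[of g U U "?a c" U, OF _ a[OF c] a[OF n]] Ch.comp0_id[OF a[OF n]] by simp
    finally show "g = ?a (\<ominus>\<^bsub>hom0 C U U\<^esub> c)" .
  qed (use 1 2 a[OF n] in simp)
qed

lemma htpy2_trunc_pnat:
  assumes \<xi>: "bilinear_map (hom0 C U U') (hom0 C V V') (hom1 C (fob F (U, V)) (fob G (U', V'))) (htpy2 C \<xi>)"
    and f: "f \<in> carrier (hom0 Ch U U')" and g: "g \<in> carrier (hom0 Ch V V')"
  shows "htpy2 Ch (trunc_pnat C F G \<xi>) f g
    = trunc_bilin (hom1 C (fob F (U, V)) (fob G (U', V'))) (htpy2 C \<xi>) f g"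
proof -
  let ?N = "hom1 C (fob F (U, V)) (fob G (U', V'))"
  have m: "Module.module scalars (hom0 Ch U V)" for U V
    by (simp add: trunc_cat_hom module_trunc_module module0)
  show ?thesis
    unfolding htpy2_def[of Ch] pure00_eq[OF ch_category_trunc ch_category_trunc f g]
    using lin_ext_pure[OF m m module_trunc_module[OF module1], where A = "(U, V)" and B = "(U', V')"
        and \<beta> = "trunc_bilin ?N (htpy2 C \<xi>)" and f = f and g = g] f g trunc_bilin_bilinear[OF module0 module0 module1 \<xi>]
    by (simp add: trunc_pnat_def Let_def trunc_cat_hom)
qed

end

section \<open>The monoidal structure after extension of scalars\<close>

context symmetric_strict_monoidal
begin

abbreviation Mh where "Mh \<equiv> trunc_smon C M"

lemma tob_trunc [simp]: "tob Mh U V = U \<diamondop> V"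
  by (simp add: tob_def trunc_smon_def trunc_tensor_fun_def)

lemma ten00_trunc:
  assumes f: "f \<in> carrier (hom0 Ch U U')" and g: "g \<in> carrier (hom0 Ch V V')"
  shows "ten00 Ch Mh f g = trunc_bilin (hom0 C (U \<diamondop> V) (U' \<diamondop> V')) (ten00 C M) f g"
proof -
  let ?N = "hom0 C (U \<diamondop> V) (U' \<diamondop> V')"
  have m: "Module.module scalars (hom0 Ch U V)" for U V
    by (simp add: trunc_cat_hom module_trunc_module module0)
  show ?thesis
    unfolding ten00_def[of Ch] pure00_eq[OF ch_category_trunc ch_category_trunc f g]
    using lin_ext_pure[OF m m module_trunc_module[OF module0], where A = "(U, V)" and B = "(U', V')"
        and \<beta> = "trunc_bilin ?N (ten00 C M)" and f = f and g = g] f g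
        trunc_bilin_bilinear[OF module0 module0 module0 ten00_bilinear[of U U' V V']]
    by (simp add: trunc_smon_def trunc_tensor_fun_def Let_def trunc_cat_hom tob_def ten00_def[abs_def])
qed

lemma ten00_trunc_closed:
  assumes f: "f \<in> carrier (hom0 Ch U U')" and g: "g \<in> carrier (hom0 Ch V V')"
  shows "ten00 Ch Mh f g \<in> carrier (hom0 Ch (U \<diamondop> V) (U' \<diamondop> V'))"
    and "coef0 (ten00 Ch Mh f g) = coef0 f \<star> coef0 g"
  using bilinear_closed[OF trunc_bilin_bilinear[OF module0 module0 module0 ten00_bilinear[of U U' V V']], of f g]
    f g
  by (simp_all add: trunc_cat_hom ten00_trunc[OF f g])
    (simp add: trunc_bilin_def)

lemma trunc_\<gamma>: "pob2 (braid Mh) U V = trunc_const (hom0 C (U \<diamondop> V) (V \<diamondop> U)) (\<gamma> U V)"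
  by (simp add: trunc_smon_def trunc_pnat_def pob2_def Let_def tob_def fun_comp_def swap_fun_def
      trunc_const_def)

lemma trunc_\<gamma>_closed: "pob2 (braid Mh) U V \<in> carrier (hom0 Ch (U \<diamondop> V) (V \<diamondop> U))"
  unfolding trunc_\<gamma> trunc_cat_hom by (rule trunc_const_closed[OF module0 \<gamma>_cell])

lemma htpy2_trunc_braid:
  assumes f: "f \<in> carrier (hom0 Ch U U')" and g: "g \<in> carrier (hom0 Ch V V')"
  shows "htpy2 Ch (braid Mh) f g = \<zero>\<^bsub>hom1 Ch (U \<diamondop> V) (V' \<diamondop> U')\<^esub>"
proof -
  let ?N = "hom1 C (U \<diamondop> V) (V' \<diamondop> U')"
  interpret N: Module.module scalars ?N by (rule module1)
  interpret M: Module.module scalars "hom0 C U U'" by (rule module0)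
  interpret K: Module.module scalars "hom0 C V V'" by (rule module0)
  have "bilinear_map (hom0 C U U') (hom0 C V V') ?N (htpy2 C (braid M))"
    by (simp add: bilinear_map_def linear_map_def htpy2_braid smod[OF module0] smod[OF module1])
  then have "htpy2 Ch (braid Mh) f g = trunc_bilin ?N (htpy2 C (braid M)) f g"
    using htpy2_trunc_pnat[of U U' V V' "tensor M" "fun_comp (tensor M) (swap_fun C C)" "braid M" f g]
      f g
    by (simp add: trunc_smon_def tob_def fun_comp_def swap_fun_def)
  also have "\<dots> = \<zero>\<^bsub>hom1 Ch (U \<diamondop> V) (V' \<diamondop> U')\<^esub>"
    using f g
    by (simp add: trunc_bilin_def trunc_cat_hom trunc_module_carrier trunc_module_simps
        htpy2_braid[where U = U and U' = U' and V = V and V' = V'])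
  finally show ?thesis .
qed

end

context infinitesimal_2_braiding
begin

abbreviation th where "th \<equiv> trunc_braiding C M t"

lemma trunc_t: "pob2 th U V = trunc_const (hom0 C (U \<diamondop> V) (U \<diamondop> V)) (t_cell U V)"
  by (simp add: trunc_braiding_def trunc_pnat_def pob2_def Let_def tob_def trunc_const_def)

lemma trunc_t_closed: "pob2 th U V \<in> carrier (hom0 Ch (U \<diamondop> V) (U \<diamondop> V))"
  unfolding trunc_t trunc_cat_hom by (rule trunc_const_closed[OF module0 t_cell])

lemma htpy2_trunc_t:
  assumes "f \<in> carrier (hom0 Ch U U')" and "g \<in> carrier (hom0 Ch V V')"
  shows "htpy2 Ch th f g = trunc_bilin (hom1 C (U \<diamondop> V) (U' \<diamondop> V')) t_htpy f g"
  using htpy2_trunc_pnat[of U U' V V' "tensor M" "tensor M" t, OF _ assms] t_htpy_bilinear[of U U' V V']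
  by (simp add: trunc_braiding_def tob_def)

lemma htpy2_trunc_t_closed:
  assumes f: "f \<in> carrier (hom0 Ch U U')" and g: "g \<in> carrier (hom0 Ch V V')"
  shows "htpy2 Ch th f g \<in> carrier (hom1 Ch (U \<diamondop> V) (U' \<diamondop> V'))"
    and "coef0 (htpy2 Ch th f g) = t_htpy (coef0 f) (coef0 g)"
  using bilinear_closed[OF trunc_bilin_bilinear[OF module0 module0 module1 t_htpy_bilinear[of U U' V V']], of f g]
    f g
  by (simp_all add: trunc_cat_hom htpy2_trunc_t[OF f g])
    (simp add: trunc_bilin_def)

lemma trunc_relator_closed:
  shows "relator_L Ch th U V W \<in> carrier (hom1 Ch (U \<diamondop> V \<diamondop> W) (U \<diamondop> V \<diamondop> W))"
    and "relator_R Ch th U V W \<in> carrier (hom1 Ch (U \<diamondop> V \<diamondop> W) (U \<diamondop> V \<diamondop> W))"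
    and "coef0 (relator_L Ch th U V W) = relator_L C t U V W"
    and "coef0 (relator_R Ch th U V W) = relator_R C t U V W"
proof -
  interpret Ch: ch_category Ch by (rule ch_category_trunc)
  show "relator_L Ch th U V W \<in> carrier (hom1 Ch (U \<diamondop> V \<diamondop> W) (U \<diamondop> V \<diamondop> W))"
    "relator_R Ch th U V W \<in> carrier (hom1 Ch (U \<diamondop> V \<diamondop> W) (U \<diamondop> V \<diamondop> W))"
    "coef0 (relator_L Ch th U V W) = relator_L C t U V W"
    "coef0 (relator_R Ch th U V W) = relator_R C t U V W"
    using htpy2_trunc_t_closed[OF trunc_t_closed Ch.id_cell, of U V W]
      htpy2_trunc_t_closed[OF Ch.id_cell trunc_t_closed, of U V W]
    by (simp_all add: relator_L_def relator_R_def assoc_ob) (simp_all add: trunc_t trunc_id_const)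
qed

end

section \<open>The deformed braiding and associator\<close>

locale deformed_braiding = totally_symmetric_2_braiding C M t
  for C :: "('k::field_char_0, 'o, 'a, 'b) ch_cat" and M :: "('k, 'o, 'a, 'b) smon"
    and t :: "('o \<times> 'o, ('k, 'o, 'o, 'a, 'a) box0, 'a, 'b) pnat"
begin

sublocale Ch: ch_category Ch by (rule ch_category_trunc)

abbreviation \<sigma> where "\<sigma> \<equiv> defo_braid Ch Mh th"
abbreviation \<alpha> where "\<alpha> \<equiv> defo_assoc Ch Mh th"

lemma fob_trunc_tensor: "fob (tensor Mh) (U, V) = U \<diamondop> V"
  using tob_trunc[of U V] by (simp add: tob_def)

text \<open>The homotopies of \<open>\<sigma>\<close> start with a factor \<open>h\<close> of their own, and elsewhere \<open>\<sigma>\<close> meets multiples of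
  \<open>h^2\<close>; so the axiom sees \<open>\<sigma>\<close> modulo \<open>h^2\<close>.\<close>

lemma \<sigma>_cell:
  shows "pob2 \<sigma> U V \<in> carrier (hom0 Ch (U \<diamondop> V) (V \<diamondop> U))"
    and "coef0 (pob2 \<sigma> U V) = \<gamma> U V"
    and "coef1 (pob2 \<sigma> U V) = (1/2) \<odot>\<^bsub>hom0 C (U \<diamondop> V) (V \<diamondop> U)\<^esub> (\<gamma> U V \<bullet>\<^bsub>C\<^esub> t_cell U V)"
proof -
  let ?H = "hom0 Ch (U \<diamondop> V) (U \<diamondop> V)" and ?N = "hom0 C (U \<diamondop> V) (U \<diamondop> V)"
  let ?K = "hom0 C (U \<diamondop> V) (V \<diamondop> U)"
  interpret H: Module.module scalars ?H by (rule Ch.module0)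
  interpret N: Module.module scalars ?N by (rule module0)
  interpret K: Module.module scalars ?K by (rule module0)
  let ?g = "pob2 (braid Mh) U V" and ?T = "pob2 th U V"
  let ?x = "Trunc 0 (1/2) 0 \<odot>\<^bsub>?H\<^esub> ?T" and ?y = "Trunc 0 0 (1/8) \<odot>\<^bsub>?H\<^esub> (?T \<bullet>\<^bsub>Ch\<^esub> ?T)"
  let ?E = "idc Ch (U \<diamondop> V) \<oplus>\<^bsub>?H\<^esub> ?x \<oplus>\<^bsub>?H\<^esub> ?y"
  have TT: "?T \<bullet>\<^bsub>Ch\<^esub> ?T \<in> carrier ?H" by (rule Ch.closed trunc_t_closed)+
  have x: "?x \<in> carrier ?H" by (rule smod_closed[OF Ch.module0 trunc_t_closed])
  have y: "?y \<in> carrier ?H" by (rule smod_closed[OF Ch.module0 TT])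
  have ix: "idc Ch (U \<diamondop> V) \<oplus>\<^bsub>?H\<^esub> ?x \<in> carrier ?H" using x Ch.id_cell by simp
  have E: "?E \<in> carrier ?H" using ix y by simp
  have e: "pob2 \<sigma> U V = ?g \<bullet>\<^bsub>Ch\<^esub> ?E"
    by (simp add: defo_braid_def pn_comp_def pn_add_def pn_scale_def pn_id_def pob2_def Let_def
        fob_trunc_tensor)
      (simp add: pob2_def[symmetric] Ch.scale0_eq[OF trunc_t_closed] Ch.scale0_eq[OF TT]
        Ch.add0_eq[OF Ch.id_cell] Ch.add0_eq[OF ix])
  show "pob2 \<sigma> U V \<in> carrier (hom0 Ch (U \<diamondop> V) (V \<diamondop> U))"
    unfolding e by (rule Ch.comp0_closed[OF trunc_\<gamma>_closed E])
  have tN: "coef0 (?T \<bullet>\<^bsub>Ch\<^esub> ?T) \<in> carrier ?N" "coef1 (?T \<bullet>\<^bsub>Ch\<^esub> ?T) \<in> carrier ?N"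
    using TT by (simp_all add: trunc_cat_hom trunc_module_carrier)
  have E0: "coef0 ?E = one (U \<diamondop> V)"
    using t_cell[of U V] tN id_cell[of "U \<diamondop> V"]
    by (simp add: trunc_cat_hom trunc_id_const trunc_t smod[OF module0] del: trunc_comp_coef0)
  have E1: "coef1 ?E = (1/2) \<odot>\<^bsub>?N\<^esub> t_cell U V"
    using t_cell[of U V] tN id_cell[of "U \<diamondop> V"]
    by (simp add: trunc_cat_hom trunc_id_const trunc_t smod[OF module0] del: trunc_comp_coef0)
  show "coef0 (pob2 \<sigma> U V) = \<gamma> U V"
    unfolding e trunc_comp_coef0 E0 by (simp add: trunc_\<gamma> comp0_id[OF \<gamma>_cell])
  have "coef1 (pob2 \<sigma> U V)
      = \<gamma> U V \<bullet>\<^bsub>C\<^esub> ((1/2) \<odot>\<^bsub>?N\<^esub> t_cell U V) \<oplus>\<^bsub>?K\<^esub> \<zero>\<^bsub>?K\<^esub> \<bullet>\<^bsub>C\<^esub> one (U \<diamondop> V)"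
    unfolding e by (subst trunc_comp0[OF trunc_\<gamma>_closed E])
      (simp only: trunc_bilin_def trunc.sel E0 E1, simp add: trunc_\<gamma>)
  then show "coef1 (pob2 \<sigma> U V) = (1/2) \<odot>\<^bsub>?K\<^esub> (\<gamma> U V \<bullet>\<^bsub>C\<^esub> t_cell U V)"
    using bilinear_smult_right[OF comp0_bilinear \<gamma>_cell t_cell, of U V "1/2"]
      comp0_closed[OF \<gamma>_cell t_cell, of U V]
    by (simp add: comp0_zero_left[OF id_cell] smod_closed[OF module0])
qed

text \<open>By assumption the homotopy of \<open>t\<close> is a multiple of \<open>h\<close>. So the linear term \<open>h/2 t\<close> of the
  exponential contributes a multiple of \<open>h^2\<close>, while the homotopy of \<open>h^2/8 t^2\<close> is a multiple of
  \<open>h^3\<close> and that of the natural transformation \<open>\<gamma>\<close> is zero.\<close>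

lemma \<sigma>_htpy:
  assumes f: "f \<in> carrier (hom0 Ch U U')" and g: "g \<in> carrier (hom0 Ch V V')"
    and 0: "t_htpy (coef0 f) (coef0 g) = \<zero>\<^bsub>hom1 C (U \<diamondop> V) (U' \<diamondop> V')\<^esub>"
  shows "htpy2 Ch \<sigma> f g = trunc_top (hom1 C (U \<diamondop> V) (V' \<diamondop> U'))
    ((1/2) \<odot>\<^bsub>hom1 C (U \<diamondop> V) (V' \<diamondop> U')\<^esub> (\<gamma> U' V' \<triangleright>\<^bsub>C\<^esub> coef1 (htpy2 Ch th f g)))"
proof -
  let ?H = "hom1 Ch (U \<diamondop> V) (U' \<diamondop> V')" and ?N = "hom1 C (U \<diamondop> V) (U' \<diamondop> V')"
  let ?K = "hom1 C (U \<diamondop> V) (V' \<diamondop> U')"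
  interpret H: Module.module scalars ?H by (rule Ch.module1)
  interpret N: Module.module scalars ?N by (rule module1)
  interpret K: Module.module scalars ?K by (rule module1)
  interpret Kh: Module.module scalars "hom1 Ch (U \<diamondop> V) (V' \<diamondop> U')" by (rule Ch.module1)
  let ?X = "htpy2 Ch th f g" and ?T = "pob2 th U V" and ?T' = "pob2 th U' V'"
  let ?Y = "?X \<triangleleft>\<^bsub>Ch\<^esub> ?T \<oplus>\<^bsub>?H\<^esub> ?T' \<triangleright>\<^bsub>Ch\<^esub> ?X"
  note X = htpy2_trunc_t_closed(1)[OF f g]
  have X0: "coef0 ?X = \<zero>\<^bsub>?N\<^esub>" using htpy2_trunc_t_closed(2)[OF f g] 0 by simp
  have XC: "coef1 ?X \<in> carrier ?N" "coef2 ?X \<in> carrier ?N"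
    using X by (simp_all add: trunc_cat_hom trunc_module_carrier)
  have XT: "?X \<triangleleft>\<^bsub>Ch\<^esub> ?T \<in> carrier ?H" by (rule Ch.closed X trunc_t_closed)+
  have TX: "?T' \<triangleright>\<^bsub>Ch\<^esub> ?X \<in> carrier ?H" by (rule Ch.closed X trunc_t_closed)+
  have Y: "?Y \<in> carrier ?H" using XT TX by simp
  have Y0: "coef0 ?Y = \<zero>\<^bsub>?N\<^esub>"
    by (simp add: trunc_cat_hom X0 trunc_t rcomp_zero[OF t_cell] lcomp_zero[OF t_cell])
  have s: "Trunc 0 (1/2) 0 \<odot>\<^bsub>?H\<^esub> ?X = trunc_top ?N ((1/2) \<odot>\<^bsub>?N\<^esub> coef1 ?X)"
    using XC by (simp add: trunc_cat_hom trunc_module_simps trunc_top_def X0 smod[OF module1])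
  have s': "Trunc 0 0 (1/8) \<odot>\<^bsub>?H\<^esub> ?Y = \<zero>\<^bsub>?H\<^esub>"
    using Y Y0 by (simp add: trunc_cat_hom trunc_top_smult[OF module1] smod[OF module1])
      (simp add: trunc_top_def trunc_module_simps)
  define E where "E = trunc_top ?N ((1/2) \<odot>\<^bsub>?N\<^esub> coef1 ?X)"
  have E: "E \<in> carrier ?H"
    unfolding E_def trunc_cat_hom by (rule trunc_top_closed[OF module1 smod_closed[OF module1 XC(1)]])
  have p: "fst (pure00 Ch Ch f g) = (U, V)" "fst (snd (pure00 Ch Ch f g)) = (U', V')"
    by (simp_all add: pure00_eq[OF ch_category_trunc ch_category_trunc f g])
  have b: "src0 (box Ch Ch) = fst" "tgt0 (box Ch Ch) = fst \<circ> snd" by (simp_all add: box_def)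
  let ?e = "pn_add Ch (pn_add Ch (pn_id (box Ch Ch) Ch (tensor Mh)) (pn_scale Ch (Trunc 0 (1/2) 0) th))
         (pn_scale Ch (Trunc 0 0 (1/8)) (pn_comp (box Ch Ch) Ch th th))"
  have "htpy2 Ch ?e f g
      = (\<zero>\<^bsub>?H\<^esub> +\<^sub>1\<^bsub>Ch\<^esub> scale1 Ch (Trunc 0 (1/2) 0) ?X)
        +\<^sub>1\<^bsub>Ch\<^esub> scale1 Ch (Trunc 0 0 (1/8)) (?X \<triangleleft>\<^bsub>Ch\<^esub> ?T +\<^sub>1\<^bsub>Ch\<^esub> ?T' \<triangleright>\<^bsub>Ch\<^esub> ?X)"
    by (simp add: pn_comp_def pn_add_def pn_scale_def pn_id_def htpy2_def pob2_def b p
        fob_trunc_tensor)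
  also have "\<dots> = E"
    using E Ch.add1_eq[OF H.zero_closed] Ch.add1_eq[OF E] Ch.add1_eq[OF XT] Ch.scale1_eq[OF X]
      Ch.scale1_eq[OF Y] s s'
    by (simp add: E_def[symmetric])
  finally have e: "htpy2 Ch ?e f g = E" .
  have gE: "pob2 (braid Mh) U' V' \<triangleright>\<^bsub>Ch\<^esub> E
      = trunc_top ?K (\<gamma> U' V' \<triangleright>\<^bsub>C\<^esub> ((1/2) \<odot>\<^bsub>?N\<^esub> coef1 ?X))"
    unfolding E_def
    using trunc_lcomp_top[OF trunc_\<gamma>_closed smod_closed[OF module1 XC(1)]] by (simp add: trunc_\<gamma>)
  have z: "\<zero>\<^bsub>hom1 Ch (U \<diamondop> V) (V' \<diamondop> U')\<^esub> +\<^sub>1\<^bsub>Ch\<^esub> pob2 (braid Mh) U' V' \<triangleright>\<^bsub>Ch\<^esub> E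
      = pob2 (braid Mh) U' V' \<triangleright>\<^bsub>Ch\<^esub> E"
    using Ch.add1_eq[OF Kh.zero_closed] Ch.lcomp_closed[OF trunc_\<gamma>_closed E] by simp
  have pe: "pob2 ?e U V \<in> carrier (hom0 Ch (U \<diamondop> V) (U \<diamondop> V))"
  proof -
    interpret H0: Module.module scalars "hom0 Ch (U \<diamondop> V) (U \<diamondop> V)" by (rule Ch.module0)
    have TT: "?T \<bullet>\<^bsub>Ch\<^esub> ?T \<in> carrier (hom0 Ch (U \<diamondop> V) (U \<diamondop> V))" by (rule Ch.closed trunc_t_closed)+
    have sT: "scale0 Ch r ?T \<in> carrier (hom0 Ch (U \<diamondop> V) (U \<diamondop> V))"
        "scale0 Ch r (?T \<bullet>\<^bsub>Ch\<^esub> ?T) \<in> carrier (hom0 Ch (U \<diamondop> V) (U \<diamondop> V))" for r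
      using Ch.scale0_eq[OF trunc_t_closed] Ch.scale0_eq[OF TT]
        smod_closed[OF Ch.module0 trunc_t_closed] smod_closed[OF Ch.module0 TT] by simp_all
    have ad: "x \<in> carrier (hom0 Ch (U \<diamondop> V) (U \<diamondop> V)) \<Longrightarrow> y \<in> carrier (hom0 Ch (U \<diamondop> V) (U \<diamondop> V)) \<Longrightarrow>
       x +\<^sub>0\<^bsub>Ch\<^esub> y \<in> carrier (hom0 Ch (U \<diamondop> V) (U \<diamondop> V))" for x y
      using Ch.add0_eq[of x] by simp
    have "pob2 ?e U V = (idc Ch (U \<diamondop> V) +\<^sub>0\<^bsub>Ch\<^esub> scale0 Ch (Trunc 0 (1/2) 0) ?T)
        +\<^sub>0\<^bsub>Ch\<^esub> scale0 Ch (Trunc 0 0 (1/8)) (?T \<bullet>\<^bsub>Ch\<^esub> ?T)"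
      by (simp add: pn_comp_def pn_add_def pn_scale_def pn_id_def pob2_def fob_trunc_tensor)
    then show ?thesis using ad sT Ch.id_cell by simp
  qed
  have "htpy2 Ch \<sigma> f g = htpy2 Ch (braid Mh) f g \<triangleleft>\<^bsub>Ch\<^esub> pob2 ?e U V
      +\<^sub>1\<^bsub>Ch\<^esub> pob2 (braid Mh) U' V' \<triangleright>\<^bsub>Ch\<^esub> htpy2 Ch ?e f g"
    unfolding defo_braid_def Let_def pn_comp_def[of _ _ "braid Mh"]
    by (simp add: htpy2_def pob2_def b p)
  also have "\<dots> = trunc_top ?K (\<gamma> U' V' \<triangleright>\<^bsub>C\<^esub> ((1/2) \<odot>\<^bsub>?N\<^esub> coef1 ?X))"
    unfolding e htpy2_trunc_braid[OF f g] Ch.rcomp_zero[OF pe] z by (rule gE)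
  also have "\<gamma> U' V' \<triangleright>\<^bsub>C\<^esub> ((1/2) \<odot>\<^bsub>?N\<^esub> coef1 ?X) = (1/2) \<odot>\<^bsub>?K\<^esub> (\<gamma> U' V' \<triangleright>\<^bsub>C\<^esub> coef1 ?X)"
    by (rule bilinear_smult_right[OF lcomp_bilinear \<gamma>_cell XC(1)])
  finally show ?thesis .
qed

lemma \<sigma>_one_\<sigma>:
  "htpy2 Ch \<sigma> (idc Ch U) (pob2 \<sigma> V W) = trunc_top (hom1 C (U \<diamondop> V \<diamondop> W) (W \<diamondop> V \<diamondop> U))
    (reversal U V W \<triangleright>\<^bsub>C\<^esub> ((1/2) \<odot>\<^bsub>hom1 C (U \<diamondop> V \<diamondop> W) (U \<diamondop> V \<diamondop> W)\<^esub>
      ((1/2) \<odot>\<^bsub>hom1 C (U \<diamondop> V \<diamondop> W) (U \<diamondop> V \<diamondop> W)\<^esub> R U V W)))"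
proof -
  let ?N = "hom1 C (U \<diamondop> V \<diamondop> W) (U \<diamondop> W \<diamondop> V)" and ?E = "hom1 C (U \<diamondop> V \<diamondop> W) (U \<diamondop> V \<diamondop> W)"
  let ?X = "hom1 C (U \<diamondop> V \<diamondop> W) (W \<diamondop> V \<diamondop> U)"
  interpret N: Module.module scalars ?N by (rule module1)
  note gt = comp0_closed[OF \<gamma>_cell t_cell, of V W]
  have z: "t_htpy \<zero>\<^bsub>hom0 C U U\<^esub> (\<gamma> V W) = \<zero>\<^bsub>?N\<^esub>"
    by (rule linear_map_zero[OF module0 module1 bilinear_left[OF t_htpy_bilinear \<gamma>_cell]])
  have 1: "coef1 (htpy2 Ch th (idc Ch U) (pob2 \<sigma> V W)) = (1/2) \<odot>\<^bsub>?N\<^esub> (one U \<star> \<gamma> V W \<triangleright>\<^bsub>C\<^esub> R U V W)"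
    using htpy2_trunc_t[OF Ch.id_cell \<sigma>_cell(1), of U V W] smod_closed[OF module1, of _ "U \<diamondop> V \<diamondop> W" "U \<diamondop> W \<diamondop> V"]
      t_htpy_closed[OF id_cell gt, of U]
      bilinear_smult_right[OF t_htpy_bilinear id_cell gt, of U "1/2"]
    by (simp add: trunc_bilin_def \<sigma>_cell trunc_id_const z)
      (simp add: t_htpy_one_\<gamma>t)
  have "htpy2 Ch \<sigma> (idc Ch U) (pob2 \<sigma> V W) = trunc_top ?X
     ((1/2) \<odot>\<^bsub>?X\<^esub> (\<gamma> U (W \<diamondop> V) \<triangleright>\<^bsub>C\<^esub> ((1/2) \<odot>\<^bsub>?N\<^esub> (one U \<star> \<gamma> V W \<triangleright>\<^bsub>C\<^esub> R U V W))))"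
    using \<sigma>_htpy[OF Ch.id_cell \<sigma>_cell(1), of U V W]
    by (simp add: trunc_id_const[of U] \<sigma>_cell t_htpy_one_\<gamma> 1[unfolded trunc_id_const] assoc_ob)
  also have "(1/2) \<odot>\<^bsub>?X\<^esub> (\<gamma> U (W \<diamondop> V) \<triangleright>\<^bsub>C\<^esub> ((1/2) \<odot>\<^bsub>?N\<^esub> (one U \<star> \<gamma> V W \<triangleright>\<^bsub>C\<^esub> R U V W)))
     = reversal U V W \<triangleright>\<^bsub>C\<^esub> ((1/2) \<odot>\<^bsub>?E\<^esub> ((1/2) \<odot>\<^bsub>?E\<^esub> R U V W))"
    unfolding lcomp_smult_lcomp[OF \<gamma>_right one_\<gamma> R_closed] reversal_def[symmetric]
    by (rule bilinear_smult_right[OF lcomp_bilinear reversal_cell smod_closed[OF module1 R_closed], symmetric])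
  finally show ?thesis .
qed

lemma \<sigma>_\<sigma>_one:
  "htpy2 Ch \<sigma> (pob2 \<sigma> U V) (idc Ch W) = trunc_top (hom1 C (U \<diamondop> V \<diamondop> W) (W \<diamondop> V \<diamondop> U))
    (reversal U V W \<triangleright>\<^bsub>C\<^esub> ((1/2) \<odot>\<^bsub>hom1 C (U \<diamondop> V \<diamondop> W) (U \<diamondop> V \<diamondop> W)\<^esub>
      ((1/2) \<odot>\<^bsub>hom1 C (U \<diamondop> V \<diamondop> W) (U \<diamondop> V \<diamondop> W)\<^esub> L U V W)))"
proof -
  let ?N = "hom1 C (U \<diamondop> V \<diamondop> W) (V \<diamondop> U \<diamondop> W)" and ?E = "hom1 C (U \<diamondop> V \<diamondop> W) (U \<diamondop> V \<diamondop> W)"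
  let ?X = "hom1 C (U \<diamondop> V \<diamondop> W) (W \<diamondop> V \<diamondop> U)"
  interpret N: Module.module scalars ?N by (rule module1)
  note gt = comp0_closed[OF \<gamma>_cell t_cell, of U V]
  have z: "t_htpy (\<gamma> U V) \<zero>\<^bsub>hom0 C W W\<^esub> = \<zero>\<^bsub>?N\<^esub>"
    using linear_map_zero[OF module0 module1 bilinear_right[OF t_htpy_bilinear \<gamma>_cell[of U V]], of W W]
    by (simp add: assoc_ob)
  have 1: "coef1 (htpy2 Ch th (pob2 \<sigma> U V) (idc Ch W)) = (1/2) \<odot>\<^bsub>?N\<^esub> (\<gamma> U V \<star> one W \<triangleright>\<^bsub>C\<^esub> L U V W)"
    using htpy2_trunc_t[OF \<sigma>_cell(1) Ch.id_cell, of U V W] smod_closed[OF module1, of _ "U \<diamondop> V \<diamondop> W" "V \<diamondop> U \<diamondop> W"]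
      t_htpy_closed[OF gt id_cell, of W]
      bilinear_smult_left[OF t_htpy_bilinear gt id_cell, of "1/2" W]
    by (simp add: trunc_bilin_def \<sigma>_cell trunc_id_const z assoc_ob)
      (simp add: t_htpy_\<gamma>t_one)
  have "htpy2 Ch \<sigma> (pob2 \<sigma> U V) (idc Ch W) = trunc_top ?X
     ((1/2) \<odot>\<^bsub>?X\<^esub> (\<gamma> (V \<diamondop> U) W \<triangleright>\<^bsub>C\<^esub> ((1/2) \<odot>\<^bsub>?N\<^esub> (\<gamma> U V \<star> one W \<triangleright>\<^bsub>C\<^esub> L U V W))))"
    using \<sigma>_htpy[OF \<sigma>_cell(1) Ch.id_cell, of U V W]
    by (simp add: trunc_id_const[of W] \<sigma>_cell t_htpy_\<gamma>_one 1[unfolded trunc_id_const] assoc_ob)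
  also have "(1/2) \<odot>\<^bsub>?X\<^esub> (\<gamma> (V \<diamondop> U) W \<triangleright>\<^bsub>C\<^esub> ((1/2) \<odot>\<^bsub>?N\<^esub> (\<gamma> U V \<star> one W \<triangleright>\<^bsub>C\<^esub> L U V W)))
     = reversal U V W \<triangleright>\<^bsub>C\<^esub> ((1/2) \<odot>\<^bsub>?E\<^esub> ((1/2) \<odot>\<^bsub>?E\<^esub> L U V W))"
    unfolding lcomp_smult_lcomp[OF \<gamma>_left \<gamma>_one L_closed] reversal_eq(3)
    by (rule bilinear_smult_right[OF lcomp_bilinear reversal_cell smod_closed[OF module1 L_closed], symmetric])
  finally show ?thesis .
qed

text \<open>Only the constant coefficient is recorded because associators meet multiples of \<open>h^2\<close>.\<close>

lemma \<alpha>_cell: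
  shows "pob3 \<alpha> U V W \<in> carrier (hom0 Ch (U \<diamondop> V \<diamondop> W) (U \<diamondop> V \<diamondop> W))"
    and "coef0 (pob3 \<alpha> U V W) = one (U \<diamondop> V \<diamondop> W)"
    and "pob3 (pn_inverse D Ch \<alpha>) U V W \<in> carrier (hom0 Ch (U \<diamondop> V \<diamondop> W) (U \<diamondop> V \<diamondop> W))"
    and "coef0 (pob3 (pn_inverse D Ch \<alpha>) U V W) = one (U \<diamondop> V \<diamondop> W)"
proof -
  let ?O = "U \<diamondop> V \<diamondop> W"
  let ?H = "hom0 Ch ?O ?O" and ?N = "hom0 C ?O ?O"
  interpret H: Module.module scalars ?H by (rule Ch.module0)
  interpret N: Module.module scalars ?N by (rule module0)
  let ?x = "ten00 Ch Mh (pob2 th U V) (idc Ch W)" and ?y = "ten00 Ch Mh (idc Ch U) (pob2 th V W)"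
  have x: "?x \<in> carrier ?H" and y: "?y \<in> carrier ?H"
    using ten00_trunc_closed(1)[OF trunc_t_closed Ch.id_cell, of U V W]
      ten00_trunc_closed(1)[OF Ch.id_cell trunc_t_closed, of U V W]
    by (simp_all add: assoc_ob)
  let ?c = "?x \<bullet>\<^bsub>Ch\<^esub> ?y \<ominus>\<^bsub>?H\<^esub> ?y \<bullet>\<^bsub>Ch\<^esub> ?x"
  note xy = Ch.comp0_closed[OF x y] and yx = Ch.comp0_closed[OF y x]
  have c: "?c \<in> carrier ?H" using xy yx by simp
  have c0: "coef0 ?c \<in> carrier ?N" using c by (simp add: trunc_cat_hom trunc_module_carrier)
  define d where "d = (1/24) \<odot>\<^bsub>?N\<^esub> coef0 ?c"
  have d: "d \<in> carrier ?N" unfolding d_def by (rule smod_closed[OF module0 c0])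
  have "fob (tensor2 Ch Mh) ((U, V), W) = ?O"
    by (simp add: tensor2_def fun_comp_def box_fun_def Let_def id_fun_def fob_trunc_tensor assoc_ob)
  then have "pob3 \<alpha> U V W = idc Ch ?O \<oplus>\<^bsub>?H\<^esub> Trunc 0 0 (1/24) \<odot>\<^bsub>?H\<^esub> ?c"
    by (simp add: defo_assoc_def pob3_def Let_def pn_add_def pn_scale_def pn_id_def
        pn_commutator_def pn_diff_def pn_comp_def t12_def t23_def
        Ch.add0_eq[OF Ch.id_cell] Ch.diff0_eq[OF xy] Ch.scale0_eq[OF c])
  also have "\<dots> = Trunc (one ?O) \<zero>\<^bsub>?N\<^esub> d"
    using c d id_cell[of ?O]
    by (simp add: trunc_cat_hom trunc_top_smult[OF module0] trunc_id d_def trunc_top_def)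
      (simp add: trunc_module_simps)
  finally have a: "pob3 \<alpha> U V W = Trunc (one ?O) \<zero>\<^bsub>?N\<^esub> d" .
  show "pob3 \<alpha> U V W \<in> carrier ?H" "coef0 (pob3 \<alpha> U V W) = one ?O"
    using d by (simp_all add: a trunc_cat_hom trunc_module_carrier id_cell)
  have "pob3 (pn_inverse D Ch \<alpha>) U V W = Trunc (one ?O) \<zero>\<^bsub>?N\<^esub> (\<ominus>\<^bsub>?N\<^esub> d)"
    using inverse0_trunc[OF d] a by (simp add: pn_inverse_def pob3_def)
  then show "pob3 (pn_inverse D Ch \<alpha>) U V W \<in> carrier ?H"
      "coef0 (pob3 (pn_inverse D Ch \<alpha>) U V W) = one ?O"
    using d by (simp_all add: trunc_cat_hom trunc_module_carrier id_cell)
qed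

end

section \<open>The Breen polytope axiom\<close>

text \<open>Here \<open>a\<close> stands for the third relator. Writing both sides as combinations of \<open>l\<close>, \<open>r\<close> and \<open>a\<close>, the
  difference has all three coefficients equal to \<open>1/6\<close>.\<close>

lemma breen_module_identity:
  fixes N :: "('k::field_char_0, 'm) module" (structure)
  assumes N: "Module.module scalars N"
    and l: "l \<in> carrier N" and r: "r \<in> carrier N" and a: "a \<in> carrier N"
  shows "\<ominus> ((1/24) \<odot> (2 \<odot> l \<oplus> r)) \<oplus> (1/2) \<odot> ((1/2) \<odot> r) \<oplus> (1/24) \<odot> (2 \<odot> a \<oplus> r)
      = \<ominus> ((1/24) \<odot> (l \<oplus> 2 \<odot> a)) \<ominus> (1/2) \<odot> ((1/2) \<odot> l) \<oplus> (1/24) \<odot> (l \<oplus> 2 \<odot> r)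
    \<longleftrightarrow> l \<oplus> r = \<ominus> a"
    (is "?lhs = ?rhs \<longleftrightarrow> _")
proof -
  interpret N: Module.module scalars N by (rule N)
  define c where "c x y z = x \<odot> l \<oplus> (y \<odot> r \<oplus> z \<odot> a)" for x y z
  have cl: "c x y z \<in> carrier N" for x y z
    unfolding c_def using l r a by (simp add: smod[OF N])
  have ca: "c x y z \<oplus> c x' y' z' = c (x + x') (y + y') (z + z')" for x y z x' y' z'
    unfolding c_def using l r a by (simp add: smod[OF N] N.a_ac)
  have cs: "s \<odot> c x y z = c (s * x) (s * y) (s * z)" for s x y z
    unfolding c_def using l r a by (simp add: smod[OF N])
  have cn: "\<ominus> c x y z = c (- x) (- y) (- z)" for x y z
    unfolding c_def using l r a by (simp add: smod[OF N] N.minus_add)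
  have c1: "l = c 1 0 0" "r = c 0 1 0" "a = c 0 0 1"
    unfolding c_def using l r a by (simp_all add: smod[OF N])
  have L: "?lhs = c (- 1/12) (1/4) (1/12)" by (simp add: c1 cs cn ca)
  have R: "?rhs = c (- 1/4) (1/12) (- 1/12)" by (simp add: c1 cs cn ca a_minus_def)
  have "?lhs = ?rhs \<longleftrightarrow> c (1/6) (1/6) (1/6) = \<zero>"
    using N.minus_zero_iff[OF cl cl, of "- 1/12" "1/4" "1/12" "- 1/4" "1/12" "- 1/12"]
    unfolding L R by (simp add: a_minus_def cn ca)
  also have "\<dots> \<longleftrightarrow> c 1 1 1 = \<zero>"
    using cs[of 6 "1/6" "1/6" "1/6"] cs[of "1/6" 1 1 1] smod_zero_right[OF N] by auto
  also have "\<dots> \<longleftrightarrow> l \<oplus> r = \<ominus> a"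
  proof -
    have "c 1 1 1 = (l \<oplus> r) \<ominus> (\<ominus> a)"
      unfolding c_def using l r a by (simp add: smod[OF N] a_minus_def N.a_assoc)
    then show ?thesis using N.minus_zero_iff[of "l \<oplus> r" "\<ominus> a"] l r a by simp
  qed
  finally show ?thesis .
qed

context deformed_braiding
begin

lemma coef0_two [simp]: "coef0 (2 :: 'k trunc) = 2"
  using arg_cong[OF one_add_one[where 'a = "'k trunc"], of coef0]
  by (simp add: one_trunc_def plus_trunc_def)

lemma HL_eq:
  "defo_HL Ch Mh th U V W = trunc_top (hom1 C (U \<diamondop> V \<diamondop> W) (V \<diamondop> W \<diamondop> U))
    ((1/24) \<odot>\<^bsub>hom1 C (U \<diamondop> V \<diamondop> W) (V \<diamondop> W \<diamondop> U)\<^esub> (\<gamma> U (V \<diamondop> W) \<triangleright>\<^bsub>C\<^esub>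
      (2 \<odot>\<^bsub>hom1 C (U \<diamondop> V \<diamondop> W) (U \<diamondop> V \<diamondop> W)\<^esub> L U V W
        \<oplus>\<^bsub>hom1 C (U \<diamondop> V \<diamondop> W) (U \<diamondop> V \<diamondop> W)\<^esub> R U V W)))"
proof -
  let ?E = "hom1 Ch (U \<diamondop> V \<diamondop> W) (U \<diamondop> V \<diamondop> W)"
  let ?l = "relator_L Ch th U V W" and ?r = "relator_R Ch th U V W"
  interpret E: Module.module scalars ?E by (rule Ch.module1)
  note l = trunc_relator_closed(1)[of U V W] and r = trunc_relator_closed(2)[of U V W]
  note l2 = smod_closed[OF Ch.module1 l, of 2]
  have s: "scale1 Ch 2 ?l +\<^sub>1\<^bsub>Ch\<^esub> ?r = 2 \<odot>\<^bsub>?E\<^esub> ?l \<oplus>\<^bsub>?E\<^esub> ?r"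
    by (simp add: Ch.scale1_eq[OF l] Ch.add1_eq[OF l2])
  have c: "pob2 (braid Mh) U (V \<diamondop> W) \<triangleright>\<^bsub>Ch\<^esub> (2 \<odot>\<^bsub>?E\<^esub> ?l \<oplus>\<^bsub>?E\<^esub> ?r)
      \<in> carrier (hom1 Ch (U \<diamondop> V \<diamondop> W) (V \<diamondop> W \<diamondop> U))"
    using Ch.lcomp_closed[OF trunc_\<gamma>_closed[of U "V \<diamondop> W"] E.add.m_closed[OF l2 r]] by (simp add: assoc_ob)
  show ?thesis
    unfolding defo_HL_def tob_trunc s Ch.scale1_eq[OF c]
    using c by (simp add: trunc_cat_hom trunc_top_smult[OF module1] trunc_\<gamma> trunc_relator_closed)
qed

lemma HR_eq:
  "defo_HR Ch Mh th U V W = trunc_top (hom1 C (U \<diamondop> V \<diamondop> W) (W \<diamondop> U \<diamondop> V))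
    ((1/24) \<odot>\<^bsub>hom1 C (U \<diamondop> V \<diamondop> W) (W \<diamondop> U \<diamondop> V)\<^esub> (\<gamma> (U \<diamondop> V) W \<triangleright>\<^bsub>C\<^esub>
      (L U V W \<oplus>\<^bsub>hom1 C (U \<diamondop> V \<diamondop> W) (U \<diamondop> V \<diamondop> W)\<^esub>
        2 \<odot>\<^bsub>hom1 C (U \<diamondop> V \<diamondop> W) (U \<diamondop> V \<diamondop> W)\<^esub> R U V W)))"
proof -
  let ?E = "hom1 Ch (U \<diamondop> V \<diamondop> W) (U \<diamondop> V \<diamondop> W)"
  let ?l = "relator_L Ch th U V W" and ?r = "relator_R Ch th U V W"
  interpret E: Module.module scalars ?E by (rule Ch.module1)
  note l = trunc_relator_closed(1)[of U V W] and r = trunc_relator_closed(2)[of U V W]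
  note r2 = smod_closed[OF Ch.module1 r, of 2]
  have s: "?l +\<^sub>1\<^bsub>Ch\<^esub> scale1 Ch 2 ?r = ?l \<oplus>\<^bsub>?E\<^esub> 2 \<odot>\<^bsub>?E\<^esub> ?r"
    by (simp add: Ch.scale1_eq[OF r] Ch.add1_eq[OF l])
  have c: "pob2 (braid Mh) (U \<diamondop> V) W \<triangleright>\<^bsub>Ch\<^esub> (?l \<oplus>\<^bsub>?E\<^esub> 2 \<odot>\<^bsub>?E\<^esub> ?r)
      \<in> carrier (hom1 Ch (U \<diamondop> V \<diamondop> W) (W \<diamondop> U \<diamondop> V))"
    using Ch.lcomp_closed[OF _ E.add.m_closed[OF l r2]] trunc_\<gamma>_closed[of "U \<diamondop> V" W]
    by (simp add: assoc_ob)
  show ?thesis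
    unfolding defo_HR_def tob_trunc s Ch.scale1_eq[OF c]
    using c by (simp add: trunc_cat_hom trunc_top_smult[OF module1] trunc_\<gamma> trunc_relator_closed assoc_ob)
qed

text \<open>Each of the six terms is computed as \<open>h^2\<close> times the reversal applied to a combination of the three
  relators; linearity and cancellation of the reversal then leave \<open>breen_module_identity\<close>.\<close>

lemma breen_iff_coherent:
  "breen_axiom Ch Mh \<alpha> \<sigma> (defo_HL Ch Mh th) (defo_HR Ch Mh th) \<longleftrightarrow> coherent_braiding C M t"
proof -
  let ?one = "idc Ch" and ?a = "pob3 \<alpha>" and ?ai = "pob3 (pn_inverse (box (box Ch Ch) Ch) Ch \<alpha>)"
    and ?s = "pob2 \<sigma>" and ?sh = "htpy2 Ch \<sigma>"
    and ?HL = "defo_HL Ch Mh th" and ?HR = "defo_HR Ch Mh th"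
  have "neg1 Ch (?a W V U \<bullet>\<^bsub>Ch\<^esub> ten00 Ch Mh (?s V W) (?one U) \<bullet>\<^bsub>Ch\<^esub> ?ai V W U \<triangleright>\<^bsub>Ch\<^esub> ?HL U V W)
           +\<^sub>1\<^bsub>Ch\<^esub> ?a W V U \<triangleright>\<^bsub>Ch\<^esub> ?sh (?one U) (?s V W) \<triangleleft>\<^bsub>Ch\<^esub> ?a U V W
           +\<^sub>1\<^bsub>Ch\<^esub> ?HL U W V \<triangleleft>\<^bsub>Ch\<^esub> ?ai U W V \<triangleleft>\<^bsub>Ch\<^esub> ten00 Ch Mh (?one U) (?s V W) \<triangleleft>\<^bsub>Ch\<^esub> ?a U V W
         = neg1 Ch (?a W V U \<triangleright>\<^bsub>Ch\<^esub> ?HR V U W \<triangleleft>\<^bsub>Ch\<^esub> ?a V U W \<triangleleft>\<^bsub>Ch\<^esub> ten00 Ch Mh (?s U V) (?one W))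
           -\<^sub>1\<^bsub>Ch\<^esub> ?sh (?s U V) (?one W)
           +\<^sub>1\<^bsub>Ch\<^esub> ten00 Ch Mh (?one W) (?s U V) \<bullet>\<^bsub>Ch\<^esub> ?a W U V \<triangleright>\<^bsub>Ch\<^esub> ?HR U V W \<triangleleft>\<^bsub>Ch\<^esub> ?a U V W
     \<longleftrightarrow> L U V W \<oplus>\<^bsub>hom1 C (U \<diamondop> V \<diamondop> W) (U \<diamondop> V \<diamondop> W)\<^esub> R U V W
       = \<ominus>\<^bsub>hom1 C (U \<diamondop> V \<diamondop> W) (U \<diamondop> V \<diamondop> W)\<^esub> outer U V W"
    (is "neg1 Ch ?T1 +\<^sub>1\<^bsub>Ch\<^esub> ?T2 +\<^sub>1\<^bsub>Ch\<^esub> ?T3 = neg1 Ch ?S1 -\<^sub>1\<^bsub>Ch\<^esub> ?S2 +\<^sub>1\<^bsub>Ch\<^esub> ?S3 \<longleftrightarrow> _") for U V W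
  proof -
    let ?O = "U \<diamondop> V \<diamondop> W" and ?O' = "W \<diamondop> V \<diamondop> U"
    let ?E = "hom1 C ?O ?O" and ?X = "hom1 C ?O ?O'"
    let ?l = "L U V W" and ?r = "R U V W" and ?o = "outer U V W" and ?G = "reversal U V W"
    interpret E: Module.module scalars ?E by (rule module1)
    interpret X: Module.module scalars ?X by (rule module1)
    interpret Xh: Module.module scalars "hom1 Ch ?O ?O'" by (rule Ch.module1)
    note l = L_closed[of U V W] and r = R_closed[of U V W] and o = outer_closed[of U V W]
    define t1 where "t1 = (1/24) \<odot>\<^bsub>?E\<^esub> (2 \<odot>\<^bsub>?E\<^esub> ?l \<oplus>\<^bsub>?E\<^esub> ?r)"
    define t2 where "t2 = (1/2) \<odot>\<^bsub>?E\<^esub> ((1/2) \<odot>\<^bsub>?E\<^esub> ?r)"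
    define t3 where "t3 = (1/24) \<odot>\<^bsub>?E\<^esub> (2 \<odot>\<^bsub>?E\<^esub> ?o \<oplus>\<^bsub>?E\<^esub> ?r)"
    define s1 where "s1 = (1/24) \<odot>\<^bsub>?E\<^esub> (?l \<oplus>\<^bsub>?E\<^esub> 2 \<odot>\<^bsub>?E\<^esub> ?o)"
    define s2 where "s2 = (1/2) \<odot>\<^bsub>?E\<^esub> ((1/2) \<odot>\<^bsub>?E\<^esub> ?l)"
    define s3 where "s3 = (1/24) \<odot>\<^bsub>?E\<^esub> (?l \<oplus>\<^bsub>?E\<^esub> 2 \<odot>\<^bsub>?E\<^esub> ?r)"
    have cl: "t1 \<in> carrier ?E" "t2 \<in> carrier ?E" "t3 \<in> carrier ?E"
        "s1 \<in> carrier ?E" "s2 \<in> carrier ?E" "s3 \<in> carrier ?E"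
      unfolding t1_def t2_def t3_def s1_def s2_def s3_def
      using l r o by (simp_all add: smod_closed[OF module1])
    note G = reversal_cell[of U V W]
    have Gl: "linear_map ?E ?X (\<lambda>x. ?G \<triangleright>\<^bsub>C\<^esub> x)" by (rule bilinear_right[OF lcomp_bilinear G])
    have tG: "trunc_top ?X (?G \<triangleright>\<^bsub>C\<^esub> x) \<in> carrier (hom1 Ch ?O ?O')" if "x \<in> carrier ?E" for x
      unfolding trunc_cat_hom by (rule trunc_top_closed[OF module1 lcomp_closed[OF G that]])
    have s_one: "ten00 Ch Mh (?s A B) (?one D) \<in> carrier (hom0 Ch (A \<diamondop> B \<diamondop> D) (B \<diamondop> A \<diamondop> D))"
        "coef0 (ten00 Ch Mh (?s A B) (?one D)) = \<gamma> A B \<star> one D" for A B D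
      using ten00_trunc_closed[OF \<sigma>_cell(1) Ch.id_cell, of A B D]
      by (simp_all add: assoc_ob \<sigma>_cell trunc_id_const)
    have one_s: "ten00 Ch Mh (?one D) (?s A B) \<in> carrier (hom0 Ch (D \<diamondop> A \<diamondop> B) (D \<diamondop> B \<diamondop> A))"
        "coef0 (ten00 Ch Mh (?one D) (?s A B)) = one D \<star> \<gamma> A B" for A B D
      using ten00_trunc_closed[OF Ch.id_cell \<sigma>_cell(1), of D A B]
      by (simp_all add: assoc_ob \<sigma>_cell trunc_id_const)
    note a = \<alpha>_cell(1,2) \<alpha>_cell(3,4)[where D = "box (box Ch Ch) Ch"]
    \<comment> \<open>The terms in the order of the axiom; \<open>t1\<close> and \<open>s1\<close> are taken without their sign.\<close>
    have T1: "?T1 = trunc_top ?X (?G \<triangleright>\<^bsub>C\<^esub> t1)"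
    proof -
      have x: "2 \<odot>\<^bsub>?E\<^esub> ?l \<oplus>\<^bsub>?E\<^esub> ?r \<in> carrier ?E" using l r by (simp add: smod_closed[OF module1])
      note k = Ch.comp0_closed[OF Ch.comp0_closed[OF a(1)[of W V U] s_one(1)[of V W U]] a(3)[of V W U]]
      have "?T1 = trunc_top ?X (\<gamma> V W \<star> one U \<triangleright>\<^bsub>C\<^esub> ((1/24) \<odot>\<^bsub>hom1 C ?O (V \<diamondop> W \<diamondop> U)\<^esub>
          (\<gamma> U (V \<diamondop> W) \<triangleright>\<^bsub>C\<^esub> (2 \<odot>\<^bsub>?E\<^esub> ?l \<oplus>\<^bsub>?E\<^esub> ?r))))"
        unfolding HL_eq
        by (subst trunc_lcomp_top[OF k smod_closed[OF module1 lcomp_closed[OF \<gamma>_right x]]])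
          (simp add: a s_one comp0_id[OF \<gamma>_one])
      then show ?thesis
        unfolding lcomp_smult_lcomp[OF \<gamma>_one \<gamma>_right x] reversal_eq t1_def .
    qed
    have T2: "?T2 = trunc_top ?X (?G \<triangleright>\<^bsub>C\<^esub> t2)"
    proof -
      note c = lcomp_closed[OF G cl(2)]
      show ?thesis
        unfolding \<sigma>_one_\<sigma> t2_def[symmetric] trunc_lcomp_top[OF a(1) c] a(2)
        using comp1_id[OF c] trunc_rcomp_top[OF c a(1)] by (simp add: a)
    qed
    have T3: "?T3 = trunc_top ?X (?G \<triangleright>\<^bsub>C\<^esub> t3)"
    proof -
      let ?F = "hom1 C (U \<diamondop> W \<diamondop> V) (U \<diamondop> W \<diamondop> V)"
      let ?x = "2 \<odot>\<^bsub>?F\<^esub> L U W V \<oplus>\<^bsub>?F\<^esub> R U W V"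
      interpret F: Module.module scalars ?F by (rule module1)
      have x: "?x \<in> carrier ?F"
        using L_closed[of U W V] R_closed[of U W V] by (simp add: smod_closed[OF module1])
      have x': "2 \<odot>\<^bsub>?E\<^esub> ?o \<oplus>\<^bsub>?E\<^esub> ?r \<in> carrier ?E" using o r by (simp add: smod_closed[OF module1])
      have c: "?x \<triangleleft>\<^bsub>C\<^esub> one U \<star> \<gamma> V W = one U \<star> \<gamma> V W \<triangleright>\<^bsub>C\<^esub> (2 \<odot>\<^bsub>?E\<^esub> ?o \<oplus>\<^bsub>?E\<^esub> ?r)"
        using comb_commute[OF one_\<gamma> L_closed R_closed o r L_outer R_commute, of 2 1]
        by (simp add: smod_one[OF module1] R_closed)
      define y where "y = (1/24) \<odot>\<^bsub>hom1 C (U \<diamondop> W \<diamondop> V) ?O'\<^esub> (\<gamma> U (W \<diamondop> V) \<triangleright>\<^bsub>C\<^esub> ?x)"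
      have y: "y \<in> htp (U \<diamondop> W \<diamondop> V) ?O'"
        unfolding y_def by (rule smod_closed[OF module1 lcomp_closed[OF \<gamma>_right x]])
      note yk = rcomp_closed[OF y one_\<gamma>[of U V W]]
      have "?T3 = trunc_top ?X (y \<triangleleft>\<^bsub>C\<^esub> one U \<star> \<gamma> V W)"
        unfolding HL_eq y_def[symmetric]
        using trunc_rcomp_top[OF y a(3)[of U W V]] trunc_rcomp_top[OF y one_s(1)[of U V W]]
          trunc_rcomp_top[OF yk a(1)[of U V W]] comp1_id[OF y] comp1_id[OF yk]
        by (simp add: a one_s)
      then show ?thesis
        unfolding y_def smult_lcomp_rcomp[OF \<gamma>_right one_\<gamma> x x' c] reversal_def[symmetric] t3_def .
    qed
    have S1: "?S1 = trunc_top ?X (?G \<triangleright>\<^bsub>C\<^esub> s1)"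
    proof -
      let ?F = "hom1 C (V \<diamondop> U \<diamondop> W) (V \<diamondop> U \<diamondop> W)"
      let ?x = "L V U W \<oplus>\<^bsub>?F\<^esub> 2 \<odot>\<^bsub>?F\<^esub> R V U W"
      interpret F: Module.module scalars ?F by (rule module1)
      have x: "?x \<in> carrier ?F"
        using L_closed[of V U W] R_closed[of V U W] by (simp add: smod_closed[OF module1])
      have x': "?l \<oplus>\<^bsub>?E\<^esub> 2 \<odot>\<^bsub>?E\<^esub> ?o \<in> carrier ?E" using o l by (simp add: smod_closed[OF module1])
      have c: "?x \<triangleleft>\<^bsub>C\<^esub> \<gamma> U V \<star> one W = \<gamma> U V \<star> one W \<triangleright>\<^bsub>C\<^esub> (?l \<oplus>\<^bsub>?E\<^esub> 2 \<odot>\<^bsub>?E\<^esub> ?o)"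
        using comb_commute[OF \<gamma>_one L_closed R_closed l o L_commute R_outer, of 1 2]
        by (simp add: smod_one[OF module1] L_closed)
      define y where "y = (1/24) \<odot>\<^bsub>hom1 C (V \<diamondop> U \<diamondop> W) ?O'\<^esub> (\<gamma> (V \<diamondop> U) W \<triangleright>\<^bsub>C\<^esub> ?x)"
      have y: "y \<in> htp (V \<diamondop> U \<diamondop> W) ?O'"
        unfolding y_def by (rule smod_closed[OF module1 lcomp_closed[OF \<gamma>_left x]])
      have "?S1 = trunc_top ?X (y \<triangleleft>\<^bsub>C\<^esub> \<gamma> U V \<star> one W)"
        unfolding HR_eq y_def[symmetric]
        using trunc_lcomp_top[OF a(1)[of W V U] y] trunc_rcomp_top[OF y a(1)[of V U W]]
          trunc_rcomp_top[OF y s_one(1)[of U V W]] comp1_id[OF y]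
        by (simp add: a s_one)
      then show ?thesis
        unfolding y_def smult_lcomp_rcomp[OF \<gamma>_left \<gamma>_one x x' c] reversal_eq s1_def .
    qed
    have S2: "?S2 = trunc_top ?X (?G \<triangleright>\<^bsub>C\<^esub> s2)"
      unfolding \<sigma>_\<sigma>_one s2_def ..
    have S3: "?S3 = trunc_top ?X (?G \<triangleright>\<^bsub>C\<^esub> s3)"
    proof -
      have x: "?l \<oplus>\<^bsub>?E\<^esub> 2 \<odot>\<^bsub>?E\<^esub> ?r \<in> carrier ?E" using l r by (simp add: smod_closed[OF module1])
      note k = Ch.comp0_closed[OF one_s(1)[of W U V] a(1)[of W U V]]
      note c = lcomp_closed[OF G cl(6)]
      have "ten00 Ch Mh (?one W) (?s U V) \<bullet>\<^bsub>Ch\<^esub> ?a W U V \<triangleright>\<^bsub>Ch\<^esub> ?HR U V W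
         = trunc_top ?X (one W \<star> \<gamma> U V \<triangleright>\<^bsub>C\<^esub> ((1/24) \<odot>\<^bsub>hom1 C ?O (W \<diamondop> U \<diamondop> V)\<^esub>
          (\<gamma> (U \<diamondop> V) W \<triangleright>\<^bsub>C\<^esub> (?l \<oplus>\<^bsub>?E\<^esub> 2 \<odot>\<^bsub>?E\<^esub> ?r))))"
        unfolding HR_eq
        by (subst trunc_lcomp_top[OF k smod_closed[OF module1 lcomp_closed[OF \<gamma>_left x]]])
          (simp add: a one_s comp0_id[OF one_\<gamma>])
      also have "\<dots> = trunc_top ?X (?G \<triangleright>\<^bsub>C\<^esub> s3)"
        unfolding lcomp_smult_lcomp[OF one_\<gamma> \<gamma>_left x] reversal_eq s3_def ..
      finally show ?thesis
        using trunc_rcomp_top[OF c a(1)[of U V W]] comp1_id[OF c] by (simp add: a)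
    qed
    have neg: "neg1 Ch (trunc_top ?X (?G \<triangleright>\<^bsub>C\<^esub> x)) = trunc_top ?X (?G \<triangleright>\<^bsub>C\<^esub> (\<ominus>\<^bsub>?E\<^esub> x))"
      if "x \<in> carrier ?E" for x
      unfolding Ch.neg1_eq[OF tG[OF that]]
      using trunc_top_neg[OF module1 lcomp_closed[OF G that]]
        linear_map_neg[OF module1 module1 Gl that]
      by (simp add: trunc_cat_hom)
    have add: "trunc_top ?X (?G \<triangleright>\<^bsub>C\<^esub> x) +\<^sub>1\<^bsub>Ch\<^esub> trunc_top ?X (?G \<triangleright>\<^bsub>C\<^esub> y)
        = trunc_top ?X (?G \<triangleright>\<^bsub>C\<^esub> (x \<oplus>\<^bsub>?E\<^esub> y))"
      if "x \<in> carrier ?E" "y \<in> carrier ?E" for x y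
      unfolding Ch.add1_eq[OF tG[OF that(1)]]
      using linear_map_add[OF Gl that] by (simp add: trunc_cat_hom trunc_top_add[OF module1])
    have diff: "trunc_top ?X (?G \<triangleright>\<^bsub>C\<^esub> x) -\<^sub>1\<^bsub>Ch\<^esub> trunc_top ?X (?G \<triangleright>\<^bsub>C\<^esub> y)
        = trunc_top ?X (?G \<triangleright>\<^bsub>C\<^esub> (x \<ominus>\<^bsub>?E\<^esub> y))"
      if "x \<in> carrier ?E" "y \<in> carrier ?E" for x y
      unfolding Ch.diff1_eq[OF tG[OF that(1)]]
      using linear_map_add[OF Gl that(1) E.a_inv_closed[OF that(2)]]
        linear_map_neg[OF module1 module1 Gl that(2)]
      by (simp add: trunc_cat_hom trunc_top_add[OF module1]
          trunc_top_neg[OF module1 lcomp_closed[OF G that(2)]] a_minus_def)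
    have inj: "?G \<triangleright>\<^bsub>C\<^esub> x = ?G \<triangleright>\<^bsub>C\<^esub> y \<longleftrightarrow> x = y" if "x \<in> carrier ?E" "y \<in> carrier ?E" for x y
    proof
      obtain k where k: "k \<in> hom ?O' ?O" "k \<bullet>\<^bsub>C\<^esub> ?G = one ?O" by (rule reversal_retract)
      assume "?G \<triangleright>\<^bsub>C\<^esub> x = ?G \<triangleright>\<^bsub>C\<^esub> y"
      then have "k \<bullet>\<^bsub>C\<^esub> ?G \<triangleright>\<^bsub>C\<^esub> x = k \<bullet>\<^bsub>C\<^esub> ?G \<triangleright>\<^bsub>C\<^esub> y"
        using assoc001[OF k(1) G] that by simp
      then show "x = y" using comp1_id that by (simp add: k(2))
    qed simp
    have "neg1 Ch ?T1 +\<^sub>1\<^bsub>Ch\<^esub> ?T2 +\<^sub>1\<^bsub>Ch\<^esub> ?T3 = neg1 Ch ?S1 -\<^sub>1\<^bsub>Ch\<^esub> ?S2 +\<^sub>1\<^bsub>Ch\<^esub> ?S3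
      \<longleftrightarrow> \<ominus>\<^bsub>?E\<^esub> t1 \<oplus>\<^bsub>?E\<^esub> t2 \<oplus>\<^bsub>?E\<^esub> t3 = \<ominus>\<^bsub>?E\<^esub> s1 \<ominus>\<^bsub>?E\<^esub> s2 \<oplus>\<^bsub>?E\<^esub> s3"
      unfolding T1 T2 T3 S1 S2 S3 using cl by (simp add: neg add diff inj)
    also have "\<dots> \<longleftrightarrow> ?l \<oplus>\<^bsub>?E\<^esub> ?r = \<ominus>\<^bsub>?E\<^esub> ?o"
      unfolding t1_def t2_def t3_def s1_def s2_def s3_def
      by (rule breen_module_identity[OF module1 l r o])
    finally show ?thesis .
  qed
  then show ?thesis unfolding coherent_iff breen_axiom_def Let_def by simp
qed

end

theorem proposition5p29:
  fixes C :: "('k::field_char_0, 'o, 'a, 'b) ch_cat"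
    and M :: "('k, 'o, 'a, 'b) smon"
    and t :: "('o \<times> 'o, ('k, 'o, 'o, 'a, 'a) box0, 'a, 'b) pnat"
  assumes "symmetric_strict_monoidal C M"
    and "infinitesimal_2_braiding C M t"
    and "strict_braiding C M t"
    and "totally_symmetric_braiding C M t"
  defines "Ch \<equiv> trunc_cat C" and "Mh \<equiv> trunc_smon C M" and "th \<equiv> trunc_braiding C M t"
  shows "breen_axiom Ch Mh (defo_assoc Ch Mh th) (defo_braid Ch Mh th)
           (defo_HL Ch Mh th) (defo_HR Ch Mh th)
         \<longleftrightarrow> coherent_braiding C M t"
proof -
  interpret infinitesimal_2_braiding C M t by (rule assms(2))
  interpret deformed_braiding C M t by unfold_locales (rule assms(4))
  show ?thesis unfolding Ch_def Mh_def th_def by (rule breen_iff_coherent)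
qed

end
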